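(* Let $q\ge3$ be a squarefree odd integer, let $\chi$ be a primitive non-principal Dirichlet character modulo $q$, and assume GRH for $L(s,\chi)$. Fix a real $K>0$. There exist constants $C_K=C_K(K,q,\chi)>0$ and $T_0=T_0(K,q,\chi)\ge3$ such that for every $T\ge T_0$ and every integer $k$ with $1\le k\le K L_T$, $$\frac1T\int_T^{2T}|X_\chi(t)|^{2k}\,dt\le (C_K\,k\,L_T)^k,$$ and for any such constants $C_K,T_0$ the following holds: for every $T\ge T_0$ and every real $V$ with $$\sqrt{e\,C_K\,L_T}\;\le\;V\;\le\;\sqrt{e\,C_K\,K}\cdot L_T,$$ one has $$\frac1T\,\operatorname{meas}\{t\in[T,2T]:|X_\chi(t)|>V\}\;\le\;\exp\!\Bigl(-\frac{V^2}{2\,e\,C_K\,L_T}\Bigr).$$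
   Context: GRH for $L(s,\chi)$ means that every nontrivial zero of $L(s,\chi)$ (zero with $0<\operatorname{Re}s<1$) satisfies $\operatorname{Re}s=\tfrac12$. For real $t$ with $L(\tfrac12+it,\chi)\neq 0$, $X_\chi(t):=\operatorname{Im}\log L(\tfrac12+it,\chi)$, where $\log L(s,\chi)$ is obtained by starting from the principal branch at $\operatorname{Re}s=+\infty$ (so $\log L\to 0$ as $\operatorname{Re}s\to+\infty$) and continuing analytically along the horizontal line $\operatorname{Im}s=t$ down to $\operatorname{Re}s=\tfrac12$. Equivalently $X_\chi(t)=-\int_{1/2}^\infty \operatorname{Im}\frac{L'}{L}(\sigma+it,\chi)\,d\sigma$. The values of $X_\chi$ at the countably many $t$ with $L(\tfrac12+it,\chi)=0$ may be assigned arbitrarily. $L_T:=\log\log(qT)$; $e$ is the base of natural logarithms; $\operatorname{meas}$ is Lebesgue measure. *)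

theory Defs
  imports "HOL-Complex_Analysis.Complex_Analysis" "HOL-Computational_Algebra.Squarefree"
begin

text \<open>A character modulo \<open>q\<close> is given by its values on the natural numbers, which
  represent all residue classes. Total multiplicativity and \<open>chi 1 \<noteq> 0\<close> give \<open>chi 1 = 1\<close>.\<close>

definition dirichlet_character :: "nat \<Rightarrow> (nat \<Rightarrow> complex) \<Rightarrow> bool" where
  "dirichlet_character q chi \<longleftrightarrow>
     (\<forall>m n. chi (m * n) = chi m * chi n) \<and>
     (\<forall>n. chi (n + q) = chi n) \<and>
     (\<forall>n. chi n = 0 \<longleftrightarrow> \<not> coprime n q)"

definition principal_character :: "nat \<Rightarrow> nat \<Rightarrow> complex" where
  "principal_character q n = (if coprime n q then 1 else 0)"

definition induced_from :: "nat \<Rightarrow> (nat \<Rightarrow> complex) \<Rightarrow> nat \<Rightarrow> bool" where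
  "induced_from q chi d \<longleftrightarrow>
     (\<exists>\<psi>. dirichlet_character d \<psi> \<and> (\<forall>n. coprime n q \<longrightarrow> chi n = \<psi> n))"

definition primitive_character :: "nat \<Rightarrow> (nat \<Rightarrow> complex) \<Rightarrow> bool" where
  "primitive_character q chi \<longleftrightarrow>
     dirichlet_character q chi \<and> (\<forall>d. d dvd q \<and> d < q \<longrightarrow> \<not> induced_from q chi d)"

text \<open>For non-principal \<open>chi\<close> the series converges (conditionally) and is holomorphic
  on the whole half-plane \<open>Re s > 0\<close>, see \<open>dirichlet_L_holomorphic\<close> and
  \<open>dirichlet_L_summable\<close> below. It is therefore the analytic continuation to this
  half-plane of the series on \<open>Re s > 1\<close>. The value for \<open>Re s \<le> 0\<close> is not meaningful;
  it is never used.\<close>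

definition dirichlet_L :: "(nat \<Rightarrow> complex) \<Rightarrow> complex \<Rightarrow> complex" where
  "dirichlet_L chi s = (\<Sum>n. chi (Suc n) / of_nat (Suc n) powr s)"

definition GRH :: "(nat \<Rightarrow> complex) \<Rightarrow> bool" where
  "GRH chi \<longleftrightarrow> (\<forall>s. 0 < Re s \<and> Re s < 1 \<and> dirichlet_L chi s = 0 \<longrightarrow> Re s = 1 / 2)"

definition right_ray :: "complex \<Rightarrow> complex set" where
  "right_ray s = {z. Im z = Im s \<and> Re z \<ge> Re s}"

text \<open>\<open>g\<close> is the branch of \<open>log L\<close> along the horizontal ray to the right of \<open>s\<close> that
  tends to \<open>0\<close> at \<open>+\<infinity>\<close>. For \<open>Re s > 0\<close> such a \<open>g\<close> exists iff \<open>L\<close> has no zero on the ray, and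
  its value at \<open>s\<close> is then unique (\<open>log_dirichlet_L_eqI\<close>). If there is a zero, the value
  \<open>log_dirichlet_L chi s\<close> is unspecified.\<close>

definition is_log_L_branch :: "(nat \<Rightarrow> complex) \<Rightarrow> complex \<Rightarrow> (complex \<Rightarrow> complex) \<Rightarrow> bool" where
  "is_log_L_branch chi s g \<longleftrightarrow>
     g analytic_on right_ray s \<and>
     (\<forall>z\<in>right_ray s. exp (g z) = dirichlet_L chi z) \<and>
     ((\<lambda>\<sigma>. g (Complex \<sigma> (Im s))) \<longlongrightarrow> 0) at_top"

definition log_dirichlet_L :: "(nat \<Rightarrow> complex) \<Rightarrow> complex \<Rightarrow> complex" where
  "log_dirichlet_L chi s = (THE w. \<exists>g. is_log_L_branch chi s g \<and> w = g s)"

text \<open>\<open>X\<close> is left arbitrary at the ordinates of zeros on the critical line.\<close>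

definition is_X :: "(nat \<Rightarrow> complex) \<Rightarrow> (real \<Rightarrow> real) \<Rightarrow> bool" where
  "is_X chi X \<longleftrightarrow>
     (\<forall>t. dirichlet_L chi (Complex (1 / 2) t) \<noteq> 0 \<longrightarrow>
          X t = Im (log_dirichlet_L chi (Complex (1 / 2) t)))"

definition LT :: "nat \<Rightarrow> real \<Rightarrow> real" where
  "LT q T = ln (ln (real q * T))"

text \<open>Integrability and measurability are stated explicitly because \<open>set_lebesgue_integral\<close>
  and \<open>measure\<close> return \<open>0\<close> where they are undefined.\<close>

definition moment_bound ::
  "nat \<Rightarrow> (real \<Rightarrow> real) \<Rightarrow> real \<Rightarrow> real \<Rightarrow> real \<Rightarrow> bool" where
  "moment_bound q X K C T0 \<longleftrightarrow>
     (\<forall>T\<ge>T0. \<forall>k::nat. 1 \<le> k \<and> real k \<le> K * LT q T \<longrightarrow>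
        set_integrable lebesgue {T..2*T} (\<lambda>t. \<bar>X t\<bar> ^ (2 * k)) \<and>
        1 / T * (LINT t:{T..2*T}|lebesgue. \<bar>X t\<bar> ^ (2 * k)) \<le> (C * real k * LT q T) ^ k)"

definition tail_bound ::
  "nat \<Rightarrow> (real \<Rightarrow> real) \<Rightarrow> real \<Rightarrow> real \<Rightarrow> real \<Rightarrow> bool" where
  "tail_bound q X K C T0 \<longleftrightarrow>
     (\<forall>T\<ge>T0. \<forall>V. sqrt (exp 1 * C * LT q T) \<le> V \<and> V \<le> sqrt (exp 1 * C * K) * LT q T \<longrightarrow>
        {t\<in>{T..2*T}. \<bar>X t\<bar> > V} \<in> sets lebesgue \<and>
        1 / T * measure lebesgue {t\<in>{T..2*T}. \<bar>X t\<bar> > V}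
          \<le> exp (- (V\<^sup>2 / (2 * exp 1 * C * LT q T))))"


lemma dirichlet_character_mod:
  assumes "dirichlet_character q chi"
  shows "chi (n mod q) = chi n"
proof -
  have "chi (m + k * q) = chi m" for m k
  proof (induction k)
    case (Suc k)
    have "chi (m + Suc k * q) = chi ((m + k * q) + q)" by (simp add: algebra_simps)
    also have "\<dots> = chi (m + k * q)" using assms unfolding dirichlet_character_def by blast
    finally show ?case using Suc by simp
  qed simp
  from this[of "n mod q" "n div q"] show ?thesis by simp
qed

lemma sum_character_eq_0:
  assumes chi: "dirichlet_character q chi" and "chi \<noteq> principal_character q" and q: "q > 0"
  shows "sum chi {..<q} = 0"
proof -
  have mult: "chi (m * n) = chi m * chi n" and zero: "chi n = 0 \<longleftrightarrow> \<not> coprime n q" for m n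
    using chi by (auto simp: dirichlet_character_def)
  obtain b where "chi b \<noteq> principal_character q b" using assms(2) by (meson ext)
  then have b: "coprime b q" "chi b \<noteq> 1"
    using zero[of b] by (auto simp: principal_character_def split: if_splits)
  have inj: "inj_on (\<lambda>a. (a * b) mod q) {..<q}"
  proof (rule inj_onI)
    fix x y assume xy: "x \<in> {..<q}" "y \<in> {..<q}" "(x * b) mod q = (y * b) mod q"
    then have "int q dvd (int x - int y) * int b"
      by (simp add: mod_eq_dvd_iff left_diff_distrib flip: of_nat_mult zmod_int)
         (metis of_nat_mod mod_eq_dvd_iff)
    then have "int q dvd int x - int y"
      using b(1) by (simp add: coprime_dvd_mult_left_iff coprime_commute)
    then have "int x mod int q = int y mod int q" by (simp add: mod_eq_dvd_iff)
    then show "x = y" using xy by simp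
  qed
  have "(\<lambda>a. (a * b) mod q) ` {..<q} = {..<q}"
    using q by (intro card_subset_eq) (auto simp: card_image[OF inj])
  with inj have "bij_betw (\<lambda>a. (a * b) mod q) {..<q} {..<q}" by (simp add: bij_betw_def)
  then have "sum chi {..<q} = (\<Sum>a<q. chi ((a * b) mod q))"
    by (rule sum.reindex_bij_betw[symmetric])
  also have "\<dots> = chi b * sum chi {..<q}"
    by (simp add: dirichlet_character_mod[OF chi] mult sum_distrib_left mult.commute)
  finally show ?thesis using b(2) by simp
qed

lemma norm_character_le_1:
  assumes chi: "dirichlet_character q chi" and q: "q > 0"
  shows "norm (chi n) \<le> 1"
proof (rule ccontr)
  assume "\<not> norm (chi n) \<le> 1"
  then have gt: "norm (chi n) > 1" by simp
  have mult: "chi (m * n) = chi m * chi n" and zero: "chi n = 0 \<longleftrightarrow> \<not> coprime n q" for m n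
    using chi by (auto simp: dirichlet_character_def)
  have "chi 1 * chi 1 = chi 1" "chi 1 \<noteq> 0" using mult[of 1 1] zero[of 1] by auto
  then have 1: "chi 1 = 1" by simp
  have pow: "chi (n ^ k) = chi n ^ k" for k by (induction k) (use 1 in \<open>auto simp: mult\<close>)
  obtain k where k: "norm (chi n) ^ k > (\<Sum>a<q. norm (chi a))"
    using real_arch_pow[OF gt] by blast
  have "norm (chi n) ^ k = norm (chi (n ^ k mod q))"
    by (simp add: dirichlet_character_mod[OF chi] pow norm_power)
  also have "\<dots> \<le> (\<Sum>a<q. norm (chi a))"
    using q by (intro member_le_sum) auto
  finally show False using k by simp
qed

lemma norm_character_partial_sum_le:
  assumes chi: "dirichlet_character q chi" and np: "chi \<noteq> principal_character q" and q: "q > 1"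
  shows "norm (\<Sum>k<n. chi (Suc k)) \<le> real q"
proof -
  have "chi 0 = 0" using chi q by (simp add: dirichlet_character_def)
  then have eq: "(\<Sum>k<n. chi (Suc k)) = sum chi {..<Suc n}" for n
    by (simp add: sum.lessThan_Suc_shift del: sum.lessThan_Suc)
  have split: "sum chi {..<n + q} = sum chi {..<q} + (\<Sum>i<n. chi (i + q))" for n
    by (induction n) (simp_all add: add_ac)
  have per: "sum chi {..<m + q * j} = sum chi {..<m}" for m j
  proof (induction j)
    case (Suc j)
    have "sum chi {..<m + q * Suc j} = sum chi {..<(m + q * j) + q}" by (simp add: algebra_simps)
    also have "\<dots> = sum chi {..<q} + (\<Sum>i<m + q * j. chi (i + q))"
      by (rule split)
    also have "\<dots> = sum chi {..<m + q * j}"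
      using chi q by (simp add: sum_character_eq_0[OF chi np] dirichlet_character_def)
    finally show ?case using Suc by simp
  qed simp
  have "(\<Sum>k<n. chi (Suc k)) = sum chi {..<Suc n mod q}"
    using per[of "Suc n mod q" "Suc n div q"] by (simp add: eq)
  also have "norm \<dots> \<le> (\<Sum>k<Suc n mod q. 1)"
    using norm_character_le_1[OF chi] q by (intro sum_norm_le) auto
  also have "\<dots> \<le> real q" using q by (simp add: less_imp_le)
  finally show ?thesis .
qed

lemma norm_powr_diff_le:
  fixes s :: complex
  assumes s: "Re s > 0"
  shows "norm (of_nat (Suc n) powr (-s) - of_nat (Suc (Suc n)) powr (-s))
           \<le> norm s * real (Suc n) powr (- Re s - 1)"
proof -
  let ?S = "closed_segment (of_nat (Suc n)) (of_nat (Suc (Suc n))) :: complex set"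
  have S: "Re z \<ge> Suc n \<and> Im z = 0" if "z \<in> ?S" for z
  proof -
    have "z \<in> closed_segment (complex_of_real (Suc n)) (complex_of_real (Suc (Suc n)))"
      using that by simp
    then show ?thesis
      by (simp only: closed_segment_of_real) (auto simp: closed_segment_eq_real_ivl split: if_splits)
  qed
  have "norm (of_nat (Suc n) powr (-s) - of_nat (Suc (Suc n)) powr (-s))
          \<le> norm s * real (Suc n) powr (- Re s - 1) *
             norm (of_nat (Suc n) - of_nat (Suc (Suc n)) :: complex)"
  proof (rule field_differentiable_bound[where S = ?S and f' = "\<lambda>z. -s * z powr (-s - 1)"])
    fix z assume z: "z \<in> ?S"
    then have pos: "Re z > 0" "Im z = 0" using S[of z] by auto
    then have "z \<notin> \<real>\<^sub>\<le>\<^sub>0" by (auto simp: complex_nonpos_Reals_iff)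
    then show "((\<lambda>z. z powr (-s)) has_field_derivative -s * z powr (-s - 1)) (at z within ?S)"
      by (auto intro!: derivative_eq_intros)
    have zr: "z = complex_of_real (Re z)" using pos by (simp add: complex_eq_iff)
    have "norm (z powr (-s - 1)) = Re z powr (- Re s - 1)"
      using pos by (subst zr, subst norm_powr_real_powr) auto
    also have "\<dots> \<le> real (Suc n) powr (- Re s - 1)"
      using S[OF z] s by (intro powr_mono2') auto
    finally show "norm (-s * z powr (-s - 1)) \<le> norm s * real (Suc n) powr (- Re s - 1)"
      by (simp add: norm_mult mult_left_mono)
  qed auto
  then show ?thesis by (simp add: norm_mult)
qed

lemma dirichlet_L_partial_sum:
  fixes s :: complex
  defines "S \<equiv> (\<lambda>chi n. \<Sum>k<n. chi (Suc k) :: complex)"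
  shows "(\<Sum>n<N. chi (Suc n) / of_nat (Suc n) powr s) =
           (\<Sum>n<N. S chi (Suc n) * (of_nat (Suc n) powr (-s) - of_nat (Suc (Suc n)) powr (-s)))
             + S chi N * of_nat (Suc N) powr (-s)"
  by (induction N) (simp_all add: S_def powr_minus field_simps del: of_nat_Suc)

lemma dirichlet_L_aux:
  assumes chi: "dirichlet_character q chi" and np: "chi \<noteq> principal_character q" and q: "q > 1"
  defines "u \<equiv> (\<lambda>n s. (\<Sum>k<Suc n. chi (Suc k)) *
                  (of_nat (Suc n) powr (-s) - of_nat (Suc (Suc n)) powr (-s)))"
  shows "Re s > 0 \<Longrightarrow> norm (u n s) \<le> real q * (norm s * real (Suc n) powr (- Re s - 1))"
    and "Re s > 0 \<Longrightarrow> (\<lambda>n. chi (Suc n) / of_nat (Suc n) powr s) sums (\<Sum>n. u n s)"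
proof -
  show bound: "norm (u n s) \<le> real q * (norm s * real (Suc n) powr (- Re s - 1))"
    if "Re s > 0" for n s
    unfolding u_def norm_mult
    by (intro mult_mono norm_character_partial_sum_le[OF chi np q] norm_powr_diff_le[OF that])
       (use q in auto)
  show "(\<lambda>n. chi (Suc n) / of_nat (Suc n) powr s) sums (\<Sum>n. u n s)" if s: "Re s > 0"
  proof -
    have "summable (\<lambda>n. real n powr (- Re s - 1))"
      using s by (simp add: summable_real_powr_iff)
    then have "summable (\<lambda>n. real (Suc n) powr (- Re s - 1))"
      by (subst summable_Suc_iff)
    then have "summable (\<lambda>n. real q * (norm s * real (Suc n) powr (- Re s - 1)))"
      by (intro summable_mult)
    then have "summable (\<lambda>n. u n s)"
      by (rule summable_comparison_test') (rule bound[OF s])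
    then have lim1: "(\<lambda>N. \<Sum>n<N. u n s) \<longlonglongrightarrow> (\<Sum>n. u n s)"
      by (rule summable_LIMSEQ)
    have lim2: "(\<lambda>N. (\<Sum>k<N. chi (Suc k)) * of_nat (Suc N) powr (-s)) \<longlonglongrightarrow> 0"
    proof (rule Lim_null_comparison)
      have *: "norm (complex_of_nat (Suc N) powr (-s)) = real (Suc N) powr (- Re s)" for N
        by (subst of_real_of_nat_eq[symmetric], subst norm_powr_real_powr) auto
      show "\<forall>\<^sub>F N in sequentially. norm ((\<Sum>k<N. chi (Suc k)) * of_nat (Suc N) powr (-s))
              \<le> real q * real (Suc N) powr (- Re s)"
        unfolding norm_mult *
        using norm_character_partial_sum_le[OF chi np q] by (intro always_eventually allI mult_right_mono) auto
      have "filterlim (\<lambda>N. real (Suc N)) at_top sequentially"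
        by (rule filterlim_compose[OF filterlim_real_sequentially filterlim_Suc])
      then have "(\<lambda>N. real (Suc N) powr (- Re s)) \<longlonglongrightarrow> 0"
        using s by (intro tendsto_neg_powr) auto
      from tendsto_mult_left[OF this, of "real q"]
      show "(\<lambda>N. real q * real (Suc N) powr (- Re s)) \<longlonglongrightarrow> 0" by simp
    qed
    from tendsto_add[OF lim1 lim2] show ?thesis
      unfolding sums_def dirichlet_L_partial_sum u_def by (simp only: add_0_right)
  qed
qed

theorem dirichlet_L_summable:
  assumes "dirichlet_character q chi" "chi \<noteq> principal_character q" "q > 1" "Re s > 0"
  shows "summable (\<lambda>n. chi (Suc n) / of_nat (Suc n) powr s)"
  using dirichlet_L_aux(2)[OF assms(1,2,3,4)] by (rule sums_summable)

theorem dirichlet_L_holomorphic: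
  assumes chi: "dirichlet_character q chi" and np: "chi \<noteq> principal_character q" and q: "q > 1"
  shows "dirichlet_L chi holomorphic_on {s. Re s > 0}"
proof -
  define u :: "nat \<Rightarrow> complex \<Rightarrow> complex" where
    "u = (\<lambda>n s. (\<Sum>k<Suc n. chi (Suc k)) *
                  (of_nat (Suc n) powr (-s) - of_nat (Suc (Suc n)) powr (-s)))"
  note aux = dirichlet_L_aux[OF chi np q]
  have L: "dirichlet_L chi s = (\<Sum>n. u n s)" if "Re s > 0" for s
    unfolding dirichlet_L_def u_def by (rule sums_unique[OF aux(2)[OF that], symmetric])
  have opn: "open {s. Re s > 0}" by (rule open_halfspace_Re_gt)
  have "(\<lambda>s. \<Sum>n. u n s) holomorphic_on {s. Re s > 0}"
  proof (rule holomorphic_uniform_sequence[OF opn])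
    show "(\<lambda>s. \<Sum>n<N. u n s) holomorphic_on {s. Re s > 0}" for N
      unfolding u_def by (intro holomorphic_intros)
    fix x :: complex assume x: "x \<in> {s. Re s > 0}"
    define d where "d = Re x / 2"
    have d: "d > 0" using x by (simp add: d_def)
    have re: "Re s \<ge> d" and nm: "norm s \<le> norm x + d" if "s \<in> cball x d" for s
    proof -
      have *: "norm (x - s) \<le> d" using that by (simp add: dist_norm)
      then show "Re s \<ge> d" using complex_Re_le_cmod[of "x - s"] by (simp add: d_def)
      show "norm s \<le> norm x + d" using * norm_triangle_sub[of s x] by (simp add: norm_minus_commute)
    qed
    have "uniform_limit (cball x d) (\<lambda>N s. \<Sum>n<N. u n s) (\<lambda>s. \<Sum>n. u n s) sequentially"
    proof (rule Weierstrass_m_test)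
      show "norm (u n s) \<le> real q * ((norm x + d) * real (Suc n) powr (- d - 1))"
        if "s \<in> cball x d" for n s
      proof -
        have "norm (u n s) \<le> real q * (norm s * real (Suc n) powr (- Re s - 1))"
          unfolding u_def by (rule aux(1)) (use re[OF that] d in linarith)
        also have "\<dots> \<le> real q * ((norm x + d) * real (Suc n) powr (- d - 1))"
          using re[OF that] nm[OF that] d by (intro mult_left_mono mult_mono powr_mono) (auto intro: add_nonneg_nonneg)
        finally show ?thesis .
      qed
      have "summable (\<lambda>n. real n powr (- d - 1))"
        using d by (simp add: summable_real_powr_iff)
      then have "summable (\<lambda>n. real (Suc n) powr (- d - 1))"
        by (subst summable_Suc_iff)
      then show "summable (\<lambda>n. real q * ((norm x + d) * real (Suc n) powr (- d - 1)))"
        by (intro summable_mult)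
    qed
    moreover have "cball x d \<subseteq> {s. Re s > 0}" using re d by force
    ultimately show "\<exists>d. 0 < d \<and> cball x d \<subseteq> {s. Re s > 0} \<and>
        uniform_limit (cball x d) (\<lambda>N s. \<Sum>n<N. u n s) (\<lambda>s. \<Sum>n. u n s) sequentially"
      using d by blast
  qed
  then show ?thesis by (rule holomorphic_transform) (simp add: L)
qed

lemma log_dirichlet_L_eqI:
  assumes g: "is_log_L_branch chi s g"
  shows "log_dirichlet_L chi s = g s"
proof -
  have uniq: "h s = g s" if h: "is_log_L_branch chi s h" for h
  proof -
    let ?p = "\<lambda>\<sigma>. Complex \<sigma> (Im s)"
    let ?d = "\<lambda>\<sigma>. (h (?p \<sigma>) - g (?p \<sigma>)) / (2 * of_real pi * \<i>)"
    have ray: "?p ` {Re s..} \<subseteq> right_ray s" by (auto simp: right_ray_def)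
    have "continuous_on (right_ray s) g" "continuous_on (right_ray s) h"
      using g h by (auto simp: is_log_L_branch_def intro: analytic_imp_holomorphic holomorphic_on_imp_continuous_on)
    moreover have "continuous_on {Re s..} ?p"
      unfolding Complex_eq by (intro continuous_intros)
    ultimately have cont: "continuous_on {Re s..} ?d"
      by (intro continuous_intros continuous_on_compose2[OF _ _ ray]) auto
    have int: "?d \<sigma> \<in> \<int>" if "\<sigma> \<ge> Re s" for \<sigma>
    proof -
      have "exp (h (?p \<sigma>)) = exp (g (?p \<sigma>))"
        using g h ray that by (auto simp: is_log_L_branch_def right_ray_def)
      then obtain n :: int where "h (?p \<sigma>) = g (?p \<sigma>) + of_int (2 * n) * of_real pi * \<i>"
        unfolding exp_eq by (auto simp: mult_ac)
      then have "?d \<sigma> = of_int n" by (simp add: field_simps)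
      then show ?thesis by simp
    qed
    have "?d constant_on {Re s..}"
    proof (rule continuous_discrete_range_constant[OF _ cont])
      fix x assume x: "x \<in> {Re s..}"
      have "1 \<le> norm (?d y - ?d x)" if y: "y \<in> {Re s..}" "?d y \<noteq> ?d x" for y
      proof -
        have "?d y - ?d x \<in> \<int>" using int x y by (intro Ints_diff) auto
        then obtain n where n: "?d y - ?d x = of_int n" by (auto elim: Ints_cases)
        then have "n \<noteq> 0" using y by auto
        then have "norm (complex_of_int n) \<ge> 1" by simp
        then show ?thesis using n by metis
      qed
      then show "\<exists>e>0. \<forall>y. y \<in> {Re s..} \<and> ?d y \<noteq> ?d x \<longrightarrow> e \<le> norm (?d y - ?d x)"
        by (intro exI[of _ 1]) auto
    qed auto
    then obtain c where c: "\<And>\<sigma>. \<sigma> \<ge> Re s \<Longrightarrow> ?d \<sigma> = c" by (auto simp: constant_on_def)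
    have "(?d \<longlongrightarrow> (0 - 0) / (2 * of_real pi * \<i>)) at_top"
      using g h by (intro tendsto_intros) (auto simp: is_log_L_branch_def)
    moreover have "\<forall>\<^sub>F \<sigma> in at_top. ?d \<sigma> = c"
      using eventually_ge_at_top[of "Re s"] by eventually_elim (rule c)
    ultimately have "((\<lambda>_. c) \<longlongrightarrow> 0) (at_top :: real filter)"
      by (simp add: tendsto_cong)
    then have "c = 0" by (simp add: tendsto_const_iff)
    then show ?thesis using c[of "Re s"] by simp
  qed
  show ?thesis
    unfolding log_dirichlet_L_def
  proof (rule the_equality)
    show "\<exists>ga. is_log_L_branch chi s ga \<and> g s = ga s" using g by blast
  qed (use uniq in blast)
qed

end

theory Submission
  imports Defs "HOL-Combinatorics.Multiset_Permutations" "HOL-Real_Asymp.Real_Asymp"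
begin

text \<open>
  The second half is Markov's inequality with an optimal choice of the moment
  (\<open>tail_bound_from_moment_bound\<close>). The substance is the moment bound, whose proof compares the argument of
  \<open>L\<close> on the critical line with short Dirichlet polynomials over primes.

  Where \<open>log L\<close> lives. In the quadrant \<open>Re s > 1 / 2\<close>, \<open>Im s > 0\<close> there are no zeros: to the
  left of \<open>Re s = 1\<close> by GRH, on that line by the inequality \<open>3 + 4 cos \<theta> + cos 2\<theta> \<ge> 0\<close>
  (\<open>dirichlet_L_nonzero_line_1\<close>), and to the right by the Euler product. So \<open>L\<close> has a holomorphic logarithm
  there, and \<open>X(t)\<close> is the limit of its imaginary part as \<open>Re s\<close> decreases to \<open>1 / 2\<close>
  (\<open>Im_log_L_tendsto\<close>).

  One-sided regularity. On a disc about \<open>2 + \<i>t\<close> that crosses the critical line, \<open>L\<close> has at most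
  \<open>O(log t)\<close> zeros, and after they are divided out the logarithm is \<open>O(log t)\<close> by the inequality of Borel
  and Caratheodory (\<open>local_log_bounds\<close>). All these zeros lie on or to the left of the critical
  line, so each contributes a term \<open>1 / (s - \<rho>)\<close> with positive real part to \<open>L' / L\<close>. Hence
  \<open>Re (L' / L) \<ge> - A log t\<close>: the argument of \<open>L\<close> may jump up along a vertical line, but it cannot
  decrease fast. A function of this kind is bounded above by its averages against the derivative of a
  majorant of the unit step, up to the slope times the scale \<open>h\<close> of the averaging
  (\<open>smoothing_upper_bound\<close>), and reflection gives the bound below. For \<open>h = 40 k / log T\<close> the error is
  \<open>O(k)\<close>.

  Prime sums. The majorant is chosen with a derivative of exponential type \<open>4\<close> (\<open>band_limited_majorant\<close>). At scale
  \<open>h\<close> such an average ignores oscillations of frequency above \<open>4 / h\<close>, thus the part of \<open>log L\<close> that comes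
  from primes beyond \<open>exp (5 / h)\<close>, although the line of integration lies outside
  the half-plane of absolute convergence; this is proved by moving the integral to the right (\<open>contour_shift\<close>). Therefore \<open>\<bar>X(t)\<bar>\<close>
  is at most a sum of four Dirichlet polynomials over primes and squares of primes of length about \<open>T\<close> to the power
  \<open>1 / (8 k)\<close>, plus \<open>O(k)\<close> (\<open>argument_approximation\<close>).

  Moments. The polynomials are so short that in their \<open>2 k\<close>-th moment over \<open>[T, 2T]\<close> essentially only the diagonal
  survives. By unique factorization it is at most \<open>k!\<close> times the \<open>k\<close>-th power of
  the sum of the squared coefficients (\<open>prime_polynomial_moment\<close>), which is
  \<open>O(log log T)\<close> because the sum of \<open>1 / p\<close> over the primes up to \<open>T\<close> is (\<open>sum_primes_inverse_le\<close>). This gives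
  \<open>(C k log log T)\<^sup>k\<close>. The pointwise error contributes \<open>(C k)\<^sup>2\<^sup>k\<close>, which has the required form because
  \<open>k \<le> K log log (q T)\<close>.
\<close>

section \<open>Logarithms of Euler products\<close>

text \<open>Two continuous logarithms of the same function differ by a multiple of \<open>2 \<pi> \<i>\<close>, and a continuous
  function with discrete values is constant on a connected set. This is how branches of \<open>log L\<close>
  that are constructed in different ways are identified.\<close>

lemma eq_if_exp_eq_on_connected:
  fixes f g :: "complex \<Rightarrow> complex"
  assumes "connected A" "continuous_on A f" "continuous_on A g"
    and exp: "\<And>z. z \<in> A \<Longrightarrow> exp (f z) = exp (g z)"
    and z0: "z0 \<in> A" and z: "z \<in> A"
  shows "f z - g z = f z0 - g z0"
proof -
  let ?d = "\<lambda>z. f z - g z"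
  have cont: "continuous_on A ?d"
    using assms by (intro continuous_intros)
  have int: "\<exists>n::int. f w = g w + of_int (2 * n) * of_real pi * \<i>" if "w \<in> A" for w
    using exp[OF that] unfolding exp_eq by (auto simp: mult_ac)
  have "?d constant_on A"
  proof (rule continuous_discrete_range_constant[OF assms(1) cont])
    fix x assume x: "x \<in> A"
    have "2 * pi \<le> norm (?d y - ?d x)" if y: "y \<in> A" "?d y \<noteq> ?d x" for y
    proof -
      obtain m n :: int where mn: "f x = g x + of_int (2 * m) * of_real pi * \<i>"
          "f y = g y + of_int (2 * n) * of_real pi * \<i>"
        using int x y by meson
      then have *: "?d y - ?d x = of_int (n - m) * (2 * of_real pi * \<i>)"
        by (simp add: algebra_simps)
      then have "n \<noteq> m" using y by auto
      then have "norm (of_int (n - m) :: complex) \<ge> 1"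
        by (simp only: norm_of_int)
      then show ?thesis using * by (simp only: norm_mult) simp
    qed
    then show "\<exists>e>0. \<forall>y. y \<in> A \<and> ?d y \<noteq> ?d x \<longrightarrow> e \<le> norm (?d y - ?d x)"
      by (intro exI[of _ "2 * pi"]) auto
  qed
  then show ?thesis using z0 z by (auto simp: constant_on_def)
qed

lemma norm_ln_1_plus_le:
  fixes z :: complex
  assumes "norm z \<le> 3 / 4"
  shows "norm (ln (1 + z)) \<le> 4 * norm z"
proof -
  have "norm (ln (1 + z)) \<le> norm (ln (1 + z) - z) + norm z"
    by (metis diff_add_cancel norm_triangle_ineq)
  also have "norm (ln (1 + z) - z) \<le> norm z ^ 2 / (1 - norm z)"
    using assms by (intro Ln_approx_linear) auto
  also have "\<dots> \<le> norm z ^ 2 / (1 / 4)"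
    using assms by (intro divide_left_mono) auto
  also have "\<dots> \<le> 3 * norm z"
    using mult_right_mono[of "norm z" "3/4" "norm z"] assms by (simp add: power2_eq_square)
  finally show ?thesis by simp
qed

lemma minus_ln_1_minus_sums:
  fixes z :: complex
  assumes "norm z < 1"
  shows "(\<lambda>n. z ^ n / of_nat n) sums (- ln (1 - z))"
proof -
  have "(\<lambda>n. - ((- (- z)) ^ n) / of_nat n) sums ln (1 + (- z))"
    using assms by (intro Ln_series') auto
  from sums_minus[OF this] show ?thesis by simp
qed

lemma norm_ln_1_minus_remainder_le:
  fixes z :: complex
  assumes z: "norm z \<le> 3 / 4"
  shows "norm (- ln (1 - z) - z - z\<^sup>2 / 2) \<le> 4 * norm z ^ 3"
proof -
  note * = minus_ln_1_minus_sums[OF le_less_trans[OF z]]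
  have s: "(\<lambda>n. z ^ (n + 3) / of_nat (n + 3)) sums (- ln (1 - z) - z - z\<^sup>2 / 2)"
  proof -
    have "(\<Sum>n<3. z ^ n / of_nat n) = z + z\<^sup>2 / 2"
      by (simp add: numeral_3_eq_3 numeral_2_eq_2)
    then show ?thesis
      using sums_split_initial_segment[OF *, of 3] by (simp add: diff_diff_eq del: of_nat_add)
  qed
  have geo: "(\<lambda>n. norm z ^ 3 * (3 / 4) ^ n) sums (norm z ^ 3 * (1 / (1 - 3 / 4)))"
    by (intro sums_mult geometric_sums) auto
  have "norm (z ^ (n + 3) / of_nat (n + 3)) \<le> norm z ^ 3 * (3 / 4) ^ n" for n
  proof -
    have "norm (z ^ (n + 3) / of_nat (n + 3)) = norm z ^ 3 * norm z ^ n / real (n + 3)"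
      by (simp add: norm_divide norm_mult norm_power power_add mult.commute del: of_nat_add)
    also have "\<dots> \<le> norm z ^ 3 * norm z ^ n / 1"
      by (intro divide_left_mono) auto
    also have "\<dots> \<le> norm z ^ 3 * (3 / 4) ^ n"
      using z by (auto intro!: mult_left_mono power_mono)
    finally show ?thesis .
  qed
  from norm_sums_le[OF s geo this] show ?thesis by simp
qed

text \<open>The Euler product is needed for \<open>chi\<close>, for its square, and for the constant sequence \<open>1\<close>,
  whose series is the zeta function. Hence the common setting.\<close>

locale completely_multiplicative =
  fixes a :: "nat \<Rightarrow> complex"
  assumes one: "a 1 = 1" and mult: "a (m * n) = a m * a n" and norm_le_1: "norm (a n) \<le> 1"
begin

definition dterm :: "complex \<Rightarrow> nat \<Rightarrow> complex" where
  "dterm s n = a n / of_nat n powr s"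

definition log_factor :: "complex \<Rightarrow> nat \<Rightarrow> complex" where
  "log_factor s n = (if prime n then - ln (1 - dterm s n) else 0)"

definition log_series :: "complex \<Rightarrow> complex" where
  "log_series s = (\<Sum>n. log_factor s n)"

lemma dterm_0 [simp]: "dterm s 0 = 0"
  and dterm_1 [simp]: "dterm s 1 = 1" "dterm s (Suc 0) = 1"
  using one by (auto simp: dterm_def)

lemma dterm_mult: "dterm s (m * n) = dterm s m * dterm s n"
proof -
  have "complex_of_nat (m * n) powr s = of_nat m powr s * of_nat n powr s"
    using powr_times_real[of "of_nat m" "of_nat n" s] by simp
  then show ?thesis by (simp add: dterm_def mult)
qed

lemma norm_dterm_le: "norm (dterm s n) \<le> real n powr (- Re s)"
proof -
  have "norm (dterm s n) = norm (a n) * real n powr (- Re s)"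
    by (cases "n = 0")
       (simp_all add: dterm_def norm_divide norm_powr_real_powr powr_minus field_simps)
  also have "\<dots> \<le> 1 * real n powr (- Re s)"
    by (intro mult_right_mono norm_le_1) auto
  finally show ?thesis by simp
qed

text \<open>The bound away from \<open>1\<close> keeps \<open>1 - dterm s p\<close> off the branch cut of the logarithm, down to
  the critical line and including \<open>p = 2\<close>, where \<open>2\<close> to the power \<open>- 1 / 2\<close> is below \<open>3 / 4\<close>.\<close>

lemma norm_dterm_prime_le:
  assumes "prime p" "Re s \<ge> 1 / 2"
  shows "norm (dterm s p) \<le> 3 / 4"
proof -
  have p: "real p \<ge> 2" using prime_ge_2_nat[OF assms(1)] by simp
  have "norm (dterm s p) \<le> real p powr (- Re s)" by (rule norm_dterm_le)
  also have "\<dots> \<le> real p powr (- (1 / 2))" using assms p by (intro powr_mono) auto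
  also have "\<dots> \<le> 2 powr (- (1 / 2))" using p by (intro powr_mono2') auto
  also have "\<dots> = 1 / sqrt 2" by (simp add: powr_minus powr_half_sqrt field_simps)
  also have "\<dots> \<le> 3 / 4"
  proof -
    have "(4/3 :: real) \<le> sqrt 2" by (rule real_le_rsqrt) (simp add: power2_eq_square)
    then show ?thesis by (simp add: field_simps)
  qed
  finally show ?thesis .
qed

lemma norm_log_factor_le:
  assumes "Re s \<ge> 1 / 2"
  shows "norm (log_factor s n) \<le> 4 * real n powr (- Re s)"
proof (cases "prime n")
  case True
  have "norm (log_factor s n) = norm (ln (1 + (- dterm s n)))"
    using True by (simp add: log_factor_def)
  also have "\<dots> \<le> 4 * norm (- dterm s n)"
    using norm_dterm_prime_le[OF True assms] by (intro norm_ln_1_plus_le) auto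
  also have "\<dots> \<le> 4 * real n powr (- Re s)"
    using norm_dterm_le by auto
  finally show ?thesis .
qed (auto simp: log_factor_def)

lemma exp_log_factor:
  assumes "prime p" "Re s \<ge> 1 / 2"
  shows "exp (log_factor s p) * (1 - dterm s p) = 1"
proof -
  have "1 - dterm s p \<noteq> 0" using norm_dterm_prime_le[OF assms] by auto
  then show ?thesis using assms by (simp add: log_factor_def exp_minus)
qed

lemma summable_norm_dterm: "Re s > 1 \<Longrightarrow> summable (\<lambda>n. norm (dterm s n))"
  by (rule summable_comparison_test'[of "\<lambda>n. real n powr (- Re s)"])
     (auto simp: summable_real_powr_iff norm_dterm_le)

lemma summable_norm_log_factor: "Re s > 1 \<Longrightarrow> summable (\<lambda>n. norm (log_factor s n))"
  by (rule summable_comparison_test'[of "\<lambda>n. 4 * real n powr (- Re s)"])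
     (auto simp: summable_real_powr_iff norm_log_factor_le)

lemma dterm_summable_on: "Re s > 1 \<Longrightarrow> dterm s summable_on A"
  using norm_summable_imp_summable_on[OF summable_norm_dterm] summable_on_subset by blast

lemma norm_dterm_summable_on: "Re s > 1 \<Longrightarrow> (\<lambda>n. norm (dterm s n)) summable_on A"
  using norm_summable_imp_summable_on[of "\<lambda>n. norm (dterm s n)"] summable_norm_dterm[of s]
    summable_on_subset by auto

lemma dirichlet_L_conv_infsum:
  assumes "Re s > 1"
  shows "dirichlet_L a s = infsum (dterm s) UNIV"
proof -
  have sm: "summable (dterm s)" using summable_norm_dterm[OF assms] by (rule summable_norm_cancel)
  have "infsum (dterm s) UNIV = (\<Sum>n. dterm s n)"
    using norm_summable_imp_has_sum[OF summable_norm_dterm[OF assms] summable_sums[OF sm]]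
    by (rule infsumI)
  also have "\<dots> = (\<Sum>n. dterm s (Suc n))"
    using suminf_split_head[OF sm] by simp
  finally show ?thesis by (simp add: dirichlet_L_def dterm_def)
qed

definition sifted :: "nat set \<Rightarrow> nat set" where
  "sifted S = {n. \<forall>p\<in>S. \<not> p dvd n}"

text \<open>Splitting off the multiples of \<open>p\<close> multiplies the series by an Euler factor;
  this is the sieve of Eratosthenes.\<close>

lemma infsum_sifted_insert:
  assumes s: "Re s > 1" and p: "prime p" "p \<notin> S" "\<forall>q\<in>S. prime q"
  shows "infsum (dterm s) (sifted (insert p S)) = (1 - dterm s p) * infsum (dterm s) (sifted S)"
proof -
  have un: "sifted S = sifted (insert p S) \<union> (\<lambda>m. p * m) ` sifted S"
  proof (intro equalityI subsetI)
    fix n assume n: "n \<in> sifted S"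
    show "n \<in> sifted (insert p S) \<union> (\<lambda>m. p * m) ` sifted S"
    proof (cases "p dvd n")
      case True
      then obtain m where m: "n = p * m" by blast
      then have "m \<in> sifted S" using n by (auto simp: sifted_def)
      then show ?thesis using m by blast
    qed (use n in \<open>auto simp: sifted_def\<close>)
  next
    fix n assume "n \<in> sifted (insert p S) \<union> (\<lambda>m. p * m) ` sifted S"
    then show "n \<in> sifted S"
    proof
      assume "n \<in> (\<lambda>m. p * m) ` sifted S"
      then obtain m where m: "m \<in> sifted S" "n = p * m" by blast
      have "\<not> q dvd p * m" if "q \<in> S" for q
      proof
        assume "q dvd p * m"
        moreover have "prime q" "\<not> q dvd m" using that p(3) m(1) by (auto simp: sifted_def)
        ultimately have "q dvd p" by (simp add: prime_dvd_mult_iff)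
        then show False using primes_dvd_imp_eq[of q p] \<open>prime q\<close> p(1,2) that by blast
      qed
      then show ?thesis using m by (auto simp: sifted_def)
    qed (auto simp: sifted_def)
  qed
  have disj: "sifted (insert p S) \<inter> (\<lambda>m. p * m) ` sifted S = {}"
    by (auto simp: sifted_def)
  have inj: "inj_on (\<lambda>m. p * m) (sifted S)"
    using p prime_gt_0_nat[of p] by (auto intro!: inj_onI)
  have "infsum (dterm s) (sifted S) =
          infsum (dterm s) (sifted (insert p S) \<union> (\<lambda>m. p * m) ` sifted S)"
    using un by (rule arg_cong)
  also have "\<dots> = infsum (dterm s) (sifted (insert p S)) + infsum (dterm s) ((\<lambda>m. p * m) ` sifted S)"
    by (rule infsum_Un_disjoint) (use disj in \<open>auto simp: dterm_summable_on[OF s]\<close>)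
  also have "infsum (dterm s) ((\<lambda>m. p * m) ` sifted S) = dterm s p * infsum (dterm s) (sifted S)"
    unfolding infsum_reindex[OF inj] o_def dterm_mult
    by (rule infsum_cmult_right) (rule dterm_summable_on[OF s])
  finally show ?thesis by (metis add_diff_cancel_right' left_diff_distrib mult_1)
qed

lemma infsum_sifted:
  assumes s: "Re s > 1" and "finite S" "\<forall>q\<in>S. prime q"
  shows "infsum (dterm s) (sifted S) = (\<Prod>p\<in>S. 1 - dterm s p) * dirichlet_L a s"
  using assms(2,3)
proof (induction S rule: finite_induct)
  case empty
  then show ?case by (simp add: sifted_def dirichlet_L_conv_infsum[OF s])
next
  case (insert p S)
  have "infsum (dterm s) (sifted (insert p S)) = (1 - dterm s p) * infsum (dterm s) (sifted S)"
    by (rule infsum_sifted_insert[OF s]) (use insert in auto)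
  also have "infsum (dterm s) (sifted S) = (\<Prod>p\<in>S. 1 - dterm s p) * dirichlet_L a s"
    using insert by blast
  finally show ?case using insert(1,2) by (simp add: mult.assoc)
qed

text \<open>After sifting by the primes below \<open>N\<close> only the term \<open>1\<close> and terms with index at least \<open>N\<close>
  remain, and the latter form part of a tail of a convergent series.\<close>

lemma euler_product_tendsto:
  assumes s: "Re s > 1"
  shows "(\<lambda>N. (\<Prod>p | prime p \<and> p < N. 1 - dterm s p) * dirichlet_L a s) \<longlonglongrightarrow> 1"
proof -
  let ?S = "\<lambda>N. {p. prime p \<and> p < N}"
  let ?f = "\<lambda>n. norm (dterm s n)"
  have fin: "finite (?S N)" for N :: nat by (rule finite_subset[of _ "{..<N}"]) auto
  have le: "norm ((\<Prod>p\<in>?S N. 1 - dterm s p) * dirichlet_L a s - 1) \<le> (\<Sum>n. ?f n) - sum ?f {..<N}"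
    if N: "N > 1" for N
  proof -
    have sub: "sifted (?S N) - {1} \<subseteq> insert 0 {N..}"
    proof
      fix n assume n: "n \<in> sifted (?S N) - {1}"
      show "n \<in> insert 0 {N..}"
      proof (rule ccontr)
        assume "n \<notin> insert 0 {N..}"
        then have "0 < n" "n < N" by auto
        moreover obtain p where "prime p" "p dvd n" using n prime_factor_nat[of n] by auto
        ultimately have "p \<in> ?S N" using dvd_imp_le[of p n] by auto
        with n \<open>p dvd n\<close> show False by (auto simp: sifted_def)
      qed
    qed
    have one: "1 \<in> sifted (?S N)" by (auto simp: sifted_def)
    have "(\<Prod>p\<in>?S N. 1 - dterm s p) * dirichlet_L a s = infsum (dterm s) (sifted (?S N))"
      by (rule infsum_sifted[symmetric]) (use s fin in auto)
    also have "sifted (?S N) = insert 1 (sifted (?S N) - {1})" using one by auto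
    also have "infsum (dterm s) (insert 1 (sifted (?S N) - {1})) = 1 + infsum (dterm s) (sifted (?S N) - {1})"
      by (subst infsum_insert) (auto simp: dterm_summable_on[OF s])
    finally have "norm ((\<Prod>p\<in>?S N. 1 - dterm s p) * dirichlet_L a s - 1) =
        norm (infsum (dterm s) (sifted (?S N) - {1}))" by simp
    also have "\<dots> \<le> infsum ?f (sifted (?S N) - {1})"
      by (rule norm_infsum_bound) (rule norm_dterm_summable_on[OF s])
    also have "\<dots> \<le> infsum ?f (insert 0 {N..})"
      by (rule infsum_mono2) (use sub norm_dterm_summable_on[OF s] in auto)
    also have "\<dots> = infsum ?f {N..}"
      by (rule infsum_cong_neutral) auto
    also have "\<dots> = infsum ?f UNIV - infsum ?f {..<N}"
    proof -
      have "infsum ?f ({..<N} \<union> {N..}) = infsum ?f {..<N} + infsum ?f {N..}"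
        by (rule infsum_Un_disjoint) (auto simp: norm_dterm_summable_on[OF s])
      moreover have "{..<N} \<union> {N..} = UNIV" by auto
      ultimately show ?thesis by simp
    qed
    also have "infsum ?f {..<N} = sum ?f {..<N}" by simp
    also have "infsum ?f UNIV = (\<Sum>n. ?f n)"
      using norm_summable_imp_has_sum[of ?f] summable_norm_dterm[OF s]
      by (auto intro!: infsumI simp: summable_sums)
    finally show ?thesis .
  qed
  have "(\<lambda>N. (\<Sum>n. ?f n) - sum ?f {..<N}) \<longlonglongrightarrow> (\<Sum>n. ?f n) - (\<Sum>n. ?f n)"
    by (intro tendsto_intros summable_LIMSEQ summable_norm_dterm[OF s])
  then have "(\<lambda>N. (\<Sum>n. ?f n) - sum ?f {..<N}) \<longlonglongrightarrow> 0" by simp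
  then have "(\<lambda>N. (\<Prod>p\<in>?S N. 1 - dterm s p) * dirichlet_L a s - 1) \<longlonglongrightarrow> 0"
    by (rule Lim_null_comparison[rotated])
       (use le in \<open>auto intro!: eventually_mono[OF eventually_gt_at_top[of 1]]\<close>)
  then show ?thesis by (simp add: LIM_zero_iff)
qed

lemma exp_log_series:
  assumes s: "Re s > 1"
  shows "exp (log_series s) = dirichlet_L a s"
proof -
  let ?S = "\<lambda>N. {p. prime p \<and> p < N}"
  have fin: "finite (?S N)" for N :: nat by (rule finite_subset[of _ "{..<N}"]) auto
  have sum: "sum (log_factor s) {..<N} = sum (log_factor s) (?S N)" for N
    by (rule sum.mono_neutral_right) (auto simp: log_factor_def)
  have "exp (sum (log_factor s) {..<N}) * (\<Prod>p\<in>?S N. 1 - dterm s p) = 1" for N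
    unfolding sum using exp_log_factor[of _ s] s fin
    by (simp add: exp_sum prod.distrib[symmetric])
  then have eq: "exp (sum (log_factor s) {..<N}) * ((\<Prod>p\<in>?S N. 1 - dterm s p) * dirichlet_L a s)
      = dirichlet_L a s" for N
    by (simp only: mult.assoc[symmetric] mult_1_left)
  have "(\<lambda>N. exp (sum (log_factor s) {..<N}) * ((\<Prod>p\<in>?S N. 1 - dterm s p) * dirichlet_L a s))
      \<longlonglongrightarrow> exp (log_series s) * 1"
    unfolding log_series_def using summable_norm_log_factor[OF s]
    by (intro tendsto_intros euler_product_tendsto[OF s] summable_LIMSEQ) (rule summable_norm_cancel)
  then show ?thesis unfolding eq by (simp add: LIMSEQ_const_iff)
qed

lemma dirichlet_L_nonzero: "Re s > 1 \<Longrightarrow> dirichlet_L a s \<noteq> 0"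
  using exp_log_series[of s] by (metis exp_not_eq_zero)

lemma log_factor_holomorphic: "(\<lambda>s. log_factor s n) holomorphic_on {s. Re s > 1 / 2}"
proof (cases "prime n")
  case True
  have "(\<lambda>s. - ln (1 - a n / of_nat n powr s)) holomorphic_on {s. Re s > 1 / 2}"
  proof (intro holomorphic_intros)
    fix s assume s: "s \<in> {s. Re s > 1 / 2}"
    have "Re (dterm s n) \<le> 3 / 4"
      using norm_dterm_prime_le[OF True, of s] s complex_Re_le_cmod[of "dterm s n"] by auto
    then show "1 - a n / of_nat n powr s \<notin> \<real>\<^sub>\<le>\<^sub>0"
      by (auto simp: complex_nonpos_Reals_iff dterm_def)
    show "of_nat n powr s \<noteq> 0" using True by auto
  qed
  then show ?thesis using True by (simp add: log_factor_def dterm_def)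
qed (auto simp: log_factor_def)

text \<open>The tail of the logarithm beyond \<open>N\<close> has size about \<open>N\<close> to the power \<open>- Re s\<close>; a factor
  \<open>N\<^sup>2\<close> is given away so that a constant independent of \<open>s\<close> suffices.\<close>

lemma norm_log_series_tail_le:
  assumes s: "Re s \<ge> 2" and N: "N \<ge> 1"
  shows "norm (log_series s - sum (log_factor s) {..<N})
           \<le> 4 * (\<Sum>n. real n powr (- 2)) * real N powr (2 - Re s)"
proof -
  have sm: "summable (log_factor s)"
    by (rule summable_norm_cancel, rule summable_norm_log_factor) (use s in auto)
  have sm2: "summable (\<lambda>n. real n powr (- 2))" by (simp add: summable_real_powr_iff)
  have sm3: "summable (\<lambda>n. real (n + N) powr (- 2))"
    by (rule summable_ignore_initial_segment[OF sm2])
  have "log_series s - sum (log_factor s) {..<N} = (\<Sum>n. log_factor s (n + N))"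
    unfolding log_series_def by (rule suminf_minus_initial_segment[OF sm, symmetric])
  also have "norm \<dots> \<le> (\<Sum>n. 4 * real N powr (2 - Re s) * real (n + N) powr (- 2))"
  proof (rule norm_suminf_le)
    show "norm (log_factor s (n + N)) \<le> 4 * real N powr (2 - Re s) * real (n + N) powr (- 2)" for n
    proof -
      have "norm (log_factor s (n + N)) \<le> 4 * real (n + N) powr (- Re s)"
        using s by (intro norm_log_factor_le) auto
      also have "real (n + N) powr (- Re s) = real (n + N) powr (2 - Re s) * real (n + N) powr (- 2)"
        by (subst powr_add[symmetric]) simp
      also have "\<dots> \<le> real N powr (2 - Re s) * real (n + N) powr (- 2)"
        using s N by (intro mult_right_mono powr_mono2') auto
      finally show ?thesis by simp
    qed
    show "summable (\<lambda>n. 4 * real N powr (2 - Re s) * real (n + N) powr (- 2))"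
      by (rule summable_mult[OF sm3])
  qed
  also have "\<dots> = 4 * real N powr (2 - Re s) * (\<Sum>n. real (n + N) powr (- 2))"
    by (rule suminf_mult[OF sm3])
  also have "(\<Sum>n. real (n + N) powr (- 2)) \<le> (\<Sum>n. real n powr (- 2))"
  proof -
    have "(\<Sum>n. real (n + N) powr (- 2)) = (\<Sum>n. real n powr (- 2)) - (\<Sum>n<N. real n powr (- 2))"
      by (rule suminf_minus_initial_segment[OF sm2])
    moreover have "(\<Sum>n<N. real n powr (- 2)) \<ge> 0" by (rule sum_nonneg) auto
    ultimately show ?thesis by linarith
  qed
  finally have "norm (log_series s - sum (log_factor s) {..<N})
      \<le> 4 * real N powr (2 - Re s) * (\<Sum>n. real n powr (- 2))"
    by (simp add: mult_left_mono)
  then show ?thesis by (simp only: mult_ac)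
qed

text \<open>By the Weierstrass test on half-planes \<open>Re s > d\<close> with \<open>d > 1\<close>.\<close>

lemma log_series_continuous: "continuous_on {s. Re s > 1} log_series"
proof -
  have "isCont log_series s0" if s0: "Re s0 > 1" for s0
  proof -
    define d where "d = (1 + Re s0) / 2"
    let ?A = "{s. Re s > d}"
    have d: "d > 1" "Re s0 > d" using s0 by (auto simp: d_def field_simps)
    have "uniform_limit ?A (\<lambda>N s. \<Sum>n<N. log_factor s n) (\<lambda>s. \<Sum>n. log_factor s n) sequentially"
    proof (rule Weierstrass_m_test)
      show "norm (log_factor s n) \<le> 4 * real n powr (- d)" if s: "s \<in> ?A" for n s
      proof (cases "n = 0")
        case False
        have "norm (log_factor s n) \<le> 4 * real n powr (- Re s)"
          using s d by (intro norm_log_factor_le) auto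
        also have "\<dots> \<le> 4 * real n powr (- d)"
          using s False by (intro mult_left_mono powr_mono) auto
        finally show ?thesis .
      qed (auto simp: log_factor_def)
      show "summable (\<lambda>n. 4 * real n powr (- d))"
        using d by (intro summable_mult) (simp add: summable_real_powr_iff)
    qed
    moreover have "continuous_on ?A (\<lambda>s. \<Sum>n<N. log_factor s n)" for N
    proof (intro continuous_intros holomorphic_on_imp_continuous_on)
      fix n show "(\<lambda>s. log_factor s n) holomorphic_on ?A"
        by (rule holomorphic_on_subset[OF log_factor_holomorphic]) (use d in auto)
    qed
    ultimately have "continuous_on ?A log_series"
      unfolding log_series_def by (intro uniform_limit_theorem) (auto intro!: always_eventually)
    then show ?thesis
      using d by (simp add: continuous_on_eq_continuous_at open_halfspace_Re_gt)
  qed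
  then show ?thesis by (intro continuous_at_imp_continuous_on) auto
qed

end

section \<open>Non-vanishing on the line \<open>Re s = 1\<close>\<close>

text \<open>For \<open>u = cis \<theta>\<close> this is \<open>3 + 4 cos \<theta> + cos 2\<theta> = 2 (1 + cos \<theta>)\<^sup>2 \<ge> 0\<close>. The value \<open>0\<close> is allowed
  because characters vanish at the primes that divide the modulus.\<close>

lemma mertens_341:
  fixes u :: complex
  assumes "norm u = 1 \<or> u = 0"
  shows "Re (3 + 4 * u + u\<^sup>2) \<ge> 0"
proof (cases "u = 0")
  case False
  then have "(Re u)\<^sup>2 + (Im u)\<^sup>2 = 1" using assms by (simp add: cmod_def)
  then have "Re (3 + 4 * u + u\<^sup>2) = 2 * (1 + Re u)\<^sup>2"
    by (simp add: power2_eq_square algebra_simps)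
  then show ?thesis by simp
qed auto

text \<open>The inequality of Mertens applied to each power in the logarithmic series.\<close>

lemma Re_log_341_nonneg:
  fixes w :: complex and r :: real
  assumes w: "norm w = 1 \<or> w = 0" and r: "0 \<le> r" "r < 1"
  shows "Re (3 * (- ln (1 - of_real r)) + 4 * (- ln (1 - of_real r * w)) + (- ln (1 - of_real r * w\<^sup>2))) \<ge> 0"
proof -
  have w1: "norm w \<le> 1" "norm (w\<^sup>2) \<le> 1" using w by (auto simp: norm_power)
  have lt: "norm (of_real r :: complex) < 1" "norm (of_real r * w) < 1" "norm (of_real r * w\<^sup>2) < 1"
    using r w1 mult_left_mono[of "norm w" 1 r] mult_left_mono[of "norm (w\<^sup>2)" 1 r]
    by (auto simp: norm_mult norm_power)
  have "(\<lambda>n. 3 * (of_real r ^ n / of_nat n) + 4 * ((of_real r * w) ^ n / of_nat n)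
           + (of_real r * w\<^sup>2) ^ n / of_nat n) sums
        (3 * (- ln (1 - of_real r)) + 4 * (- ln (1 - of_real r * w)) + (- ln (1 - of_real r * w\<^sup>2)))"
    by (intro sums_add sums_mult minus_ln_1_minus_sums lt)
  from sums_Re[OF this]
  have s: "(\<lambda>n. Re (3 * (of_real r ^ n / of_nat n) + 4 * ((of_real r * w) ^ n / of_nat n)
           + (of_real r * w\<^sup>2) ^ n / of_nat n)) sums
        Re (3 * (- ln (1 - of_real r)) + 4 * (- ln (1 - of_real r * w)) + (- ln (1 - of_real r * w\<^sup>2)))" .
  have nonneg: "Re (3 * (of_real r ^ n / of_nat n) + 4 * ((of_real r * w) ^ n / of_nat n)
           + (of_real r * w\<^sup>2) ^ n / of_nat n) \<ge> 0" for n
  proof (cases "n = 0")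
    case False
    have "norm (w ^ n) = 1 \<or> w ^ n = 0" using w False by (auto simp: norm_power)
    then have *: "Re (3 + 4 * w ^ n + (w ^ n)\<^sup>2) \<ge> 0" by (rule mertens_341)
    have "3 * (of_real r ^ n / of_nat n) + 4 * ((of_real r * w) ^ n / of_nat n)
           + (of_real r * w\<^sup>2) ^ n / of_nat n = of_real (r ^ n / real n) * (3 + 4 * w ^ n + (w ^ n)\<^sup>2)"
      by (simp add: power_mult_distrib power_mult[symmetric] mult.commute[of 2 n] ring_distribs
            add_divide_distrib mult_ac)
    then have "Re (3 * (of_real r ^ n / of_nat n) + 4 * ((of_real r * w) ^ n / of_nat n)
           + (of_real r * w\<^sup>2) ^ n / of_nat n) = (r ^ n / real n) * Re (3 + 4 * w ^ n + (w ^ n)\<^sup>2)"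
      by (metis Re_complex_of_real Im_complex_of_real times_complex.sel(1) diff_zero mult_zero_left)
    also have "\<dots> \<ge> 0" using * r by (intro mult_nonneg_nonneg) auto
    finally show ?thesis .
  qed auto
  show ?thesis
    using sums_le[OF _ sums_zero s] nonneg by blast
qed

lemma completely_multiplicative_1: "completely_multiplicative (\<lambda>_. 1)"
  by standard auto

lemma completely_multiplicative_character:
  assumes "dirichlet_character q chi" "q > 0"
  shows "completely_multiplicative chi"
proof
  show m: "chi (m * n) = chi m * chi n" for m n using assms by (simp add: dirichlet_character_def)
  have "chi 1 \<noteq> 0" using assms by (simp add: dirichlet_character_def)
  moreover have "chi 1 * chi 1 = chi 1" using m[of 1 1] by simp
  ultimately show "chi 1 = 1" by simp
  show "norm (chi n) \<le> 1" for n by (rule norm_character_le_1[OF assms])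
qed

text \<open>The powers of \<open>chi n\<close> are values of \<open>chi\<close>, of which there are finitely many; a modulus strictly
  between \<open>0\<close> and \<open>1\<close> would give infinitely many.\<close>

lemma norm_character:
  assumes chi: "dirichlet_character q chi" and q: "q > 0"
  shows "norm (chi n) = 1 \<or> chi n = 0"
proof (rule ccontr)
  assume "\<not> (norm (chi n) = 1 \<or> chi n = 0)"
  with norm_character_le_1[OF assms, of n] have n: "chi n \<noteq> 0" "norm (chi n) < 1" by auto
  interpret completely_multiplicative chi
    using completely_multiplicative_character[OF assms] .
  have pow: "chi (n ^ k) = chi n ^ k" for k by (induction k) (use one in \<open>auto simp: mult\<close>)
  let ?A = "(\<lambda>a. norm (chi a)) ` {a. a < q \<and> chi a \<noteq> 0}"
  have fin: "finite ?A" by auto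
  have in_A: "norm (chi n) ^ k \<in> ?A" for k
    using n q pow[of k] dirichlet_character_mod[OF chi, of "n ^ k"]
    by (intro image_eqI[of _ _ "n ^ k mod q"]) (auto simp: norm_power)
  then have "Min ?A \<in> ?A" using fin by (intro Min_in) auto
  then have "Min ?A > 0" by auto
  then obtain k where "norm (chi n) ^ k < Min ?A" using real_arch_pow_inv[OF _ n(2)] by blast
  moreover have "Min ?A \<le> norm (chi n) ^ k" using fin in_A by (rule Min_le)
  ultimately show False by simp
qed

text \<open>Summing over the primes, the 3-4-1 combination of the logarithms of the three Euler products
  has nonnegative real part.\<close>

lemma (in completely_multiplicative) euler_product_341:
  assumes unit: "\<And>n. norm (a n) = 1 \<or> a n = 0" and \<sigma>: "\<sigma> > 1"
  shows "norm (dirichlet_L (\<lambda>_. 1) (of_real \<sigma>)) ^ 3 * norm (dirichlet_L a (Complex \<sigma> t)) ^ 4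
           * norm (dirichlet_L (\<lambda>n. a n ^ 2) (Complex \<sigma> (2 * t))) \<ge> 1"
proof -
  interpret Z: completely_multiplicative "\<lambda>_. 1 :: complex" by (rule completely_multiplicative_1)
  interpret S: completely_multiplicative "\<lambda>n. a n ^ 2"
    by standard (use norm_le_1 in \<open>auto simp: one[simplified] mult power_mult_distrib norm_power power_le_one\<close>)
  let ?s1 = "complex_of_real \<sigma>" and ?s2 = "Complex \<sigma> t" and ?s3 = "Complex \<sigma> (2 * t)"
  have sm: "summable (Z.log_factor ?s1)" "summable (log_factor ?s2)" "summable (S.log_factor ?s3)"
    by (rule summable_norm_cancel, rule Z.summable_norm_log_factor summable_norm_log_factor S.summable_norm_log_factor,
        simp add: \<sigma>)+
  define F where "F = (\<lambda>n. 3 * Z.log_factor ?s1 n + 4 * log_factor ?s2 n + S.log_factor ?s3 n)"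
  define W where "W = 3 * Z.log_series ?s1 + 4 * log_series ?s2 + S.log_series ?s3"
  have "F sums W"
    unfolding F_def W_def Z.log_series_def log_series_def S.log_series_def
    by (intro sums_add sums_mult summable_sums sm)
  then have s: "(\<lambda>n. Re (F n)) sums Re W" by (rule sums_Re)
  have "Re (F n) \<ge> 0" for n
  proof (cases "prime n")
    case True
    define r where "r = real n powr (- \<sigma>)"
    define w where "w = a n * of_nat n powr (- (\<i> * t))"
    have n: "real n > 1" using prime_gt_1_nat[OF True] by simp
    have r: "0 \<le> r" "r < 1" using n \<sigma> by (auto simp: r_def powr_less_one)
    have nrm: "norm (of_nat n powr (- (\<i> * of_real t)) :: complex) = 1"
      using n by (subst norm_powr_real_powr) auto
    have w: "norm w = 1 \<or> w = 0" using unit[of n] nrm by (auto simp: w_def norm_mult)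
    have r': "of_nat n powr (- complex_of_real \<sigma>) = of_real r"
      using powr_of_real[of "real n" "- \<sigma>"] by (simp add: r_def)
    have 1: "Z.dterm ?s1 n = of_real r"
      using r' by (simp add: Z.dterm_def powr_minus field_simps)
    have 2: "dterm ?s2 n = of_real r * w"
    proof -
      have "dterm ?s2 n = a n * of_nat n powr (- ?s2)" by (simp add: dterm_def powr_minus field_simps)
      also have "- ?s2 = - complex_of_real \<sigma> + - (\<i> * of_real t)" by (simp add: Complex_eq)
      also have "complex_of_nat n powr (- complex_of_real \<sigma> + - (\<i> * of_real t)) = of_real r * of_nat n powr (- (\<i> * of_real t))"
        unfolding powr_add r' ..
      finally show ?thesis by (simp add: w_def)
    qed
    have 3: "S.dterm ?s3 n = of_real r * w\<^sup>2"
    proof -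
      have "S.dterm ?s3 n = (a n)\<^sup>2 * of_nat n powr (- ?s3)" by (simp add: S.dterm_def powr_minus field_simps)
      also have "- ?s3 = - complex_of_real \<sigma> + (- (\<i> * of_real t) + - (\<i> * of_real t))" by (simp add: Complex_eq)
      also have "complex_of_nat n powr (- complex_of_real \<sigma> + (- (\<i> * of_real t) + - (\<i> * of_real t)))
        = of_real r * (of_nat n powr (- (\<i> * of_real t)) * of_nat n powr (- (\<i> * of_real t)))"
        unfolding powr_add r' ..
      finally show ?thesis by (simp add: w_def power2_eq_square)
    qed
    show ?thesis
      using Re_log_341_nonneg[OF w r] True
      by (simp only: F_def Z.log_factor_def log_factor_def S.log_factor_def 1 2 3 if_True)
  qed (auto simp: F_def Z.log_factor_def log_factor_def S.log_factor_def)
  then have "Re W \<ge> 0"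
    using sums_le[OF _ sums_zero s] by blast
  then have "1 \<le> norm (exp W)" by (simp add: norm_exp_eq_Re)
  also have "exp W = exp (Z.log_series ?s1) ^ 3 * exp (log_series ?s2) ^ 4 * exp (S.log_series ?s3)"
    unfolding W_def exp_add by (metis exp_of_nat_mult of_nat_numeral)
  also have "\<dots> = dirichlet_L (\<lambda>_. 1) ?s1 ^ 3 * dirichlet_L a ?s2 ^ 4 * dirichlet_L (\<lambda>n. a n ^ 2) ?s3"
    using \<sigma> by (simp only: Z.exp_log_series exp_log_series S.exp_log_series Re_complex_of_real complex.sel)
  finally show ?thesis by (simp only: norm_mult norm_power)
qed

text \<open>The mean value inequality for \<open>x\<close> to the power \<open>- s\<close>.\<close>

lemma norm_powr_minus_diff_le:
  fixes s :: complex
  assumes s: "Re s \<ge> - 1" and x: "0 < a" "a \<le> x"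
  shows "norm (of_real x powr (-s) - of_real a powr (-s)) \<le> norm s * a powr (- Re s - 1) * (x - a)"
proof -
  let ?S = "closed_segment (of_real a) (of_real x) :: complex set"
  have S: "Re z \<ge> a \<and> Im z = 0" if "z \<in> ?S" for z
    using that x by (auto simp: closed_segment_of_real closed_segment_eq_real_ivl)
  have "norm (of_real x powr (-s) - of_real a powr (-s))
          \<le> norm s * a powr (- Re s - 1) * norm (of_real x - of_real a :: complex)"
  proof (rule field_differentiable_bound[where S = ?S and f' = "\<lambda>z. -s * z powr (-s - 1)"])
    fix z assume z: "z \<in> ?S"
    then have pos: "Re z > 0" "Im z = 0" using S[of z] x by auto
    then have "z \<notin> \<real>\<^sub>\<le>\<^sub>0" by (auto simp: complex_nonpos_Reals_iff)
    then show "((\<lambda>z. z powr (-s)) has_field_derivative -s * z powr (-s - 1)) (at z within ?S)"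
      by (auto intro!: derivative_eq_intros)
    have zr: "z = complex_of_real (Re z)" using pos by (simp add: complex_eq_iff)
    have "norm (z powr (-s - 1)) = Re z powr (- Re s - 1)"
      using pos by (subst zr, subst norm_powr_real_powr) auto
    also have "\<dots> \<le> a powr (- Re s - 1)"
      using S[OF z] s x by (intro powr_mono2') auto
    finally show "norm (-s * z powr (-s - 1)) \<le> norm s * a powr (- Re s - 1)"
      by (simp add: norm_mult mult_left_mono)
  qed auto
  also have "norm (of_real x - of_real a :: complex) = x - a"
    using x by (simp flip: of_real_diff)
  finally show ?thesis .
qed

lemma summable_Suc_powr: "summable (\<lambda>n. real (Suc n) powr (- 2))"
  by (subst summable_Suc_iff) (simp add: summable_real_powr_iff)

text \<open>The \<open>n\<close>-th term of the zeta series is compared with the integral of \<open>x\<close> to the power \<open>- s\<close> over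
  the interval from \<open>n\<close> to \<open>n + 1\<close>. The integrals add up to \<open>1 / (s - 1)\<close>, and the
  differences are \<open>O(\<bar>s\<bar> / n\<^sup>2)\<close> uniformly for \<open>Re s > 1\<close>. This gives the order of the pole at
  \<open>1\<close> and boundedness away from it.\<close>

lemma zeta_minus_pole_bound:
  assumes s: "Re s > 1"
  shows "norm (dirichlet_L (\<lambda>_. 1) s - 1 / (s - 1)) \<le> norm s * (\<Sum>n. real (Suc n) powr (- 2))"
proof -
  have s1: "s \<noteq> 1" using s by auto
  let ?g = "\<lambda>n. of_nat (Suc n) powr (1 - s) / (s - 1)"
  have "(\<lambda>n. complex_of_nat (Suc n) powr (1 - s)) \<longlonglongrightarrow> 0"
  proof (rule tendsto_norm_zero_cancel)
    have "norm (complex_of_nat (Suc n) powr (1 - s)) = real (Suc n) powr (- (Re s - 1))" for n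
      by (subst norm_powr_real_powr) auto
    moreover have "filterlim (\<lambda>N. real (Suc N)) at_top sequentially"
      by (rule filterlim_compose[OF filterlim_real_sequentially filterlim_Suc])
    then have "(\<lambda>n. real (Suc n) powr (- (Re s - 1))) \<longlonglongrightarrow> 0"
      using s by (intro tendsto_neg_powr) auto
    ultimately show "(\<lambda>n. norm (complex_of_nat (Suc n) powr (1 - s))) \<longlonglongrightarrow> 0" by simp
  qed
  then have "?g \<longlonglongrightarrow> 0 / (s - 1)" using s1 by (intro tendsto_intros) auto
  from telescope_sums'[OF this]
  have tel: "(\<lambda>n. ?g n - ?g (Suc n)) sums (1 / (s - 1))" by simp
  interpret Z: completely_multiplicative "\<lambda>_. 1 :: complex" by (rule completely_multiplicative_1)
  have "summable (\<lambda>n. Z.dterm s n)"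
    by (rule summable_norm_cancel, rule Z.summable_norm_dterm[OF s])
  then have "summable (\<lambda>n. 1 / complex_of_nat (Suc n) powr s)"
    by (subst (asm) summable_Suc_iff[symmetric]) (simp add: Z.dterm_def)
  then have "(\<lambda>n. 1 / of_nat (Suc n) powr s) sums dirichlet_L (\<lambda>_. 1) s"
    unfolding dirichlet_L_def by (rule summable_sums)
  from sums_diff[OF this tel]
  have S: "(\<lambda>n. 1 / of_nat (Suc n) powr s - (?g n - ?g (Suc n))) sums (dirichlet_L (\<lambda>_. 1) s - 1 / (s - 1))" .
  note sm = summable_Suc_powr
  have S2: "(\<lambda>n. norm s * real (Suc n) powr (- 2)) sums (norm s * (\<Sum>n. real (Suc n) powr (- 2)))"
    by (intro sums_mult summable_sums sm)
  have le: "norm (1 / of_nat (Suc n) powr s - (?g n - ?g (Suc n))) \<le> norm s * real (Suc n) powr (- 2)" for n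
  proof -
    define N where "N = real (Suc n)"
    have N: "N \<ge> 1" by (simp add: N_def)
    let ?S = "closed_segment (of_real N) (of_real (N + 1)) :: complex set"
    \<comment> \<open>The increment of \<open>?f\<close> from \<open>N\<close> to \<open>N + 1\<close> is the integral minus the term.\<close>
    let ?f = "\<lambda>z. z powr (1 - s) / (1 - s) - z * of_real N powr (- s)"
    have "norm (?f (of_real (N + 1)) - ?f (of_real N)) \<le> norm s * N powr (- Re s - 1) * norm (of_real (N + 1) - of_real N :: complex)"
    proof (rule field_differentiable_bound[where S = ?S and f' = "\<lambda>z. z powr (- s) - of_real N powr (- s)"])
      fix z assume z: "z \<in> ?S"
      obtain x where x: "z = of_real x" "N \<le> x" "x \<le> N + 1"
        using z by (auto simp: closed_segment_of_real closed_segment_eq_real_ivl simp del: of_real_add)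
      then have "z \<notin> \<real>\<^sub>\<le>\<^sub>0" using N by (auto simp: complex_nonpos_Reals_iff)
      then have "((\<lambda>z. z powr (1 - s)) has_field_derivative (1 - s) * z powr (1 - s - 1)) (at z within ?S)"
        by (intro has_field_derivative_at_within[OF has_field_derivative_powr])
      from DERIV_cdivide[OF this, of "1 - s"]
      have "((\<lambda>z. z powr (1 - s) / (1 - s)) has_field_derivative z powr (- s)) (at z within ?S)"
        using s1 by simp
      moreover have "((\<lambda>z. z * of_real N powr (- s)) has_field_derivative of_real N powr (- s)) (at z within ?S)"
        by (auto intro!: derivative_eq_intros)
      ultimately show "(?f has_field_derivative z powr (- s) - of_real N powr (- s)) (at z within ?S)"
        by (rule DERIV_diff)
      have "norm (z powr (- s) - of_real N powr (- s)) \<le> norm s * N powr (- Re s - 1) * (x - N)"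
        unfolding x by (rule norm_powr_minus_diff_le) (use s N x in auto)
      also have "\<dots> \<le> norm s * N powr (- Re s - 1) * 1"
        using x by (intro mult_left_mono) auto
      finally show "norm (z powr (- s) - of_real N powr (- s)) \<le> norm s * N powr (- Re s - 1)" by simp
    qed auto
    also have "norm (of_real (N + 1) - of_real N :: complex) = 1" by simp
    also have "norm s * N powr (- Re s - 1) * 1 \<le> norm s * N powr (- 2) * 1"
      using s N by (intro mult_right_mono mult_left_mono powr_mono) auto
    finally have *: "norm (?f (of_real (N + 1)) - ?f (of_real N)) \<le> norm s * N powr (- 2)" by simp
    have e1: "complex_of_real N = of_nat (Suc n)" "complex_of_real (N + 1) = of_nat (Suc (Suc n))"
      by (auto simp: N_def)
    have "?f (of_real (N + 1)) - ?f (of_real N) = - (1 / of_nat (Suc n) powr s - (?g n - ?g (Suc n)))"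
    proof -
      have "?f (of_real (N + 1)) - ?f (of_real N) = of_real (N + 1) powr (1 - s) / (1 - s) - of_real N powr (1 - s) / (1 - s) - of_real N powr (- s)"
        by (simp add: algebra_simps)
      also have "\<dots> = - (1 / of_real N powr s - (of_real N powr (1 - s) / (s - 1) - of_real (N + 1) powr (1 - s) / (s - 1)))"
        using s1 by (simp add: powr_minus divide_simps) (simp add: algebra_simps)?
      finally show ?thesis unfolding e1 .
    qed
    then show ?thesis using * by (simp add: N_def norm_minus_commute)
  qed
  show ?thesis using norm_sums_le[OF S S2 le] .
qed

text \<open>The series of the principal character is that of zeta, sifted by the primes that divide \<open>q\<close>.\<close>

lemma norm_L_principal_le:
  assumes q: "q > 1" and s: "Re s > 1"
  shows "norm (dirichlet_L (principal_character q) s) \<le> 2 ^ card (prime_factors q) * norm (dirichlet_L (\<lambda>_. 1) s)"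
proof -
  interpret Z: completely_multiplicative "\<lambda>_. 1 :: complex" by (rule completely_multiplicative_1)
  interpret P: completely_multiplicative "principal_character q"
    by standard (auto simp: principal_character_def)
  have cop: "coprime n q \<longleftrightarrow> n \<in> Z.sifted (prime_factors q)" for n
  proof
    assume "coprime n q"
    then show "n \<in> Z.sifted (prime_factors q)"
      by (auto simp: Z.sifted_def in_prime_factors_iff dest: coprime_common_divisor)
  next
    assume *: "n \<in> Z.sifted (prime_factors q)"
    show "coprime n q"
    proof (rule ccontr)
      assume "\<not> coprime n q"
      then obtain p where "prime p" "p dvd gcd n q" using prime_factor_nat[of "gcd n q"] by (auto simp: coprime_iff_gcd_eq_1)
      then show False using * q by (auto simp: Z.sifted_def in_prime_factors_iff)
    qed
  qed
  have "dirichlet_L (principal_character q) s = infsum (P.dterm s) UNIV"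
    by (rule P.dirichlet_L_conv_infsum[OF s])
  also have "\<dots> = infsum (Z.dterm s) (Z.sifted (prime_factors q))"
    by (rule infsum_cong_neutral) (auto simp: P.dterm_def Z.dterm_def principal_character_def cop)
  also have "\<dots> = (\<Prod>p\<in>prime_factors q. 1 - Z.dterm s p) * dirichlet_L (\<lambda>_. 1) s"
    by (rule Z.infsum_sifted[OF s]) auto
  also have "norm \<dots> \<le> 2 ^ card (prime_factors q) * norm (dirichlet_L (\<lambda>_. 1) s)"
  proof -
    have "norm (1 - Z.dterm s p) \<le> 2" if "p \<in> prime_factors q" for p
    proof -
      have "norm (Z.dterm s p) \<le> 3 / 4"
        using that s by (intro Z.norm_dterm_prime_le) (auto simp: in_prime_factors_iff)
      then show ?thesis using norm_triangle_ineq4[of 1 "Z.dterm s p"] by simp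
    qed
    then have "(\<Prod>p\<in>prime_factors q. norm (1 - Z.dterm s p)) \<le> (\<Prod>p\<in>prime_factors q. 2)"
      by (intro prod_mono) auto
    then show ?thesis by (simp add: norm_mult prod_norm[symmetric] mult_right_mono)
  qed
  finally show ?thesis .
qed

text \<open>The square of \<open>chi\<close> is a character. If it is principal, the bound comes from zeta at a point of
  height \<open>t \<noteq> 0\<close>, away from the pole; otherwise the series is holomorphic across \<open>Re s = 1\<close>.\<close>

lemma L_square_bounded:
  assumes chi: "dirichlet_character q chi" and q: "q > 1" and t: "t \<noteq> 0"
  obtains B where "\<And>\<sigma>. 1 < \<sigma> \<Longrightarrow> \<sigma> \<le> 2 \<Longrightarrow> norm (dirichlet_L (\<lambda>n. chi n ^ 2) (Complex \<sigma> t)) \<le> B"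
proof (cases "(\<lambda>n. chi n ^ 2) = principal_character q")
  case True
  let ?c = "\<Sum>n. real (Suc n) powr (- 2)"
  have c: "?c \<ge> 0"
    by (intro suminf_nonneg summable_Suc_powr) auto
  show ?thesis
  proof (rule that[of "2 ^ card (prime_factors q) * (1 / \<bar>t\<bar> + (2 + \<bar>t\<bar>) * ?c)"])
    fix \<sigma> :: real assume \<sigma>: "1 < \<sigma>" "\<sigma> \<le> 2"
    let ?s = "Complex \<sigma> t"
    have "norm (dirichlet_L (\<lambda>_. 1) ?s) \<le> norm (1 / (?s - 1)) + norm (dirichlet_L (\<lambda>_. 1) ?s - 1 / (?s - 1))"
      by (metis add.commute diff_add_cancel norm_triangle_ineq)
    also have "norm (dirichlet_L (\<lambda>_. 1) ?s - 1 / (?s - 1)) \<le> norm ?s * ?c"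
      using \<sigma> by (intro zeta_minus_pole_bound) auto
    also have "norm ?s * ?c \<le> (2 + \<bar>t\<bar>) * ?c"
      using \<sigma> cmod_le[of ?s] by (intro mult_right_mono c) auto
    also have "norm (1 / (?s - 1)) \<le> 1 / \<bar>t\<bar>"
      using abs_Im_le_cmod[of "?s - 1"] t by (auto simp: norm_divide intro!: divide_left_mono mult_pos_pos)
    finally have "norm (dirichlet_L (\<lambda>_. 1) ?s) \<le> 1 / \<bar>t\<bar> + (2 + \<bar>t\<bar>) * ?c" by simp
    then have "2 ^ card (prime_factors q) * norm (dirichlet_L (\<lambda>_. 1) ?s)
        \<le> 2 ^ card (prime_factors q) * (1 / \<bar>t\<bar> + (2 + \<bar>t\<bar>) * ?c)"
      by (rule mult_left_mono) auto
    moreover have "norm (dirichlet_L (principal_character q) ?s)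
        \<le> 2 ^ card (prime_factors q) * norm (dirichlet_L (\<lambda>_. 1) ?s)"
      using \<sigma> by (intro norm_L_principal_le[OF q]) auto
    ultimately show "norm (dirichlet_L (\<lambda>n. chi n ^ 2) ?s) \<le> 2 ^ card (prime_factors q) * (1 / \<bar>t\<bar> + (2 + \<bar>t\<bar>) * ?c)"
      unfolding True by (rule order_trans[rotated])
  qed
next
  case False
  have "dirichlet_character q (\<lambda>n. chi n ^ 2)"
    using chi by (auto simp: dirichlet_character_def power_mult_distrib)
  then have "dirichlet_L (\<lambda>n. chi n ^ 2) holomorphic_on {s. Re s > 0}"
    using False q by (rule dirichlet_L_holomorphic)
  then have "continuous_on {s. Re s > 0} (dirichlet_L (\<lambda>n. chi n ^ 2))"
    by (rule holomorphic_on_imp_continuous_on)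
  moreover have "(\<lambda>\<sigma>. Complex \<sigma> t) ` {1..2} \<subseteq> {s. Re s > 0}" by auto
  moreover have "continuous_on {1..2} (\<lambda>\<sigma>. Complex \<sigma> t)"
    unfolding Complex_eq by (intro continuous_intros)
  ultimately have "continuous_on {1..2} (\<lambda>\<sigma>. dirichlet_L (\<lambda>n. chi n ^ 2) (Complex \<sigma> t))"
    using continuous_on_compose2 by blast
  then have "bounded ((\<lambda>\<sigma>. dirichlet_L (\<lambda>n. chi n ^ 2) (Complex \<sigma> t)) ` {1..2})"
    by (intro compact_imp_bounded compact_continuous_image) auto
  then obtain B where "\<forall>x\<in>(\<lambda>\<sigma>. dirichlet_L (\<lambda>n. chi n ^ 2) (Complex \<sigma> t)) ` {1..2}. norm x \<le> B"
    by (auto simp: bounded_iff)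
  then show ?thesis by (intro that[of B]) auto
qed

text \<open>The classical argument: if \<open>L\<close> vanished at \<open>1 + \<i>t\<close>, then as \<open>\<delta> \<rightarrow> 0\<close> the product in the 3-4-1
  inequality at \<open>1 + \<delta>\<close> would be at most of order \<open>\<delta>\<^sup>-\<^sup>3 \<delta>\<^sup>4\<close>, hence not bounded below by \<open>1\<close>.\<close>

theorem dirichlet_L_nonzero_line_1:
  assumes chi: "dirichlet_character q chi" and np: "chi \<noteq> principal_character q" and q: "q > 1" and t: "t \<noteq> 0"
  shows "dirichlet_L chi (Complex 1 t) \<noteq> 0"
proof
  assume zero: "dirichlet_L chi (Complex 1 t) = 0"
  interpret completely_multiplicative chi
    using completely_multiplicative_character[OF chi] q by auto
  obtain B where B: "\<And>\<sigma>. 1 < \<sigma> \<Longrightarrow> \<sigma> \<le> 2 \<Longrightarrow> norm (dirichlet_L (\<lambda>n. chi n ^ 2) (Complex \<sigma> (2 * t))) \<le> B"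
    using L_square_bounded[OF chi q, of "2 * t"] t by auto
  let ?L = "dirichlet_L chi" and ?zz = "Complex 1 t"
  have "?L field_differentiable (at ?zz)"
    by (rule holomorphic_on_imp_differentiable_at[OF dirichlet_L_holomorphic[OF chi np q] open_halfspace_Re_gt]) auto
  then obtain D where "(?L has_field_derivative D) (at ?zz)" by (auto simp: field_differentiable_def)
  then have "((\<lambda>y. (?L y - ?L ?zz) / (y - ?zz)) \<longlongrightarrow> D) (at ?zz)"
    by (simp add: has_field_derivative_iff)
  then have "\<forall>\<^sub>F y in at ?zz. norm ((?L y - ?L ?zz) / (y - ?zz)) < norm D + 1"
    by (intro order_tendstoD(2)[OF tendsto_norm]) auto
  then obtain d where d: "d > 0" "\<And>y. y \<noteq> ?zz \<Longrightarrow> dist y ?zz < d \<Longrightarrow> norm (?L y / (y - ?zz)) < norm D + 1"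
    using zero by (auto simp: eventually_at)
  let ?c = "\<Sum>n. real (Suc n) powr (- 2)"
  have c: "?c \<ge> 0"
    by (intro suminf_nonneg summable_Suc_powr) auto
  define E where "E = (1 + 2 * ?c) ^ 3 * (norm D + 1) ^ 4 * \<bar>B\<bar> + 1"
  have E: "E > 0" using c by (auto simp: E_def intro!: add_nonneg_pos mult_nonneg_nonneg)
  have small: "1 \<le> E * \<delta>" if \<delta>: "0 < \<delta>" "\<delta> < d" "\<delta> \<le> 1" for \<delta>
  proof -
    let ?Z = "dirichlet_L (\<lambda>_. 1) (of_real (1 + \<delta>))" and ?s = "Complex (1 + \<delta>) t"
    have "norm ?Z \<le> norm (1 / (complex_of_real (1 + \<delta>) - 1)) + norm (?Z - 1 / (of_real (1 + \<delta>) - 1))"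
      by (metis add.commute diff_add_cancel norm_triangle_ineq)
    also have "norm (?Z - 1 / (of_real (1 + \<delta>) - 1)) \<le> norm (complex_of_real (1 + \<delta>)) * ?c"
      using \<delta> by (intro zeta_minus_pole_bound) auto
    also have "norm (complex_of_real (1 + \<delta>)) * ?c \<le> 2 * ?c"
      using \<delta> c by (intro mult_right_mono) (auto simp: norm_of_real simp del: of_real_add)
    also have "norm (1 / (complex_of_real (1 + \<delta>) - 1)) = 1 / \<delta>" using \<delta> by (simp add: norm_divide)
    also have "1 / \<delta> + 2 * ?c \<le> (1 + 2 * ?c) / \<delta>"
      using \<delta> c mult_left_mono[of \<delta> 1 "2 * ?c"] by (simp add: field_simps)
    finally have Z: "norm ?Z \<le> (1 + 2 * ?c) / \<delta>" by simp
    have diff: "?s - ?zz = of_real \<delta>" by (simp add: complex_eq_iff)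
    have "?s \<noteq> ?zz" using \<delta> by simp
    moreover have "dist ?s ?zz < d" unfolding dist_norm diff using \<delta> by simp
    ultimately have "norm (?L ?s / of_real \<delta>) < norm D + 1"
      using d(2)[of ?s] unfolding diff by blast
    then have L: "norm (?L ?s) \<le> (norm D + 1) * \<delta>" using \<delta> by (simp add: norm_divide field_simps)
    have B': "norm (dirichlet_L (\<lambda>n. chi n ^ 2) (Complex (1 + \<delta>) (2 * t))) \<le> \<bar>B\<bar>"
      using B[of "1 + \<delta>"] \<delta> by linarith
    have "1 \<le> norm ?Z ^ 3 * norm (?L ?s) ^ 4 * norm (dirichlet_L (\<lambda>n. chi n ^ 2) (Complex (1 + \<delta>) (2 * t)))"
      by (rule euler_product_341) (use norm_character[OF chi] q \<delta> in auto)
    also have "\<dots> \<le> ((1 + 2 * ?c) / \<delta>) ^ 3 * ((norm D + 1) * \<delta>) ^ 4 * \<bar>B\<bar>"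
      using \<delta> c by (intro mult_mono power_mono Z L B') (auto intro!: mult_nonneg_nonneg)
    also have "\<dots> = (1 + 2 * ?c) ^ 3 * (norm D + 1) ^ 4 * \<bar>B\<bar> * \<delta>"
    proof -
      have "(u / \<delta>) ^ 3 * (v * \<delta>) ^ 4 * b = u ^ 3 * v ^ 4 * b * \<delta>" for u v b :: real
        using \<delta> by (simp add: field_simps eval_nat_numeral)
      then show ?thesis .
    qed
    also have "\<dots> \<le> E * \<delta>" using \<delta> by (simp add: E_def algebra_simps)
    finally show ?thesis .
  qed
  define \<delta> where "\<delta> = min (min (d / 2) 1) (1 / (2 * E))"
  have "0 < \<delta>" "\<delta> < d" "\<delta> \<le> 1" "\<delta> \<le> 1 / (2 * E)" using d E by (auto simp: \<delta>_def)
  moreover have "E * \<delta> \<le> E * (1 / (2 * E))" using \<open>\<delta> \<le> 1 / (2 * E)\<close> E by (intro mult_left_mono) auto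
  ultimately show False using small[of \<delta>] E by simp
qed

section \<open>Logarithms of holomorphic functions on a disc\<close>

text \<open>The Blaschke factor of the disc of radius \<open>R\<close> about \<open>0\<close> with zero \<open>a\<close>.\<close>

definition blaschke :: "real \<Rightarrow> complex \<Rightarrow> complex \<Rightarrow> complex" where
  "blaschke R a z = of_real R * (z - a) / (of_real (R\<^sup>2) - cnj a * z)"

lemma blaschke_denominator_lower:
  assumes "norm a \<le> r" "norm z \<le> R" "0 \<le> r" "0 \<le> R"
  shows "norm (of_real (R\<^sup>2) - cnj a * z) \<ge> R * (R - r)"
proof -
  have "norm (cnj a * z) \<le> r * R"
    unfolding norm_mult using assms by (intro mult_mono) auto
  moreover have "norm (complex_of_real (R\<^sup>2)) = R\<^sup>2" by (simp add: norm_power)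
  moreover have "norm (of_real (R\<^sup>2) - cnj a * z) \<ge> norm (complex_of_real (R\<^sup>2)) - norm (cnj a * z)"
    by (rule norm_triangle_ineq2)
  ultimately show ?thesis by (simp add: algebra_simps power2_eq_square)
qed

lemma norm_blaschke_on_circle:
  assumes "norm z = R" "norm a < R"
  shows "norm (blaschke R a z) = 1"
proof -
  have R: "R > 0" using assms norm_ge_zero[of a] by linarith
  have "complex_of_real (R\<^sup>2) = z * cnj z"
    using assms(1) complex_norm_square[of z] by simp
  then have "of_real (R\<^sup>2) - cnj a * z = z * cnj (z - a)" by (simp add: algebra_simps)
  then have "norm (of_real (R\<^sup>2) - cnj a * z) = R * norm (z - a)"
    using assms(1) by (simp only: norm_mult complex_mod_cnj)
  moreover have "z \<noteq> a" using assms by auto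
  ultimately show ?thesis using R by (simp add: blaschke_def norm_divide norm_mult)
qed

text \<open>Dividing out a zero by a Blaschke factor keeps the bound \<open>M\<close> on the disc but enlarges the
  value at the centre by at least \<open>R / r\<close>. Hence this can be repeated only about
  \<open>log (M / \<bar>f(0)\<bar>)\<close> times, which bounds the number of zeros as in Jensen's formula.\<close>

lemma blaschke_division:
  assumes f: "f holomorphic_on S" "open S" "cball 0 R \<subseteq> S"
    and M: "\<And>z. norm z \<le> R \<Longrightarrow> norm (f z) \<le> M"
    and a: "f a = 0" "norm a \<le> r" and r: "0 < r" "r < R" and f0: "f 0 \<noteq> 0"
  obtains g where "g holomorphic_on S"
    and "\<And>z. norm z \<le> R \<Longrightarrow> f z = blaschke R a z * g z"
    and "\<And>z. norm z \<le> R \<Longrightarrow> norm (g z) \<le> M" and "norm (g 0) \<ge> norm (f 0) * (R / r)"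
proof -
  have R: "R > 0" using r by linarith
  let ?q = "\<lambda>z. if z = a then deriv f a else (f z - f a) / (z - a)"
  have q: "?q holomorphic_on S"
    by (rule pole_lemma_open[OF f(1) f(2)])
  define g where "g = (\<lambda>z. ?q z * (of_real (R\<^sup>2) - cnj a * z) / of_real R)"
  have g: "g holomorphic_on S"
    unfolding g_def using R by (intro holomorphic_intros q) auto
  have den: "of_real (R\<^sup>2) - cnj a * z \<noteq> 0" if "norm z \<le> R" for z
  proof -
    have "R * (R - r) > 0" using R r by auto
    also have "R * (R - r) \<le> norm (of_real (R\<^sup>2) - cnj a * z)"
      by (rule blaschke_denominator_lower[OF a(2) that]) (use r R in auto)
    finally show ?thesis by auto
  qed
  have eq: "f z = blaschke R a z * g z" if "norm z \<le> R" for z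
    using den[OF that] R a by (cases "z = a") (simp_all add: blaschke_def g_def)
  have le: "norm (g z) \<le> M" if z: "norm z \<le> R" for z
  proof (rule maximum_modulus_frontier[of g "cball 0 R"])
    show "g holomorphic_on interior (cball 0 R)"
      by (rule holomorphic_on_subset[OF g]) (use f(3) in \<open>auto simp: subset_iff\<close>)
    show "continuous_on (closure (cball 0 R)) g"
      using R f(3) by (auto intro!: holomorphic_on_imp_continuous_on holomorphic_on_subset[OF g])
    fix w :: complex assume "w \<in> frontier (cball 0 R)"
    then have w: "norm w = R" using R by (simp add: frontier_cball)
    have "norm (f w) = norm (g w)"
      using eq[of w] norm_blaschke_on_circle[of w R a] w a r by (simp add: norm_mult)
    then show "norm (g w) \<le> M" using M[of w] w by simp
  qed (use z in auto)
  have "norm (f 0) = norm a / R * norm (g 0)"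
    using eq[of 0] R by (simp add: blaschke_def norm_mult norm_divide power2_eq_square)
  also have "\<dots> \<le> r / R * norm (g 0)"
    using a R by (intro mult_right_mono divide_right_mono) auto
  finally have "norm (g 0) \<ge> norm (f 0) * (R / r)" using R r by (simp add: field_simps)
  with g eq le show ?thesis using that by blast
qed


text \<open>Iterated division. The value at the centre grows geometrically but stays below \<open>M\<close>, so the
  induction on the number \<open>N\<close> of divisions that are still possible ends with a factor without zeros.\<close>

lemma zero_free_factorization:
  assumes S: "open S" "cball 0 R \<subseteq> S" and r: "0 < r" "r < R"
    and f: "f holomorphic_on S" "\<And>z. norm z \<le> R \<Longrightarrow> norm (f z) \<le> M" "f 0 \<noteq> 0"
  shows "\<exists>as g. g holomorphic_on S \<and>
           (\<forall>z. norm z \<le> R \<longrightarrow> f z = (\<Prod>a\<leftarrow>as. blaschke R a z) * g z) \<and>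
           (\<forall>z. norm z \<le> R \<longrightarrow> norm (g z) \<le> M) \<and>
           (\<forall>a\<in>set as. norm a \<le> r \<and> f a = 0) \<and>
           (\<forall>z. norm z \<le> r \<longrightarrow> g z \<noteq> 0) \<and>
           norm (f 0) * (R / r) ^ length as \<le> norm (g 0)"
proof -
  have Rr: "R / r > 1" using r by simp
  obtain N where "M / norm (f 0) < (R / r) ^ N" using real_arch_pow[OF Rr] by blast
  then have "M < norm (f 0) * (R / r) ^ N" using f(3) by (simp add: field_simps)
  with f show ?thesis
  proof (induction N arbitrary: f)
    case 0
    have "norm (f 0) \<le> M" by (rule "0.prems"(2)) (use r in simp)
    with "0.prems"(4) show ?case by simp
  next
    case (Suc N)
    show ?case
    proof (cases "\<forall>z. norm z \<le> r \<longrightarrow> f z \<noteq> 0")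
      case True
      with Suc.prems show ?thesis by (intro exI[of _ "[]"] exI[of _ f]) auto
    next
      case False
      then obtain a where a: "f a = 0" "norm a \<le> r" by blast
      obtain g where g: "g holomorphic_on S" "\<And>z. norm z \<le> R \<Longrightarrow> f z = blaschke R a z * g z"
          "\<And>z. norm z \<le> R \<Longrightarrow> norm (g z) \<le> M" "norm (g 0) \<ge> norm (f 0) * (R / r)"
        using blaschke_division[OF Suc.prems(1) S Suc.prems(2) a r Suc.prems(3)] by metis
      have g0: "g 0 \<noteq> 0" using g(2)[of 0] Suc.prems(3) r by auto
      have "M < norm (f 0) * (R / r) * (R / r) ^ N" using Suc.prems(4) by (simp add: mult_ac)
      also have "\<dots> \<le> norm (g 0) * (R / r) ^ N"
        using g(4) Rr by (intro mult_right_mono) auto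
      finally obtain as h where h: "h holomorphic_on S"
           "\<And>z. norm z \<le> R \<Longrightarrow> g z = (\<Prod>a\<leftarrow>as. blaschke R a z) * h z"
           "\<And>z. norm z \<le> R \<Longrightarrow> norm (h z) \<le> M"
           "\<And>a. a \<in> set as \<Longrightarrow> norm a \<le> r \<and> g a = 0"
           "\<And>z. norm z \<le> r \<Longrightarrow> h z \<noteq> 0"
           "norm (g 0) * (R / r) ^ length as \<le> norm (h 0)"
        using Suc.IH[OF g(1) g(3) g0] by blast
      have "norm (f 0) * (R / r) ^ length (a # as) = norm (f 0) * (R / r) * (R / r) ^ length as"
        by (simp add: mult_ac)
      also have "\<dots> \<le> norm (g 0) * (R / r) ^ length as"
        using g(4) Rr by (intro mult_right_mono) auto
      finally have le: "norm (f 0) * (R / r) ^ length (a # as) \<le> norm (h 0)" using h(6) by linarith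
      have zeros: "\<forall>b\<in>set (a # as). norm b \<le> r \<and> f b = 0"
        using a h(4) g(2) r by fastforce
      have "\<forall>z. norm z \<le> R \<longrightarrow> f z = (\<Prod>a\<leftarrow>a # as. blaschke R a z) * h z"
        using g(2) h(2) by (simp add: mult_ac)
      with h(1,3,5) le zeros show ?thesis
        by (intro exI[of _ "a # as"] exI[of _ h]) blast
    qed
  qed
qed

text \<open>The map \<open>w \<mapsto> w / (2B - w)\<close> sends the half-plane \<open>Re w < B\<close> into the unit disc and fixes \<open>0\<close>,
  so the Schwarz lemma applies.\<close>

lemma borel_caratheodory:
  assumes h: "h holomorphic_on ball 0 r" and r: "r > 0"
    and B: "\<And>z. norm z < r \<Longrightarrow> Re (h z) < Re (h 0) + B"
    and z: "norm z < r"
  shows "norm (h z - h 0) \<le> 2 * B * norm z / (r - norm z)"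
proof -
  have B0: "B > 0" using B[of 0] r by simp
  define \<phi> where "\<phi> = (\<lambda>w. h (of_real r * w) - h 0)"
  define \<psi> where "\<psi> = (\<lambda>w. \<phi> w / (of_real (2 * B) - \<phi> w))"
  have in_ball: "norm (of_real r * w) < r" if "norm w < 1" for w :: complex
    using that r by (simp add: norm_mult)
  have Re: "Re (\<phi> w) < B" if "norm w < 1" for w
    using B[OF in_ball[OF that]] by (simp add: \<phi>_def)
  have nz: "of_real (2 * B) - \<phi> w \<noteq> 0" if "norm w < 1" for w
    using Re[OF that] B0 by (auto simp: complex_eq_iff)
  have "(\<lambda>w. h (of_real r * w)) holomorphic_on ball 0 1"
    by (rule holomorphic_on_compose_gen[OF _ h, unfolded o_def])
       (use in_ball in \<open>auto intro!: holomorphic_intros simp del: mult_less_cancel_left\<close>)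
  then have hol: "\<psi> holomorphic_on ball 0 1"
    unfolding \<psi>_def \<phi>_def using nz by (intro holomorphic_intros) (auto simp: \<phi>_def)
  have lt: "norm (\<psi> w) < 1" if w: "norm w < 1" for w
  proof -
    have "(norm (\<phi> w))\<^sup>2 < (norm (of_real (2 * B) - \<phi> w))\<^sup>2"
      using Re[OF w] B0 mult_strict_left_mono[of "Re (\<phi> w)" B B]
      unfolding cmod_power2 by (simp add: power2_eq_square algebra_simps)
    then have "norm (\<phi> w) < norm (of_real (2 * B) - \<phi> w)"
      by (rule power2_less_imp_less) auto
    then show ?thesis using nz[OF w] by (simp add: \<psi>_def norm_divide)
  qed
  define w where "w = z / of_real r"
  have w: "norm w < 1" "of_real r * w = z" "norm w = norm z / r"
    using z r by (auto simp: w_def norm_divide)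
  have le: "norm (\<psi> w) \<le> norm w"
    by (rule Schwarz_Lemma(1)[OF hol _ lt w(1)]) (auto simp: \<psi>_def \<phi>_def)
  have "\<phi> w * (1 + \<psi> w) = of_real (2 * B) * \<psi> w"
    using nz[OF w(1)] by (simp add: \<psi>_def field_simps)
  then have eq: "norm (\<phi> w) * norm (1 + \<psi> w) = 2 * B * norm (\<psi> w)"
    using B0 by (metis norm_mult norm_of_real abs_of_pos mult_pos_pos zero_less_numeral)
  have "norm (1 + \<psi> w) \<ge> 1 - norm w"
    using norm_triangle_ineq4[of "1 + \<psi> w" "\<psi> w"] le by simp
  then have "norm (\<phi> w) * (1 - norm w) \<le> norm (\<phi> w) * norm (1 + \<psi> w)"
    by (rule mult_left_mono) auto
  also have "\<dots> \<le> 2 * B * norm w" unfolding eq using le B0 by (intro mult_left_mono) auto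
  finally have "norm (\<phi> w) \<le> 2 * B * norm w / (1 - norm w)" using w(1) by (simp add: field_simps)
  also have "\<dots> = 2 * B * norm z / (r - norm z)"
  proof -
    have "1 - norm w = (r - norm z) / r" using r w(3) by (simp add: diff_divide_distrib)
    then show ?thesis using r z w(3) by simp
  qed
  finally show ?thesis using w(2) by (simp add: \<phi>_def)
qed


lemma norm_ln_le:
  fixes w :: complex
  assumes "0 < A" "A \<le> norm w" "norm w \<le> B"
  shows "norm (ln w) \<le> \<bar>ln A\<bar> + \<bar>ln B\<bar> + 4"
proof -
  have w: "w \<noteq> 0" using assms by auto
  have "norm (ln w) \<le> \<bar>Re (ln w)\<bar> + \<bar>Im (ln w)\<bar>" by (rule cmod_le)
  also have "Re (ln w) = ln (norm w)" using w by simp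
  also have "\<bar>ln (norm w)\<bar> \<le> \<bar>ln A\<bar> + \<bar>ln B\<bar>"
  proof -
    have "ln A \<le> ln (norm w)" "ln (norm w) \<le> ln B" using assms w by auto
    then show ?thesis by linarith
  qed
  also have "\<bar>Im (ln w)\<bar> \<le> 4"
    using mpi_less_Im_Ln[OF w] Im_Ln_le_pi[OF w] pi_less_4 by linarith
  finally show ?thesis by simp
qed

lemma abs_ln_le:
  fixes x :: real
  assumes "1 / (c + 1) \<le> x" "x \<le> c + 1" "c \<ge> 0"
  shows "\<bar>ln x\<bar> \<le> c"
proof -
  have x: "x > 0" using assms by (smt (verit) divide_pos_pos)
  have "ln x \<le> c" using ln_le_minus_one[OF x] assms by linarith
  moreover have "ln (1 / x) \<le> 1 / x - 1" using x by (intro ln_le_minus_one) auto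
  moreover have "1 / x \<le> c + 1" using assms x by (simp add: field_simps)
  ultimately show ?thesis using x by (simp add: ln_div)
qed

lemma Re_ge_minus_norm: "- norm z \<le> Re z"
  using abs_Re_le_cmod[of z] by linarith

lemma norm_sum_list_le:
  fixes f :: "'a \<Rightarrow> 'b :: real_normed_vector"
  assumes "\<And>x. x \<in> set xs \<Longrightarrow> norm (f x) \<le> c"
  shows "norm (\<Sum>x\<leftarrow>xs. f x) \<le> c * real (length xs)"
  using assms
proof (induction xs)
  case (Cons x xs)
  have "norm (\<Sum>x\<leftarrow>x # xs. f x) \<le> norm (f x) + norm (\<Sum>x\<leftarrow>xs. f x)" by (simp add: norm_triangle_ineq)
  also have "\<dots> \<le> c + c * real (length xs)" using Cons by (intro add_mono) auto
  finally show ?case by (simp add: algebra_simps)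
qed auto

lemma Re_Im_sum_list:
  "Re (\<Sum>x\<leftarrow>xs. f x) = (\<Sum>x\<leftarrow>xs. Re (f x))" "Im (\<Sum>x\<leftarrow>xs. f x) = (\<Sum>x\<leftarrow>xs. Im (f x))"
  by (induction xs) auto

text \<open>Local structure of a branch \<open>lg\<close> of \<open>log f\<close> to the right of the vertical line \<open>Re z = b\<close>
  when all zeros of \<open>f\<close> in the disc lie on or to the left of that line: after Blaschke factors are
  removed, what remains has a logarithm that Borel--Caratheodory controls. Each zero \<open>a\<close>
  contributes \<open>log (z - a)\<close>, which has bounded argument and whose derivative has positive real part.
  The radii are made for discs about \<open>2 + \<i>t\<close>: the critical line is at distance \<open>3 / 2 = - b\<close>, the
  radii \<open>16 / 10\<close> and \<open>17 / 10\<close> leave room for Cauchy's estimate and for Borel--Caratheodory, and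
  \<open>18 / 10\<close> keeps the disc in the right half-plane.\<close>

lemma local_log_bounds:
  fixes f lg :: "complex \<Rightarrow> complex" and M b :: real
  defines "r \<equiv> 17 / 10" and "R \<equiv> 18 / 10"
  defines "U \<equiv> {z. norm z < r \<and> Re z > b}"
  defines "B \<equiv> ln (M / norm (f 0)) + 1"
  assumes S: "open S" "cball 0 R \<subseteq> S" and f: "f holomorphic_on S" "\<And>z. norm z \<le> R \<Longrightarrow> norm (f z) \<le> M" "f 0 \<noteq> 0"
    and b: "b = - 3 / 2" and zeros: "\<And>z. norm z \<le> r \<Longrightarrow> f z = 0 \<Longrightarrow> Re z \<le> b"
    and l: "lg holomorphic_on U" "\<And>z. z \<in> U \<Longrightarrow> exp (lg z) = f z"
    and z: "norm z \<le> 3 / 2" "Re z > b"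
  shows "\<bar>Im (lg z) - Im (lg 0)\<bar> \<le> 200 * B"
    and "norm (lg z - lg 0) \<le> 800 * B * (1 + \<bar>ln (Re z - b)\<bar>)"
    and "Re (deriv lg z) \<ge> - 500 * B"
proof -
  note r_def [simp] R_def [simp]
  have rR: "0 < r" "r < R" by auto
  obtain as g where g: "g holomorphic_on S"
      "\<And>z. norm z \<le> R \<Longrightarrow> f z = (\<Prod>a\<leftarrow>as. blaschke R a z) * g z"
      "\<And>z. norm z \<le> R \<Longrightarrow> norm (g z) \<le> M"
      "\<And>a. a \<in> set as \<Longrightarrow> norm a \<le> r \<and> f a = 0"
      "\<And>z. norm z \<le> r \<Longrightarrow> g z \<noteq> 0"
      "norm (f 0) * (R / r) ^ length as \<le> norm (g 0)"
    using zero_free_factorization[OF S rR(1,2) f] by blast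
  have a: "norm a \<le> r" "Re a \<le> b" if "a \<in> set as" for a
    using g(4)[OF that] zeros by auto
  define n where "n = length as"
  have f0: "norm (f 0) > 0" using f by auto
  have f0M: "norm (f 0) \<le> M" using f(2)[of 0] rR by simp
  have M0: "M > 0" using f0 f0M by linarith
  have B1: "B \<ge> 1" using f0 f0M by (simp add: B_def)
  have "1 * norm (f 0) \<le> (R / r) ^ n * norm (f 0)"
    using rR by (intro mult_right_mono one_le_power) auto
  then have g0: "norm (f 0) \<le> norm (g 0)" using g(6) by (simp add: mult_ac n_def)
  have g0M: "norm (g 0) \<le> M" using g(3)[of 0] rR by simp
  \<comment> \<open>Each of the \<open>n\<close> zeros costs a factor \<open>R / r = 18 / 17\<close>, whose logarithm is at least \<open>1 / 18\<close>.\<close>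
  have nB: "real n \<le> 18 * B"
  proof -
    have "(R / r) ^ n \<le> M / norm (f 0)"
    proof -
      have "norm (f 0) * (R / r) ^ n \<le> M" using g(6) g0M unfolding n_def by (rule order_trans)
      then show ?thesis using f0 by (subst pos_le_divide_eq) (simp_all only: mult.commute)
    qed
    moreover have "(R / r) ^ n > 0" "M / norm (f 0) > 0"
      using rR(1,2) f0 order_less_le_trans[OF f0 f0M] by auto
    ultimately have "ln ((R / r) ^ n) \<le> ln (M / norm (f 0))"
      by (subst ln_le_cancel_iff)
    moreover have "ln ((R / r) ^ n) = real n * ln (R / r)" using rR(1,2) by (intro ln_realpow)
    ultimately have "real n * ln (R / r) \<le> B" unfolding B_def by linarith
    moreover have "ln (R / r) \<ge> 1 / 18"
    proof -
      have "ln (r / R) \<le> r / R - 1" using rR(1,2) by (intro ln_le_minus_one) auto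
      moreover have "ln (R / r) = - ln (r / R)" using rR(1,2) by (simp add: ln_div)
      moreover have "r / R = 17 / 18" by (simp add: r_def R_def)
      ultimately show ?thesis by linarith
    qed
    then have "real n * (1 / 18) \<le> real n * ln (R / r)" by (intro mult_left_mono) auto
    ultimately show ?thesis by linarith
  qed
  have ballS: "ball 0 r \<subseteq> S" using S rR by (auto simp: subset_iff)
  obtain h where h: "h holomorphic_on ball 0 r" "\<And>z. z \<in> ball 0 r \<Longrightarrow> exp (h z) = g z"
  proof (rule holomorphic_logarithm_exists[of "ball 0 r" g 0])
    show "g holomorphic_on ball 0 r" using g(1) ballS by (rule holomorphic_on_subset)
  qed (use g(5) rR in auto)
  have Re_h: "Re (h z) = ln (norm (g z))" if "norm z < r" for z
    using h(2)[of z] that by (metis dist_0_norm ln_exp mem_ball norm_exp_eq_Re)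
  have BC: "norm (h z - h 0) \<le> 2 * B * norm z / (r - norm z)" if "norm z < r" for z
  proof (rule borel_caratheodory[OF h(1) rR(1) _ that])
    fix w :: complex assume w: "norm w < r"
    have "g w \<noteq> 0" using g(5)[of w] w by simp
    then have "ln (norm (g w)) \<le> ln M" using g(3)[of w] w M0 by (subst ln_le_cancel_iff) auto
    moreover have "ln (norm (f 0)) \<le> ln (norm (g 0))" using f0 g0 by (subst ln_le_cancel_iff) auto
    ultimately show "Re (h w) < Re (h 0) + B"
      using Re_h[OF w] Re_h[of 0] f0 M0 by (simp add: B_def ln_div)
  qed
  have h_bound: "norm (h w - h 0) \<le> 32 * B" if "norm w \<le> 16 / 10" for w
  proof -
    have "norm (h w - h 0) \<le> 2 * B * norm w / (r - norm w)" using BC[of w] that rR by simp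
    also have "\<dots> \<le> 2 * B * (16 / 10) / (1 / 10)"
      using that B1 rR by (intro frac_le mult_left_mono) auto
    finally show ?thesis by simp
  qed
  \<comment> \<open>\<open>e z a\<close> is a logarithm of the Blaschke factor; for \<open>z\<close> in \<open>U\<close> both principal branches are
    taken at points with positive real part.\<close>
  define e where "e = (\<lambda>z a. ln (z - a) - ln (of_real (R\<^sup>2) - cnj a * z) + of_real (ln R))"
  define E where "E = (\<lambda>z. (\<Sum>a\<leftarrow>as. e z a) + h z)"
  have den: "norm (of_real (R\<^sup>2) - cnj a * z) \<ge> 18 / 100" "Re (of_real (R\<^sup>2) - cnj a * z) > 0"
       "norm (of_real (R\<^sup>2) - cnj a * z) \<le> 7"
    if "a \<in> set as" "norm z \<le> r" for a z
  proof -
    show "norm (of_real (R\<^sup>2) - cnj a * z) \<ge> 18 / 100"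
      using blaschke_denominator_lower[of a r z R] a[OF that(1)] that(2) rR by simp
    have "norm (cnj a * z) \<le> r * r"
      unfolding norm_mult using a[OF that(1)] that(2) rR by (intro mult_mono) auto
    then have n: "norm (cnj a * z) \<le> 289 / 100" using rR by simp
    then show "Re (of_real (R\<^sup>2) - cnj a * z) > 0"
      using complex_Re_le_cmod[of "cnj a * z"] rR by (simp add: power2_eq_square)
    show "norm (of_real (R\<^sup>2) - cnj a * z) \<le> 7"
      using norm_triangle_ineq4[of "of_real (R\<^sup>2)" "cnj a * z"] n rR
      by (simp add: norm_power power2_eq_square)
  qed
  have U: "0 \<in> U" "z \<in> U" "open U" "convex U"
  proof -
    show "0 \<in> U" "z \<in> U" using rR b z by (auto simp: U_def)
    have "U = ball 0 r \<inter> {z. Re z > b}" by (auto simp: U_def)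
    then show "open U" "convex U"
      by (auto intro!: open_Int open_halfspace_Re_gt convex_Int convex_halfspace_Re_gt)
  qed
  have Re_za: "Re (w - a) > 0" if "w \<in> U" "a \<in> set as" for w a
    using that a[OF that(2)] by (auto simp: U_def)
  have E_der: "(E has_field_derivative
      (\<Sum>a\<leftarrow>as. 1 / (w - a) + cnj a / (of_real (R\<^sup>2) - cnj a * w)) + deriv h w) (at w)" if w: "w \<in> U" for w
  proof -
    have 1: "((\<lambda>z. e z a) has_field_derivative
            1 / (w - a) + cnj a / (of_real (R\<^sup>2) - cnj a * w)) (at w)" if "a \<in> set as" for a
    proof -
      have "w - a \<notin> \<real>\<^sub>\<le>\<^sub>0" using Re_za[OF w that] by (auto simp: complex_nonpos_Reals_iff)
      moreover have "of_real (R\<^sup>2) - cnj a * w \<notin> \<real>\<^sub>\<le>\<^sub>0"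
        using den(2)[OF that, of w] w unfolding complex_nonpos_Reals_iff U_def by auto
      ultimately show ?thesis unfolding e_def by (auto intro!: derivative_eq_intros simp: divide_simps)
    qed
    have "((\<lambda>z. \<Sum>a\<leftarrow>xs. e z a) has_field_derivative
            (\<Sum>a\<leftarrow>xs. 1 / (w - a) + cnj a / (of_real (R\<^sup>2) - cnj a * w))) (at w)" if "set xs \<subseteq> set as" for xs
      using that
    proof (induction xs)
      case (Cons x xs)
      then show ?case using DERIV_add[OF 1[of x] Cons.IH] by simp
    qed auto
    moreover have "(h has_field_derivative deriv h w) (at w)"
      using w by (intro holomorphic_derivI[OF h(1)]) (auto simp: U_def)
    ultimately show ?thesis unfolding E_def by (intro DERIV_add) auto
  qed
  have E_cont: "continuous_on U E"
    using E_der by (intro continuous_at_imp_continuous_on) (blast intro: DERIV_isCont)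
  have E_exp: "exp (E w) = f w" if w: "w \<in> U" for w
  proof -
    have 1: "exp (e w a) = blaschke R a w"
      if "a \<in> set as" for a
    proof -
      have "w - a \<noteq> 0" using Re_za[OF w that] by auto
      moreover have "of_real (R\<^sup>2) - cnj a * w \<noteq> 0"
        using den(2)[OF that, of w] w unfolding U_def by (smt (verit) mem_Collect_eq zero_complex.sel(1))
      moreover have "exp (complex_of_real (ln R)) = of_real R" using rR by (simp only: exp_of_real exp_ln)
      ultimately show ?thesis
        by (simp only: e_def exp_add exp_diff exp_Ln blaschke_def) (simp add: mult_ac)
    qed
    have "exp (\<Sum>a\<leftarrow>xs. e w a) = (\<Prod>a\<leftarrow>xs. blaschke R a w)"
      if "set xs \<subseteq> set as" for xs
      using that by (induction xs) (auto simp: exp_add 1)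
    then have "exp (E w) = (\<Prod>a\<leftarrow>as. blaschke R a w) * g w"
      using h(2)[of w] w by (simp add: E_def exp_add[of _ "h w"] U_def)
    then show ?thesis using g(2)[of w] w rR by (simp add: U_def)
  qed
  have lE: "lg w - E w = lg 0 - E 0" if "w \<in> U" for w
    by (rule eq_if_exp_eq_on_connected[of U])
       (use that U l E_exp E_cont in \<open>auto intro: convex_connected holomorphic_on_imp_continuous_on\<close>)
  then have diff: "lg z - lg 0 = E z - E 0" using U(2) by (simp add: algebra_simps)
  have E_diff: "E z - E 0 = (\<Sum>a\<leftarrow>as. e z a - e 0 a) + (h z - h 0)"
    by (simp add: E_def sum_list_subtractf)
  have hz: "norm (h z - h 0) \<le> 32 * B" using h_bound z by simp
  have z_r: "norm z \<le> r" using z rR by simp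
  show "\<bar>Im (lg z) - Im (lg 0)\<bar> \<le> 200 * B"
  proof -
    have Im_e: "\<bar>Im (e z a - e 0 a)\<bar> \<le> 8" if "a \<in> set as" for a
    proof -
      have "\<bar>Im (ln x)\<bar> \<le> 2" if "Re x > 0" for x
        using Re_Ln_pos_lt_imp[OF that] pi_less_4 by auto
      from this[OF Re_za[OF U(2) that]] this[OF Re_za[OF U(1) that]] this[OF den(2)[OF that z_r]]
        this[OF den(2)[OF that, of 0]] rR
      show ?thesis unfolding e_def by (simp only: minus_complex.sel plus_complex.sel Im_complex_of_real norm_zero) linarith
    qed
    have "\<bar>Im (\<Sum>a\<leftarrow>as. e z a - e 0 a)\<bar> \<le> 8 * real n"
      unfolding Re_Im_sum_list n_def real_norm_def[symmetric]
      by (rule norm_sum_list_le) (use Im_e in \<open>simp only: real_norm_def\<close>)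
    moreover have "\<bar>Im (h z - h 0)\<bar> \<le> 32 * B" using hz abs_Im_le_cmod order_trans by blast
    moreover have "Im (lg z) - Im (lg 0) = Im (\<Sum>a\<leftarrow>as. e z a - e 0 a) + Im (h z - h 0)"
      using arg_cong[OF diff, of Im] unfolding E_diff by simp
    ultimately show ?thesis using nB B1 by linarith
  qed
  show "norm (lg z - lg 0) \<le> 800 * B * (1 + \<bar>ln (Re z - b)\<bar>)"
  proof -
    let ?X = "\<bar>ln (Re z - b)\<bar>"
    have e: "norm (e z a - e 0 a) \<le> 42 + ?X" if aa: "a \<in> set as" for a
    proof -
      have na: "norm a \<le> 17 / 10" "Re a \<le> - 3 / 2" using a[OF aa] rR b by auto
      have "norm (ln (z - a)) \<le> ?X + \<bar>ln (4 :: real)\<bar> + 4"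
      proof (rule norm_ln_le)
        show "Re z - b > 0" using z by simp
        show "Re z - b \<le> norm (z - a)"
          using a(2)[OF aa] complex_Re_le_cmod[of "z - a"] by simp
        show "norm (z - a) \<le> 4" using norm_triangle_ineq4[of z a] na z by linarith
      qed
      moreover have "\<bar>ln (4 :: real)\<bar> \<le> 3" by (rule abs_ln_le) auto
      moreover have "norm (ln (0 - a)) \<le> \<bar>ln (1 :: real)\<bar> + \<bar>ln 2\<bar> + 4"
        using na abs_Re_le_cmod[of a] by (intro norm_ln_le) auto
      moreover have "\<bar>ln (1 :: real)\<bar> = 0" by simp
      moreover have "\<bar>ln (2 :: real)\<bar> \<le> 1" by (rule abs_ln_le) auto
      moreover have "norm (ln (of_real (R\<^sup>2) - cnj a * z)) \<le> \<bar>ln (18 / 100 :: real)\<bar> + \<bar>ln 7\<bar> + 4"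
        using den[OF aa z_r] by (intro norm_ln_le) auto
      moreover have "norm (ln (of_real (R\<^sup>2) - cnj a * 0)) \<le> \<bar>ln (3 :: real)\<bar> + \<bar>ln 4\<bar> + 4"
        using rR by (intro norm_ln_le) (auto simp: norm_power power2_eq_square)
      moreover have "\<bar>ln (18 / 100 :: real)\<bar> \<le> 5" "\<bar>ln (7::real)\<bar> \<le> 6" "\<bar>ln (3::real)\<bar> \<le> 2"
        by (rule abs_ln_le; simp)+
      moreover have "norm (e z a - e 0 a) \<le> norm (ln (z - a)) + norm (ln (0 - a))
          + norm (ln (of_real (R\<^sup>2) - cnj a * z)) + norm (ln (of_real (R\<^sup>2) - cnj a * 0))"
      proof -
        have "e z a - e 0 a = ln (z - a) - ln (0 - a) - ln (of_real (R\<^sup>2) - cnj a * z) + ln (of_real (R\<^sup>2) - cnj a * 0)"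
          by (simp add: e_def)
        then show ?thesis
          by (simp only:) (intro order_trans[OF norm_triangle_ineq] order_trans[OF norm_triangle_ineq4] add_mono order_refl)
      qed
      ultimately show ?thesis by linarith
    qed
    have "norm (lg z - lg 0) \<le> (42 + ?X) * real n + 32 * B"
      unfolding diff E_diff n_def
      by (intro order_trans[OF norm_triangle_ineq] add_mono hz norm_sum_list_le e)
    also have "\<dots> \<le> (42 + ?X) * (18 * B) + 32 * B * (1 + ?X)"
      using nB B1 by (intro add_mono mult_left_mono) (auto simp: algebra_simps)
    also have "\<dots> \<le> 800 * B * (1 + ?X)" using B1 by (simp add: algebra_simps)
    finally show ?thesis .
  qed
  show "Re (deriv lg z) \<ge> - 500 * B"
  proof -
    have "(lg has_field_derivative (\<Sum>a\<leftarrow>as. 1 / (z - a) + cnj a / (of_real (R\<^sup>2) - cnj a * z)) + deriv h z) (at z)"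
    proof (rule has_field_derivative_transform_within_open[OF _ U(3,2)])
      show "((\<lambda>w. E w + (lg 0 - E 0)) has_field_derivative
          (\<Sum>a\<leftarrow>as. 1 / (z - a) + cnj a / (of_real (R\<^sup>2) - cnj a * z)) + deriv h z) (at z)"
        using DERIV_add[OF E_der[OF U(2)] DERIV_const[of "lg 0 - E 0"]] by simp
      show "E w + (lg 0 - E 0) = lg w" if "w \<in> U" for w
        using lE[OF that] by (simp add: algebra_simps)
    qed
    then have d: "deriv lg z = (\<Sum>a\<leftarrow>as. 1 / (z - a) + cnj a / (of_real (R\<^sup>2) - cnj a * z)) + deriv h z"
      by (rule DERIV_imp_deriv)
    have term_ge: "Re (1 / (z - a) + cnj a / (of_real (R\<^sup>2) - cnj a * z)) \<ge> - 10" if aa: "a \<in> set as" for a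
    proof -
      have "Re (1 / (z - a)) \<ge> 0"
        using Re_za[OF U(2) aa] by (simp add: Re_divide)
      moreover have "norm (cnj a / (of_real (R\<^sup>2) - cnj a * z)) \<le> (17 / 10) / (18 / 100)"
        unfolding norm_divide using a[OF aa] den(1)[OF aa z_r] rR by (intro frac_le) auto
      then have "norm (cnj a / (of_real (R\<^sup>2) - cnj a * z)) \<le> 10" by (rule order_trans) simp
      then have "Re (cnj a / (of_real (R\<^sup>2) - cnj a * z)) \<ge> - 10"
        by (rule order_trans[OF le_imp_neg_le Re_ge_minus_norm])
      ultimately show ?thesis by simp
    qed
    have "(\<Sum>a\<leftarrow>as. - 10) \<le> (\<Sum>a\<leftarrow>as. Re (1 / (z - a) + cnj a / (of_real (R\<^sup>2) - cnj a * z)))"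
      by (rule sum_list_mono) (rule term_ge)
    then have s: "Re (\<Sum>a\<leftarrow>as. 1 / (z - a) + cnj a / (of_real (R\<^sup>2) - cnj a * z)) \<ge> - 10 * real n"
      unfolding Re_Im_sum_list by (simp add: sum_list_triv n_def)
    \<comment> \<open>Cauchy's estimate on a disc of radius \<open>1 / 10\<close>, which stays within radius \<open>16 / 10\<close>.\<close>
    have "norm (deriv h z) \<le> (32 * B) / (1 / 10)"
    proof -
      have *: "norm w \<le> 16 / 10" if "w \<in> cball z (1 / 10)" for w
        using that z norm_triangle_sub[of w z] by (simp add: dist_norm norm_minus_commute)
      have "(\<lambda>w. h w - h 0) holomorphic_on ball 0 r" by (intro holomorphic_intros h)
      then have hol: "(\<lambda>w. h w - h 0) holomorphic_on cball z (1 / 10)"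
        by (rule holomorphic_on_subset) (use * rR in fastforce)
      have "norm ((deriv ^^ 1) (\<lambda>w. h w - h 0) z) \<le> fact 1 * (32 * B) / (1 / 10) ^ 1"
        by (rule Cauchy_inequality)
           (use * hol in \<open>auto intro!: h_bound holomorphic_on_imp_continuous_on holomorphic_on_subset[OF hol] simp: dist_norm norm_minus_commute\<close>)
      moreover have "deriv (\<lambda>w. h w - h 0) z = deriv h z"
        using holomorphic_derivI[OF h(1), of z] z rR
        by (intro DERIV_imp_deriv) (auto intro!: derivative_eq_intros)
      ultimately show ?thesis by simp
    qed
    then have "norm (deriv h z) \<le> 320 * B" by simp
    then have "Re (deriv h z) \<ge> - 320 * B" using Re_ge_minus_norm[of "deriv h z"] by linarith
    moreover have "Re (deriv lg z) = Re (\<Sum>a\<leftarrow>as. 1 / (z - a) + cnj a / (of_real (R\<^sup>2) - cnj a * z)) + Re (deriv h z)"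
      unfolding d by (rule plus_complex.sel)
    ultimately show ?thesis using s nB B1 by linarith
  qed
qed

section \<open>The logarithm of \<open>L\<close> in a quadrant\<close>

text \<open>The upper part of the half-plane to the right of the critical line. It is convex and, under GRH, free of
  zeros; the real axis is left out because of possible zeros there.\<close>

definition quadrant :: "complex set" where
  "quadrant = {s. Re s > 1 / 2 \<and> Im s > 0}"

lemma quadrant: "open quadrant" "convex quadrant" "Complex 2 1 \<in> quadrant"
proof -
  have eq: "quadrant = {s. Re s > 1 / 2} \<inter> {s. Im s > 0}" by (auto simp: quadrant_def)
  show "open quadrant" unfolding eq by (intro open_Int open_halfspace_Re_gt open_halfspace_Im_gt)
  show "convex quadrant" unfolding eq by (intro convex_Int convex_halfspace_Re_gt convex_halfspace_Im_gt)
qed (auto simp: quadrant_def)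

locale grh_character =
  fixes q :: nat and chi :: "nat \<Rightarrow> complex"
  assumes character: "dirichlet_character q chi" and non_principal: "chi \<noteq> principal_character q"
    and q_gt_1: "q > 1" and GRH: "GRH chi"

sublocale grh_character \<subseteq> completely_multiplicative chi
  using completely_multiplicative_character[OF character] q_gt_1 by auto

context grh_character
begin

abbreviation L :: "complex \<Rightarrow> complex" where "L \<equiv> dirichlet_L chi"

lemma L_holomorphic: "L holomorphic_on {s. Re s > 0}"
  using dirichlet_L_holomorphic[OF character non_principal q_gt_1] .

lemma L_nonzero_quadrant:
  assumes "s \<in> quadrant"
  shows "L s \<noteq> 0"
proof -
  have s: "Re s > 1 / 2" "Im s > 0" using assms by (auto simp: quadrant_def)
  consider "Re s < 1" | "Re s = 1" | "Re s > 1" by linarith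
  then show ?thesis
  proof cases
    case 1
    then show ?thesis using GRH s unfolding GRH_def by force
  next
    case 2
    then have "s = Complex 1 (Im s)" by (simp add: complex_eq_iff)
    then show ?thesis
      using dirichlet_L_nonzero_line_1[OF character non_principal q_gt_1, of "Im s"] s(2)
      by (metis less_irrefl)
  next
    case 3
    then show ?thesis by (rule dirichlet_L_nonzero)
  qed
qed

text \<open>The additive constant in a logarithm on the quadrant is fixed by comparison with the Euler product.\<close>

lemma log_L_exists:
  "\<exists>l. l holomorphic_on quadrant \<and> (\<forall>s\<in>quadrant. exp (l s) = L s) \<and>
       (\<forall>s\<in>quadrant. Re s > 1 \<longrightarrow> l s = log_series s)"
proof -
  have hol: "L holomorphic_on quadrant"
    by (rule holomorphic_on_subset[OF L_holomorphic]) (auto simp: quadrant_def)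
  obtain g where g: "g holomorphic_on quadrant" "\<And>s. s \<in> quadrant \<Longrightarrow> exp (g s) = L s"
    using holomorphic_logarithm_exists[OF quadrant(2,1) hol L_nonzero_quadrant quadrant(3)] by blast
  define c where "c = g (Complex 2 1) - log_series (Complex 2 1)"
  let ?H = "{s. Re s > 1} \<inter> quadrant"
  have "connected ?H"
    by (intro convex_connected convex_Int convex_halfspace_Re_gt quadrant)
  moreover have "continuous_on ?H g"
    using g(1) holomorphic_on_imp_continuous_on continuous_on_subset by blast
  moreover have "continuous_on ?H log_series"
    by (rule continuous_on_subset[OF log_series_continuous]) auto
  ultimately have eq: "g s - log_series s = c" if "s \<in> ?H" for s
    unfolding c_def by (rule eq_if_exp_eq_on_connected) (use that g(2) exp_log_series quadrant(3) in auto)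
  have "exp (g (Complex 2 1)) = exp (log_series (Complex 2 1))"
    using g(2)[OF quadrant(3)] exp_log_series[of "Complex 2 1"] by simp
  then have c: "exp c = 1" by (simp add: c_def exp_diff)
  show ?thesis
  proof (intro exI[of _ "\<lambda>s. g s - c"] conjI ballI impI)
    show "(\<lambda>s. g s - c) holomorphic_on quadrant" by (intro holomorphic_intros g)
    show "exp (g s - c) = L s" if "s \<in> quadrant" for s using g(2)[OF that] c by (simp add: exp_diff)
    show "g s - c = log_series s" if "s \<in> quadrant" "Re s > 1" for s
      using eq[of s] that by (simp add: algebra_simps)
  qed
qed

definition log_L :: "complex \<Rightarrow> complex" where
  "log_L = (SOME l. l holomorphic_on quadrant \<and> (\<forall>s\<in>quadrant. exp (l s) = L s) \<and>
       (\<forall>s\<in>quadrant. Re s > 1 \<longrightarrow> l s = log_series s))"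

lemma log_L_holomorphic: "log_L holomorphic_on quadrant"
  and exp_log_L: "s \<in> quadrant \<Longrightarrow> exp (log_L s) = L s"
  and log_L_eq_series: "s \<in> quadrant \<Longrightarrow> Re s > 1 \<Longrightarrow> log_L s = log_series s"
  using someI_ex[OF log_L_exists] unfolding log_L_def by auto

text \<open>The series starts at the prime \<open>2\<close>, whence the exponential decay to the right.\<close>

lemma norm_log_series_le:
  assumes "Re s \<ge> 2"
  shows "norm (log_series s) \<le> 4 * (\<Sum>n. real n powr (- 2)) * 2 powr (2 - Re s)"
proof -
  have "sum (log_factor s) {..<2} = 0"
    by (intro sum.neutral) (auto simp: log_factor_def less_2_cases_iff)
  then show ?thesis using norm_log_series_tail_le[OF assms, of 2] by simp
qed

text \<open>Partial summation: the character sums are bounded by \<open>q\<close>.\<close>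

lemma norm_L_le:
  obtains C where "C \<ge> 1" "\<And>s. Re s \<ge> 1 / 5 \<Longrightarrow> norm (L s) \<le> C * norm s"
proof -
  let ?S = "\<Sum>n. real (Suc n) powr (- (1 / 5) - 1)"
  have "summable (\<lambda>n. real n powr (- (1 / 5) - 1))" by (simp add: summable_real_powr_iff)
  then have sm: "summable (\<lambda>n. real (Suc n) powr (- (1 / 5) - 1))"
    by (subst summable_Suc_iff)
  have le: "norm (L s) \<le> real q * ?S * norm s" if s: "Re s \<ge> 1 / 5" for s
  proof -
    define u where "u = (\<lambda>n. (\<Sum>k<Suc n. chi (Suc k)) *
                  (of_nat (Suc n) powr (-s) - of_nat (Suc (Suc n)) powr (-s)))"
    have s0: "Re s > 0" using s by linarith
    note aux = dirichlet_L_aux[OF character non_principal q_gt_1 s0, folded u_def]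
    have le_u: "norm (u n) \<le> real q * norm s * real (Suc n) powr (- (1 / 5) - 1)" for n
    proof -
      have "norm (u n) \<le> real q * (norm s * real (Suc n) powr (- Re s - 1))" unfolding u_def by (rule aux(1)[unfolded u_def])
      also have "\<dots> \<le> real q * (norm s * real (Suc n) powr (- (1 / 5) - 1))"
        using s by (intro mult_left_mono powr_mono) auto
      finally show ?thesis by (simp add: mult_ac)
    qed
    have "norm (\<Sum>n. u n) \<le> (\<Sum>n. real q * norm s * real (Suc n) powr (- (1 / 5) - 1))"
      by (rule norm_suminf_le[OF le_u summable_mult[OF sm]])
    also have "\<dots> = real q * norm s * ?S" by (rule suminf_mult[OF sm])
    also have "(\<Sum>n. u n) = L s"
      unfolding dirichlet_L_def using aux(2) by (simp add: u_def sums_iff)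
    finally show ?thesis by (simp only: mult_ac)
  qed
  show ?thesis
  proof (rule that[of "max 1 (real q * ?S)"])
    show "norm (L s) \<le> max 1 (real q * ?S) * norm s" if "Re s \<ge> 1 / 5" for s
      by (rule order_trans[OF le[OF that]], rule mult_right_mono) auto
  qed auto
qed

text \<open>The only input about \<open>L\<close> beyond the location of its zeros is polynomial growth; since
  the zeros to the right of \<open>Re s = 1 / 5\<close> and above the real axis have real part at most
  \<open>1 / 2\<close>, the local structure lemma applies to discs about \<open>2 + \<i>t\<close>.\<close>

theorem log_L_bounds:
  obtains A where "A \<ge> 1"
    and "\<And>\<sigma> t. 1 / 2 < \<sigma> \<Longrightarrow> \<sigma> \<le> 2 \<Longrightarrow> 3 \<le> t \<Longrightarrow> \<bar>Im (log_L (Complex \<sigma> t))\<bar> \<le> A * ln t"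
    and "\<And>\<sigma> t. 1 / 2 < \<sigma> \<Longrightarrow> \<sigma> \<le> 2 \<Longrightarrow> 3 \<le> t \<Longrightarrow>
           norm (log_L (Complex \<sigma> t)) \<le> A * ln t * (1 + \<bar>ln (\<sigma> - 1 / 2)\<bar>)"
    and "\<And>\<sigma> t. 1 / 2 < \<sigma> \<Longrightarrow> \<sigma> \<le> 2 \<Longrightarrow> 3 \<le> t \<Longrightarrow> Re (deriv log_L (Complex \<sigma> t)) \<ge> - A * ln t"
proof -
  obtain C where C: "C \<ge> 1" "\<And>s. Re s \<ge> 1 / 5 \<Longrightarrow> norm (L s) \<le> C * norm s"
    using norm_L_le by blast
  define Z where "Z = 4 * (\<Sum>n. real n powr (- 2))"
  have Z: "Z \<ge> 0"
    unfolding Z_def by (intro mult_nonneg_nonneg suminf_nonneg) (auto simp: summable_real_powr_iff)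
  define A1 where "A1 = ln C + Z + 4"
  have A1: "A1 \<ge> 4" using C Z by (simp add: A1_def)
  define A where "A = 800 * A1 + Z"
  have bounds: "\<bar>Im (log_L (Complex \<sigma> t))\<bar> \<le> A * ln t \<and>
      norm (log_L (Complex \<sigma> t)) \<le> A * ln t * (1 + \<bar>ln (\<sigma> - 1 / 2)\<bar>) \<and>
      Re (deriv log_L (Complex \<sigma> t)) \<ge> - A * ln t"
    if \<sigma>: "1 / 2 < \<sigma>" "\<sigma> \<le> 2" and t: "3 \<le> t" for \<sigma> t
  proof -
    define c where "c = Complex 2 t"
    define f where "f = (\<lambda>z. L (z + c))"
    define lg where "lg = (\<lambda>z. log_L (z + c))"
    define M where "M = C * (t + 4)"
    define z where "z = complex_of_real (\<sigma> - 2)"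
    have lnt: "ln t \<ge> 1"
    proof -
      have "exp 1 \<le> t" using exp_le t by linarith
      then show ?thesis using t by (subst ln_ge_iff) auto
    qed
    have zc: "z + c = Complex \<sigma> t" "0 + c = Complex 2 t" by (auto simp: z_def c_def complex_eq_iff)
    have c_quad: "Complex 2 t \<in> quadrant" "Complex \<sigma> t \<in> quadrant" using t \<sigma> by (auto simp: quadrant_def)
    define S where "S = {z. Re (z + c) > 0}"
    have S_eq: "S = {z. Re z > - 2}" by (auto simp: S_def c_def)
    have S: "open S" "cball 0 (18/10) \<subseteq> S"
    proof -
      show "open S" unfolding S_eq by (rule open_halfspace_Re_gt)
      show "cball 0 (18/10) \<subseteq> S"
      proof
        fix z :: complex assume "z \<in> cball 0 (18/10)"
        then have "\<bar>Re z\<bar> \<le> 18/10" using abs_Re_le_cmod[of z] by simp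
        then show "z \<in> S" by (simp add: S_eq)
      qed
    qed
    have f: "f holomorphic_on S"
    proof -
      have "(L \<circ> (\<lambda>z. z + c)) holomorphic_on S"
        by (rule holomorphic_on_compose_gen[OF _ L_holomorphic]) (auto simp: S_def intro!: holomorphic_intros)
      then show ?thesis by (simp add: f_def o_def)
    qed
    have fM: "norm (f z) \<le> M" if z: "norm z \<le> 18/10" for z
    proof -
      have "\<bar>Re z\<bar> \<le> 18/10" using abs_Re_le_cmod[of z] z by linarith
      then have "norm (f z) \<le> C * norm (z + c)" unfolding f_def by (intro C) (auto simp: c_def)
      also have "norm (z + c) \<le> t + 4"
        using norm_triangle_ineq[of z c] cmod_le[of c] z t by (simp add: c_def)
      finally show ?thesis using C by (simp add: M_def mult_left_mono)
    qed
    have log_c: "norm (log_L (Complex 2 t)) \<le> Z"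
      using norm_log_series_le[of "Complex 2 t"] log_L_eq_series[OF c_quad(1)] by (simp add: Z_def)
    have f0: "norm (f 0) \<ge> exp (- Z)"
    proof -
      have "norm (f 0) = exp (Re (log_L (Complex 2 t)))"
        using exp_log_L[OF c_quad(1)] by (simp add: f_def c_def flip: norm_exp_eq_Re)
      moreover have "Re (log_L (Complex 2 t)) \<ge> - Z"
        using log_c Re_ge_minus_norm[of "log_L (Complex 2 t)"] by linarith
      ultimately show ?thesis by simp
    qed
    then have f0': "f 0 \<noteq> 0" by (metis exp_gt_zero norm_zero not_less)
    have zeros: "Re z \<le> - 3 / 2" if "norm z \<le> 17/10" "f z = 0" for z
    proof (rule ccontr)
      assume "\<not> Re z \<le> - 3 / 2"
      moreover have "\<bar>Im z\<bar> \<le> 17/10" using abs_Im_le_cmod[of z] that by linarith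
      ultimately have "z + c \<in> quadrant" using t by (auto simp: quadrant_def c_def)
      then show False using L_nonzero_quadrant that(2) by (auto simp: f_def)
    qed
    let ?U = "{z. norm z < 17/10 \<and> Re z > - 3 / 2}"
    have U: "z + c \<in> quadrant" if "z \<in> ?U" for z
    proof -
      have "\<bar>Im z\<bar> \<le> 17/10" using abs_Im_le_cmod[of z] that by simp
      then show ?thesis using that t by (auto simp: quadrant_def c_def)
    qed
    have lg: "lg holomorphic_on ?U"
    proof -
      have "(log_L \<circ> (\<lambda>z. z + c)) holomorphic_on ?U"
        by (rule holomorphic_on_compose_gen[OF _ log_L_holomorphic]) (use U in \<open>auto intro!: holomorphic_intros\<close>)
      then show ?thesis by (simp add: lg_def o_def)
    qed
    have lg_exp: "exp (lg z) = f z" if "z \<in> ?U" for z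
      using exp_log_L[OF U[OF that]] by (simp add: lg_def f_def)
    have z: "norm z \<le> 3 / 2" "Re z > - 3 / 2" using \<sigma> by (auto simp: z_def simp del: of_real_diff)
    define B where "B = ln (M / norm (f 0)) + 1"
    have B: "B \<le> A1 * ln t"
    proof -
      have M0: "M > 0" using C t by (simp add: M_def)
      have "ln (M / norm (f 0)) \<le> ln (M / exp (- Z))"
        using M0 f0 f0' by (subst ln_le_cancel_iff) (auto intro!: divide_left_mono)
      also have "\<dots> = ln C + ln (t + 4) + Z"
        using C t M0 by (simp add: ln_div) (simp add: M_def ln_mult)
      also have "ln (t + 4) \<le> 3 * ln t"
      proof -
        have "t + 4 \<le> 3 * t" using t by linarith
        also have "3 * t \<le> t * t" using t by (intro mult_right_mono) auto
        also have "\<dots> \<le> t * t * t" using t mult_left_mono[of 1 t "t * t"] by simp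
        finally have "ln (t + 4) \<le> ln (t ^ 3)" using t by (subst ln_le_cancel_iff) (auto simp: power3_eq_cube)
        then show ?thesis using t by (simp add: ln_realpow)
      qed
      finally have *: "ln (M / norm (f 0)) \<le> ln C + 3 * ln t + Z" by simp
      have "x + 1 \<le> (a + z) * 1 + 4 * l" if "x \<le> a + 3 * l + z" "1 \<le> l" for x a z l :: real
        using that by simp
      from this[OF * lnt] have "B \<le> (ln C + Z) * 1 + 4 * ln t" unfolding B_def .
      also have "\<dots> \<le> (ln C + Z) * ln t + 4 * ln t"
        using lnt C Z by (intro add_mono mult_left_mono) auto
      finally show ?thesis by (simp add: A1_def algebra_simps)
    qed
    note loc = local_log_bounds[OF S f fM f0' refl zeros lg lg_exp z, folded B_def]
    have lg0: "lg 0 = log_L (Complex 2 t)" and lgz: "lg z = log_L (Complex \<sigma> t)"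
      by (simp_all only: lg_def zc)
    have nB: "800 * B \<le> 800 * A1 * ln t" using B by simp
    have "\<bar>Im (log_L (Complex \<sigma> t))\<bar> \<le> A * ln t"
    proof -
      have "\<bar>Im (lg z) - Im (lg 0)\<bar> \<le> 200 * B" by (rule loc(1))
      moreover have "\<bar>Im (lg 0)\<bar> \<le> Z" using log_c abs_Im_le_cmod[of "lg 0"] unfolding lg0 by linarith
      moreover have "Z * 1 \<le> Z * ln t" using lnt Z by (intro mult_left_mono)
      moreover have "200 * (A1 * ln t) \<le> 800 * (A1 * ln t)" using A1 lnt by (intro mult_right_mono) auto
      ultimately have "\<bar>Im (lg z)\<bar> \<le> 800 * (A1 * ln t) + Z * ln t" using B by linarith
      then show ?thesis by (simp add: lgz A_def algebra_simps)
    qed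
    moreover have "norm (log_L (Complex \<sigma> t)) \<le> A * ln t * (1 + \<bar>ln (\<sigma> - 1 / 2)\<bar>)"
    proof -
      let ?Y = "1 + \<bar>ln (\<sigma> - 1 / 2)\<bar>"
      have "norm (lg z - lg 0) \<le> 800 * B * (1 + \<bar>ln (Re z - (- 3 / 2))\<bar>)" by (rule loc(2))
      also have "Re z - (- 3 / 2) = \<sigma> - 1 / 2" by (simp add: z_def)
      finally have "norm (lg z - lg 0) \<le> 800 * B * ?Y" .
      also have "\<dots> \<le> 800 * A1 * ln t * ?Y" by (intro mult_right_mono nB) auto
      finally have 1: "norm (lg z - lg 0) \<le> 800 * A1 * ln t * ?Y" .
      have "Z * (1 * 1) \<le> Z * (ln t * ?Y)" using lnt Z by (intro mult_left_mono mult_mono) auto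
      then have 2: "norm (lg 0) \<le> Z * (ln t * ?Y)" using log_c unfolding lg0 by simp
      have "norm (lg z) \<le> norm (lg z - lg 0) + norm (lg 0)"
        by (metis diff_add_cancel norm_triangle_ineq)
      also have "\<dots> \<le> 800 * A1 * ln t * ?Y + Z * (ln t * ?Y)" by (rule add_mono[OF 1 2])
      also have "\<dots> = A * ln t * ?Y" unfolding A_def by (simp only: algebra_simps)
      finally show ?thesis by (simp only: lgz)
    qed
    moreover have "Re (deriv log_L (Complex \<sigma> t)) \<ge> - A * ln t"
    proof -
      have "(log_L has_field_derivative deriv log_L (Complex \<sigma> t)) (at (z + c))"
        unfolding zc by (rule holomorphic_derivI[OF log_L_holomorphic quadrant(1) c_quad(2)])
      then have "(lg has_field_derivative deriv log_L (Complex \<sigma> t)) (at z)"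
        unfolding lg_def by (simp add: DERIV_shift)
      then have "deriv lg z = deriv log_L (Complex \<sigma> t)" by (rule DERIV_imp_deriv)
      moreover have "Re (deriv lg z) \<ge> - 500 * B" by (rule loc(3))
      ultimately have "Re (deriv log_L (Complex \<sigma> t)) \<ge> - 500 * B" by (simp only:)
      moreover have "500 * (A1 * ln t) \<le> 800 * (A1 * ln t)" using A1 lnt by (intro mult_right_mono) auto
      moreover have "Z * ln t \<ge> 0" using Z lnt by simp
      ultimately have "Re (deriv log_L (Complex \<sigma> t)) \<ge> - (800 * (A1 * ln t) + Z * ln t)" using B by linarith
      then show ?thesis by (simp add: A_def algebra_simps)
    qed
    ultimately show ?thesis by blast
  qed
  show ?thesis
  proof (rule that[of A])
    show "A \<ge> 1" using A1 Z by (simp add: A_def)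
  qed (use bounds in blast)+
qed

text \<open>Near a point of the critical line where \<open>L\<close> does not vanish, the zero-free region extends a
  little to the left. On a thin horizontal strip around the ray there is a logarithm that
  agrees with \<open>log_L\<close> in the quadrant, and uniqueness of the branch along the ray
  identifies its value at the end point.\<close>

lemma Im_log_L_tendsto:
  assumes t: "t > 0" and nz: "L (Complex (1 / 2) t) \<noteq> 0"
  shows "((\<lambda>\<sigma>. Im (log_L (Complex \<sigma> t))) \<longlongrightarrow> Im (log_dirichlet_L chi (Complex (1 / 2) t))) (at_right (1 / 2))"
proof -
  define z0 where "z0 = Complex (1 / 2) t"
  have "isCont L z0"
    using holomorphic_on_imp_continuous_on[OF L_holomorphic] open_halfspace_Re_gt[of 0]
    by (auto simp: continuous_on_eq_continuous_at z0_def)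
  then obtain e where e: "e > 0" "\<And>y. dist z0 y < e \<Longrightarrow> L y \<noteq> 0"
    using continuous_at_avoid[of z0 L 0] nz by (auto simp: z0_def)
  define \<epsilon> where "\<epsilon> = min (e / 2) (1 / 4)"
  define \<delta> where "\<delta> = min (e / 2) t"
  have ed: "\<epsilon> > 0" "\<epsilon> \<le> e / 2" "\<epsilon> \<le> 1 / 4" "\<delta> > 0" "\<delta> \<le> e / 2" "\<delta> \<le> t"
    using e t by (auto simp: \<epsilon>_def \<delta>_def)
  define S where "S = {z. Re z > 1 / 2 - \<epsilon>} \<inter> {z. Im z > t - \<delta>} \<inter> {z. Im z < t + \<delta>}"
  have S: "open S" "convex S" unfolding S_def
    by (intro open_Int open_halfspace_Re_gt open_halfspace_Im_gt open_halfspace_Im_lt convex_Int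
        convex_halfspace_Re_gt convex_halfspace_Im_gt convex_halfspace_Im_lt)+
  have S_nz: "L z \<noteq> 0" if "z \<in> S" for z
  proof (cases "Re z > 1 / 2")
    case True
    then show ?thesis using that ed by (intro L_nonzero_quadrant) (auto simp: quadrant_def S_def)
  next
    case False
    have "norm (z0 - z) \<le> \<bar>Re (z0 - z)\<bar> + \<bar>Im (z0 - z)\<bar>" by (rule cmod_le)
    also have "\<dots> < e" using that False ed by (auto simp: S_def z0_def)
    finally show ?thesis using e(2)[of z] by (simp add: dist_norm)
  qed
  have hol: "L holomorphic_on S"
    by (rule holomorphic_on_subset[OF L_holomorphic]) (use ed in \<open>auto simp: S_def\<close>)
  have z0S: "z0 \<in> S" using ed by (auto simp: S_def z0_def)
  obtain g where g: "g holomorphic_on S" "\<And>z. z \<in> S \<Longrightarrow> exp (g z) = L z"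
    using holomorphic_logarithm_exists[OF S(2,1) hol S_nz z0S] by blast
  define w where "w = Complex 2 t"
  have w: "w \<in> S \<inter> quadrant" using ed t by (auto simp: w_def S_def quadrant_def)
  define h where "h = (\<lambda>z. g z - (g w - log_L w))"
  have eq: "h z = log_L z" if "z \<in> S \<inter> quadrant" for z
  proof -
    have "g z - log_L z = g w - log_L w"
    proof (rule eq_if_exp_eq_on_connected[OF _ _ _ _ w that])
      show "connected (S \<inter> quadrant)" by (intro convex_connected convex_Int S quadrant)
      show "continuous_on (S \<inter> quadrant) g" "continuous_on (S \<inter> quadrant) log_L"
        by (rule holomorphic_on_imp_continuous_on, rule holomorphic_on_subset[OF g(1)] holomorphic_on_subset[OF log_L_holomorphic], blast)+
      show "exp (g z) = exp (log_L z)" if "z \<in> S \<inter> quadrant" for z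
        using g(2) exp_log_L that by simp
    qed
    then show ?thesis by (simp add: h_def algebra_simps)
  qed
  have "exp (g w) = exp (log_L w)" using g(2) exp_log_L w by simp
  then have h_exp: "exp (h z) = L z" if "z \<in> S" for z
    using g(2)[OF that] by (simp add: h_def exp_diff)
  have h_hol: "h holomorphic_on S" unfolding h_def by (intro holomorphic_intros g)
  have ray: "right_ray z0 \<subseteq> S" using ed by (auto simp: right_ray_def S_def z0_def)
  have branch: "is_log_L_branch chi z0 h"
    unfolding is_log_L_branch_def
  proof (intro conjI ballI)
    have "h analytic_on S" using h_hol S(1) by (simp add: analytic_on_open)
    then show "h analytic_on right_ray z0" using ray analytic_on_subset by blast
    show "exp (h z) = L z" if "z \<in> right_ray z0" for z using h_exp ray that by blast
    show "((\<lambda>\<sigma>. h (Complex \<sigma> (Im z0))) \<longlongrightarrow> 0) at_top"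
    proof (rule Lim_null_comparison)
      let ?C = "4 * (\<Sum>n. real n powr (- 2))"
      have le: "norm (h (Complex \<sigma> (Im z0))) \<le> ?C * 2 powr (2 - \<sigma>)" if "\<sigma> \<ge> 2" for \<sigma>
      proof -
        have "Complex \<sigma> t \<in> S \<inter> quadrant" using that ed t by (auto simp: S_def quadrant_def)
        then have "h (Complex \<sigma> (Im z0)) = log_series (Complex \<sigma> t)"
          using eq log_L_eq_series that by (simp add: z0_def)
        then show ?thesis using norm_log_series_le[of "Complex \<sigma> t"] that by simp
      qed
      show "\<forall>\<^sub>F \<sigma> in at_top. norm (h (Complex \<sigma> (Im z0))) \<le> ?C * 2 powr (2 - \<sigma>)"
        using eventually_ge_at_top[of 2] by eventually_elim (rule le)
      have "((\<lambda>\<sigma>::real. 2 powr (2 - \<sigma>)) \<longlongrightarrow> 0) at_top" by real_asymp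
      from tendsto_mult_left[OF this, of ?C]
      show "((\<lambda>\<sigma>. ?C * 2 powr (2 - \<sigma>)) \<longlongrightarrow> 0) at_top" by simp
    qed
  qed
  have "isCont h z0" using h_hol S(1) z0S
    by (meson continuous_on_eq_continuous_at holomorphic_on_imp_continuous_on)
  moreover have "((\<lambda>\<sigma>. Complex \<sigma> t) \<longlongrightarrow> z0) (at_right (1 / 2))"
    unfolding z0_def by (intro tendsto_Complex tendsto_const tendsto_ident_at)
  ultimately have "((\<lambda>\<sigma>. h (Complex \<sigma> t)) \<longlongrightarrow> h z0) (at_right (1 / 2))"
    by (rule isCont_tendsto_compose)
  moreover have "\<forall>\<^sub>F \<sigma> in at_right (1 / 2). h (Complex \<sigma> t) = log_L (Complex \<sigma> t)"
    unfolding eventually_at_right_field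
    using ed t by (intro exI[of _ 1]) (auto intro!: eq simp: S_def quadrant_def)
  ultimately have "((\<lambda>\<sigma>. log_L (Complex \<sigma> t)) \<longlongrightarrow> h z0) (at_right (1 / 2))"
    by (rule Lim_transform_eventually)
  then show ?thesis
    using log_dirichlet_L_eqI[OF branch] by (auto simp: z0_def intro!: tendsto_intros)
qed

end

section \<open>A band-limited majorant of the unit step\<close>

text \<open>The cardinal sine, entire and of exponential type \<open>1\<close>; its powers are the building blocks.\<close>

definition csinc :: "complex \<Rightarrow> complex" where
  "csinc z = (if z = 0 then 1 else sin z / z)"

lemma csinc_holomorphic: "csinc holomorphic_on UNIV"
proof -
  have "(\<lambda>z. if z = 0 then deriv sin 0 else (sin z - sin 0) / (z - 0 :: complex)) holomorphic_on UNIV"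
    by (rule pole_lemma_open) (auto intro!: holomorphic_intros)
  moreover have "deriv sin (0 :: complex) = 1"
    by (rule DERIV_imp_deriv) (auto intro!: derivative_eq_intros)
  then have "(\<lambda>z. if z = 0 then deriv sin 0 else (sin z - sin 0) / (z - 0 :: complex)) = csinc"
    by (auto simp: fun_eq_iff csinc_def)
  ultimately show ?thesis by (simp only:)
qed

lemma norm_sin_le_exp: "norm (sin z :: complex) \<le> exp \<bar>Im z\<bar>"
proof -
  have "norm (sin z) = norm (exp (\<i> * z) - exp (- (\<i> * z))) / 2"
    by (simp add: sin_exp_eq norm_divide norm_mult)
  also have "\<dots> \<le> (norm (exp (\<i> * z)) + norm (exp (- (\<i> * z)))) / 2"
    by (intro divide_right_mono norm_triangle_ineq4) auto
  also have "\<dots> \<le> (exp \<bar>Im z\<bar> + exp \<bar>Im z\<bar>) / 2"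
    by (intro divide_right_mono add_mono) (auto simp: norm_exp_eq_Re)
  finally show ?thesis by simp
qed

text \<open>Near \<open>0\<close> the maximum principle replaces the division by \<open>z\<close>.\<close>

lemma norm_csinc_le: "norm (csinc z) \<le> 6 * exp \<bar>Im z\<bar> / (1 + norm z)"
proof (cases "norm z \<ge> 1")
  case True
  then have "norm (csinc z) = norm (sin z) / norm z" by (auto simp: csinc_def norm_divide)
  also have "\<dots> \<le> exp \<bar>Im z\<bar> / norm z" by (intro divide_right_mono norm_sin_le_exp) auto
  also have "\<dots> \<le> 6 * exp \<bar>Im z\<bar> / (1 + norm z)"
  proof -
    have "1 + norm z \<le> 6 * norm z" using True by simp
    then have "(1 + norm z) / 6 \<le> norm z" by simp
    then have "exp \<bar>Im z\<bar> / norm z \<le> exp \<bar>Im z\<bar> / ((1 + norm z) / 6)"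
      using True by (intro divide_left_mono mult_pos_pos) auto
    then show ?thesis by (simp add: mult.commute)
  qed
  finally show ?thesis .
next
  case False
  have "norm (csinc z) \<le> 3"
  proof (rule maximum_modulus_frontier[of csinc "cball 0 1"])
    fix w :: complex assume "w \<in> frontier (cball 0 1)"
    then have w: "norm w = 1" by (simp add: frontier_cball)
    then have "w \<noteq> 0" by auto
    then have "norm (csinc w) = norm (sin w)" using w by (simp add: csinc_def norm_divide)
    also have "\<dots> \<le> exp \<bar>Im w\<bar>" by (rule norm_sin_le_exp)
    also have "\<dots> \<le> exp 1" using abs_Im_le_cmod[of w] w by simp
    also have "\<dots> \<le> 3" using exp_le by simp
    finally show "norm (csinc w) \<le> 3" .
  qed (use False in \<open>auto intro!: holomorphic_on_subset[OF csinc_holomorphic] holomorphic_on_imp_continuous_on\<close>)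
  also have "3 \<le> 6 * 1 / (1 + norm z)" using False by (simp add: field_simps add_pos_nonneg)
  also have "\<dots> \<le> 6 * exp \<bar>Im z\<bar> / (1 + norm z)" by (intro divide_right_mono mult_left_mono) auto
  finally show ?thesis .
qed

lemma has_real_derivative_Re:
  assumes "(f has_field_derivative D) (at (of_real x))"
  shows "((\<lambda>x. Re (f (of_real x))) has_real_derivative Re D) (at x)"
    and "((\<lambda>x. Im (f (of_real x))) has_real_derivative Im D) (at x)"
  using has_vector_derivative_real_field[OF assms, of UNIV]
  by (auto simp: has_real_derivative_iff_has_vector_derivative
      intro!: derivative_eq_intros bounded_linear.has_vector_derivative[OF bounded_linear_Re]
        bounded_linear.has_vector_derivative[OF bounded_linear_Im])

text \<open>Positive on the real line and exactly of order \<open>1 / x\<^sup>2\<close> towards \<open>+\<infinity>\<close>: shifting the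
  sine by \<open>\<pi> / 2\<close> gives the cosine, so the numerators add up to a constant.\<close>

definition bump :: "complex \<Rightarrow> complex" where
  "bump z = csinc z ^ 2 + csinc (z + of_real (pi / 2)) ^ 2"

lemma bump_holomorphic: "bump holomorphic_on UNIV"
proof -
  have "(csinc \<circ> (\<lambda>z. z + of_real (pi / 2))) holomorphic_on UNIV"
    by (rule holomorphic_on_compose) (auto intro!: holomorphic_intros holomorphic_on_subset[OF csinc_holomorphic])
  then show ?thesis
    unfolding bump_def[abs_def] o_def by (intro holomorphic_intros csinc_holomorphic)
qed

lemma norm_csinc_power_le: "norm (csinc z ^ n) \<le> 6 ^ n * exp (n * \<bar>Im z\<bar>) / (1 + norm z) ^ n"
proof -
  have "norm (csinc z ^ n) \<le> (6 * exp \<bar>Im z\<bar> / (1 + norm z)) ^ n"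
    unfolding norm_power by (intro power_mono norm_csinc_le) auto
  also have "\<dots> = 6 ^ n * exp (n * \<bar>Im z\<bar>) / (1 + norm z) ^ n"
    by (simp add: power_divide power_mult_distrib exp_of_nat_mult)
  finally show ?thesis .
qed

lemma norm_bump_le: "norm (bump z) \<le> 360 * exp (2 * \<bar>Im z\<bar>) / (1 + norm z)\<^sup>2"
proof -
  define w where "w = z + of_real (pi / 2)"
  have Im: "Im w = Im z" by (simp add: w_def)
  have "norm z \<le> norm w + norm (complex_of_real (pi / 2))"
    using norm_triangle_ineq4[of w "of_real (pi / 2)"] by (simp add: w_def)
  also have "norm (complex_of_real (pi / 2)) \<le> 2"
    unfolding norm_of_real using pi_less_4 by simp
  finally have "1 + norm z \<le> 3 * (1 + norm w)" by (smt (verit) norm_ge_zero)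
  then have "(1 + norm z)\<^sup>2 \<le> (3 * (1 + norm w))\<^sup>2" by (intro power_mono) auto
  then have le: "(1 + norm z)\<^sup>2 \<le> 9 * (1 + norm w)\<^sup>2" by (simp only: power_mult_distrib) simp
  have pos: "(1 + norm z)\<^sup>2 > 0" "(1 + norm w)\<^sup>2 > 0" by (rule zero_less_power; rule add_pos_nonneg; simp)+
  have "norm (csinc w ^ 2) \<le> 36 * exp (2 * \<bar>Im z\<bar>) / (1 + norm w)\<^sup>2"
    using norm_csinc_power_le[of w 2] Im by simp
  also have "\<dots> \<le> 9 * (36 * exp (2 * \<bar>Im z\<bar>)) / (1 + norm z)\<^sup>2"
    using mult_left_mono[OF le, of "36 * exp (2 * \<bar>Im z\<bar>)"] pos
    by (subst frac_le_eq[OF less_imp_neq[OF pos(2), symmetric] less_imp_neq[OF pos(1), symmetric]])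
       (auto intro!: divide_nonpos_pos mult_pos_pos simp: mult_ac)
  finally have 1: "norm (csinc w ^ 2) \<le> 324 * exp (2 * \<bar>Im z\<bar>) / (1 + norm z)\<^sup>2" by simp
  have 2: "norm (csinc z ^ 2) \<le> 36 * exp (2 * \<bar>Im z\<bar>) / (1 + norm z)\<^sup>2"
    using norm_csinc_power_le[of z 2] by simp
  have "norm (bump z) \<le> norm (csinc z ^ 2) + norm (csinc w ^ 2)"
    unfolding bump_def w_def by (rule norm_triangle_ineq)
  also have "\<dots> \<le> 36 * exp (2 * \<bar>Im z\<bar>) / (1 + norm z)\<^sup>2 + 324 * exp (2 * \<bar>Im z\<bar>) / (1 + norm z)\<^sup>2"
    by (intro add_mono 1 2)
  also have "\<dots> = 360 * exp (2 * \<bar>Im z\<bar>) / (1 + norm z)\<^sup>2" by (simp add: add_divide_distrib[symmetric])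
  finally show ?thesis .
qed

text \<open>Cauchy's estimate on the unit circle about \<open>z\<close>.\<close>

lemma norm_deriv_bump_le: "norm (deriv bump z) \<le> 1440 * exp 2 * exp (2 * \<bar>Im z\<bar>) / (1 + norm z)\<^sup>2"
proof -
  have bound: "norm (bump w) \<le> 1440 * exp 2 * exp (2 * \<bar>Im z\<bar>) / (1 + norm z)\<^sup>2" if w: "norm (z - w) = 1" for w
  proof -
    have "1 + norm z \<le> 2 * (1 + norm w)" using norm_triangle_sub[of z w] w by (smt (verit) norm_ge_zero)
    then have "(1 + norm z)\<^sup>2 \<le> (2 * (1 + norm w))\<^sup>2" by (intro power_mono) auto
    then have le: "(1 + norm z)\<^sup>2 \<le> 4 * (1 + norm w)\<^sup>2" by (simp only: power_mult_distrib) simp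
    have pos: "(1 + norm z)\<^sup>2 > 0" "(1 + norm w)\<^sup>2 > 0" by (rule zero_less_power; rule add_pos_nonneg; simp)+
    have "\<bar>Im (z - w)\<bar> \<le> 1" using abs_Im_le_cmod[of "z - w"] w by simp
    then have "\<bar>Im w\<bar> \<le> \<bar>Im z\<bar> + 1" by simp
    then have ex: "exp (2 * \<bar>Im w\<bar>) \<le> exp 2 * exp (2 * \<bar>Im z\<bar>)" by (simp add: exp_add[symmetric])
    have "norm (bump w) \<le> 360 * exp (2 * \<bar>Im w\<bar>) / (1 + norm w)\<^sup>2" by (rule norm_bump_le)
    also have "\<dots> \<le> 360 * (exp 2 * exp (2 * \<bar>Im z\<bar>)) / ((1 + norm z)\<^sup>2 / 4)"
      using le pos ex by (intro frac_le mult_left_mono) auto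
    finally show ?thesis by simp
  qed
  have "norm ((deriv ^^ 1) bump z) \<le> fact 1 * (1440 * exp 2 * exp (2 * \<bar>Im z\<bar>) / (1 + norm z)\<^sup>2) / 1 ^ 1"
    by (rule Cauchy_inequality)
       (auto intro!: bound holomorphic_on_imp_continuous_on holomorphic_on_subset[OF bump_holomorphic])
  then show ?thesis by simp
qed

lemma csinc_of_real: "csinc (of_real x) = of_real (if x = 0 then 1 else sin x / x)"
  by (auto simp: csinc_def sin_of_real)

text \<open>The step is approximated by a primitive of the fourth power of \<open>sin x / x\<close>; the error
  decays quadratically on both sides. On the right, where the primitive falls short of \<open>1\<close>, a multiple of
  \<open>bump\<close> makes up for it. A square or a cube of \<open>sin x / x\<close> would decay too slowly or change sign.\<close>

theorem band_limited_majorant: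
  obtains k :: "complex \<Rightarrow> complex" and G :: "real \<Rightarrow> real" and C :: real where
    "C > 0" and "k holomorphic_on UNIV" and "\<And>x. Im (k (of_real x)) = 0"
    and "\<And>z. norm (k z) \<le> C * exp (4 * \<bar>Im z\<bar>) / (1 + norm z)\<^sup>2"
    and "\<And>x. (G has_real_derivative Re (k (of_real x))) (at x)"
    and "\<And>x. G x \<ge> 0" and "\<And>x. x \<ge> 0 \<Longrightarrow> G x \<ge> 1"
    and "\<And>x. x \<le> 0 \<Longrightarrow> G x \<le> C / (1 + \<bar>x\<bar>)\<^sup>2"
    and "\<And>x. x \<ge> 0 \<Longrightarrow> G x \<le> 1 + C / (1 + \<bar>x\<bar>)\<^sup>2"
proof -
  define s :: "real \<Rightarrow> real" where "s = (\<lambda>x. if x = 0 then 1 else sin x / x)"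
  have s: "csinc (of_real x) = of_real (s x)" for x by (simp add: csinc_of_real s_def)
  have hol4: "(\<lambda>z. csinc z ^ 4) holomorphic_on UNIV" by (intro holomorphic_intros csinc_holomorphic)
  obtain \<Phi> where \<Phi>: "\<And>z. (\<Phi> has_field_derivative csinc z ^ 4) (at z)"
    using holomorphic_convex_primitive'[OF convex_UNIV open_UNIV hol4] by auto
  define F where "F = (\<lambda>x. Re (\<Phi> (of_real x)) - Re (\<Phi> 0))"
  have F': "(F has_real_derivative s x ^ 4) (at x)" for x
  proof -
    have "((\<lambda>x. Re (\<Phi> (of_real x))) has_real_derivative s x ^ 4) (at x)"
      using has_real_derivative_Re(1)[OF \<Phi>[of "of_real x"]] by (simp add: s flip: of_real_power)
    from DERIV_diff[OF this DERIV_const] show ?thesis unfolding F_def by simp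
  qed
  have F0: "F 0 = 0" by (simp add: F_def)
  have mono: "F x \<le> F y" if "x \<le> y" for x y
    by (rule DERIV_nonneg_imp_nondecreasing[OF that]) (use F' in \<open>auto intro!: exI[of _ "s _ ^ 4"]\<close>)
  have odd: "F (- x) = - F x" for x
  proof -
    have "((\<lambda>x. F x + F (- x)) has_real_derivative 0) (at x)" for x
    proof -
      have "((\<lambda>x. F (- x)) has_real_derivative s (- x) ^ 4 * (- 1)) (at x)"
        by (rule DERIV_chain2[OF F']) (auto intro!: derivative_eq_intros)
      moreover have "s (- x) = s x" by (simp add: s_def)
      ultimately show ?thesis using DERIV_add[OF F'[of x], of "\<lambda>x. F (- x)"] by fastforce
    qed
    then have "F x + F (- x) = F 0 + F (- 0)" by (intro DERIV_isconst_all[of "\<lambda>x. F x + F (- x)"]) auto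
    then show ?thesis using F0 by simp
  qed
  have s_le: "\<bar>s x\<bar> \<le> 6 / (1 + \<bar>x\<bar>)" for x
    using norm_csinc_le[of "of_real x"] by (simp add: s)
  \<comment> \<open>\<open>F' \<le> 6\<^sup>4 / (1 + t)\<^sup>3\<close>, and \<open>648 / (1 + t)\<^sup>2\<close> is a primitive of \<open>- 1296 / (1 + t)\<^sup>3\<close>.\<close>
  have decay: "F y - F x \<le> 648 / (1 + x)\<^sup>2" if xy: "0 \<le> x" "x \<le> y" for x y
  proof -
    have "F y + 648 / (1 + y)\<^sup>2 \<le> F x + 648 / (1 + x)\<^sup>2"
    proof (rule DERIV_nonpos_imp_nonincreasing[OF xy(2)])
      fix t assume t: "x \<le> t" "t \<le> y"
      have t0: "1 + t > 0" using t xy by simp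
      have d: "((\<lambda>y. F y + 648 / (1 + y)\<^sup>2) has_real_derivative s t ^ 4 - 1296 / (1 + t) ^ 3) (at t)"
      proof -
        have "((\<lambda>y. 648 / (1 + y)\<^sup>2) has_real_derivative - 1296 / (1 + t) ^ 3) (at t)"
          using t0 by (auto intro!: derivative_eq_intros simp: power2_eq_square power3_eq_cube divide_simps)
        from DERIV_add[OF F'[of t] this] show ?thesis by simp
      qed
      have "s t ^ 4 = \<bar>s t\<bar> ^ 4" by simp
      also have "\<dots> \<le> (6 / (1 + t)) ^ 4"
        using s_le[of t] t xy by (intro power_mono) auto
      also have "\<dots> = 1296 / (1 + t) ^ 4" by (simp add: power_divide)
      also have "\<dots> \<le> 1296 / (1 + t) ^ 3"
        using t xy by (intro divide_left_mono power_increasing) auto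
      finally show "\<exists>y. ((\<lambda>y. F y + 648 / (1 + y)\<^sup>2) has_real_derivative y) (at t) \<and> y \<le> 0"
        using d by (intro exI[of _ "s t ^ 4 - 1296 / (1 + t) ^ 3"]) auto
    qed
    moreover have "648 / (1 + y)\<^sup>2 \<ge> 0" by simp
    ultimately show ?thesis by linarith
  qed
  have bdd: "bdd_above (F ` {0..})"
    using decay[of 0] F0 by (intro bdd_aboveI[of _ 648]) auto
  define m where "m = (SUP x\<in>{0..}. F x)"
  have m_ge: "F x \<le> m" for x
  proof -
    have "F x \<le> F \<bar>x\<bar>" by (rule mono) simp
    also have "\<dots> \<le> m" unfolding m_def by (rule cSUP_upper[OF _ bdd]) auto
    finally show ?thesis .
  qed
  have m_le: "m - F x \<le> 648 / (1 + x)\<^sup>2" if "x \<ge> 0" for x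
  proof -
    have "m \<le> F x + 648 / (1 + x)\<^sup>2" unfolding m_def
    proof (rule cSUP_least)
      fix y :: real assume "y \<in> {0..}"
      show "F y \<le> F x + 648 / (1 + x)\<^sup>2"
      proof (cases "x \<le> y")
        case True then show ?thesis using decay[of x y] that by simp
      next
        case False
        then have "F y \<le> F x" by (intro mono) auto
        then show ?thesis by (simp add: add_increasing2)
      qed
    qed auto
    then show ?thesis by simp
  qed
  have m: "m > 0"
  proof -
    have "F 0 < F 1"
    proof (rule DERIV_pos_imp_increasing_open[of 0 1])
      fix x :: real assume x: "0 < x" "x < 1"
      have "sin x > 0" using x pi_gt3 by (intro sin_gt_zero) auto
      then show "\<exists>y. (F has_real_derivative y) (at x) \<and> y > 0"
        using F'[of x] x by (intro exI[of _ "s x ^ 4"]) (auto simp: s_def)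
    qed (auto intro!: DERIV_isCont[OF F'] continuous_at_imp_continuous_on)
    then show ?thesis using m_ge[of 1] F0 by simp
  qed
  \<comment> \<open>The deviation of the rescaled primitive from the step, on the right; by oddness \<open>\<tau> (- x)\<close> is the one on the left.\<close>
  define \<tau> where "\<tau> = (\<lambda>x. (m - F x) / (2 * m))"
  have \<tau>: "0 \<le> \<tau> x" "x \<ge> 0 \<Longrightarrow> \<tau> x \<le> (324 / m) / (1 + x)\<^sup>2" for x
  proof -
    show "0 \<le> \<tau> x" using m_ge[of x] m by (simp add: \<tau>_def)
    assume "x \<ge> 0"
    then have "\<tau> x \<le> (648 / (1 + x)\<^sup>2) / (2 * m)"
      unfolding \<tau>_def using m by (intro divide_right_mono m_le) auto
    then show "\<tau> x \<le> (324 / m) / (1 + x)\<^sup>2" by (simp add: mult.commute)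
  qed
  define E where "E = (\<lambda>x. Re (bump (of_real x)))"
  have E_eq: "bump (of_real x) = of_real (s x ^ 2 + s (x + pi / 2) ^ 2)" for x
    unfolding bump_def of_real_add[symmetric] s by simp
  have E_eq': "E x = s x ^ 2 + s (x + pi / 2) ^ 2" for x unfolding E_def E_eq by simp
  have E0: "E x \<ge> 0" for x by (simp add: E_eq')
  have E_up: "E x \<le> 360 / (1 + \<bar>x\<bar>)\<^sup>2" for x
    using norm_bump_le[of "of_real x"] complex_Re_le_cmod[of "bump (of_real x)"] by (simp add: E_def)
  have E_low: "E x \<ge> (1 / 4) / (1 + x)\<^sup>2" if x: "x \<ge> 0" for x
  proof (cases "x = 0")
    case True
    have "E x \<ge> 1" unfolding E_eq' using True by (simp add: s_def)
    then show ?thesis using True by simp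
  next
    case False
    have "(2 * (1 + x))\<^sup>2 \<ge> x\<^sup>2" "(2 * (1 + x))\<^sup>2 \<ge> (x + pi / 2)\<^sup>2"
      using x pi_less_4 by (intro power_mono; simp)+
    then have "(sin x)\<^sup>2 / (2 * (1 + x))\<^sup>2 \<le> (sin x)\<^sup>2 / x\<^sup>2"
        "(cos x)\<^sup>2 / (2 * (1 + x))\<^sup>2 \<le> (cos x)\<^sup>2 / (x + pi / 2)\<^sup>2"
      using x False by (auto intro!: divide_left_mono mult_pos_pos zero_less_power add_nonneg_pos)
    moreover have "(sin x)\<^sup>2 / (2 * (1 + x))\<^sup>2 + (cos x)\<^sup>2 / (2 * (1 + x))\<^sup>2 = 1 / (2 * (1 + x))\<^sup>2"
      by (simp add: add_divide_distrib[symmetric])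
    moreover have "E x = (sin x)\<^sup>2 / x\<^sup>2 + (cos x)\<^sup>2 / (x + pi / 2)\<^sup>2"
    proof -
      have "x + pi / 2 \<noteq> 0" using x pi_gt_zero by linarith
      then show ?thesis using False by (simp add: E_eq' s_def power_divide sin_add)
    qed
    ultimately have "E x \<ge> 1 / (2 * (1 + x))\<^sup>2" by linarith
    also have "1 / (2 * (1 + x))\<^sup>2 = (1 / 4) / (1 + x)\<^sup>2" by (simp only: power_mult_distrib) simp
    finally show ?thesis .
  qed
  define A where "A = 4 * (324 / m)"
  have A: "A > 0" using m by (simp add: A_def)
  have AE: "A * E x \<ge> \<tau> x" if "x \<ge> 0" for x
  proof -
    have "\<tau> x \<le> (324 / m) / (1 + x)\<^sup>2" by (rule \<tau>(2)[OF that])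
    also have "\<dots> = A * ((1 / 4) / (1 + x)\<^sup>2)" by (simp add: A_def)
    also have "\<dots> \<le> A * E x" using A by (intro mult_left_mono E_low that) auto
    finally show ?thesis .
  qed
  define G where "G = (\<lambda>x. (1 + F x / m) / 2 + A * E x)"
  define k where "k = (\<lambda>z. csinc z ^ 4 / of_real (2 * m) + of_real A * deriv bump z)"
  define C where "C = 6 ^ 4 / (2 * m) + A * (1440 * exp 2) + 324 / m + A * 360"
  have bump_der: "(bump has_field_derivative deriv bump z) (at z)" for z
    by (rule holomorphic_derivI[OF bump_holomorphic]) auto
  have G_pos: "G x = 1 - \<tau> x + A * E x" for x
    using m by (simp add: G_def \<tau>_def field_simps)
  have G_neg: "G x = \<tau> (- x) + A * E x" for x
    using m by (simp add: G_def \<tau>_def odd field_simps)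
  show ?thesis
  proof (rule that[of C k G])
    show "C > 0" unfolding C_def using m A by (intro add_pos_pos mult_pos_pos divide_pos_pos) auto
    show "k holomorphic_on UNIV"
      unfolding k_def using m by (intro holomorphic_intros csinc_holomorphic bump_holomorphic) auto
    show "Im (k (of_real x)) = 0" for x
    proof -
      have "(\<lambda>x. Im (bump (of_real x))) = (\<lambda>x. 0)" by (simp only: E_eq Im_complex_of_real)
      then have "((\<lambda>x. 0 :: real) has_real_derivative Im (deriv bump (of_real x))) (at x)"
        using has_real_derivative_Re(2)[OF bump_der[of "of_real x"]] by simp
      then have "Im (deriv bump (of_real x)) = 0" using DERIV_const DERIV_unique by blast
      then show ?thesis by (simp add: k_def s flip: of_real_power of_real_divide)
    qed
    show "norm (k z) \<le> C * exp (4 * \<bar>Im z\<bar>) / (1 + norm z)\<^sup>2" for z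
    proof -
      let ?e = "exp (4 * \<bar>Im z\<bar>)" and ?d = "(1 + norm z)\<^sup>2"
      have d: "?d > 0" by (intro zero_less_power add_pos_nonneg) auto
      have "norm (csinc z ^ 4 / of_real (2 * m)) \<le> (6 ^ 4 * ?e / (1 + norm z) ^ 4) / (2 * m)"
      proof -
        have "norm (csinc z ^ 4 / of_real (2 * m)) = norm (csinc z ^ 4) / (2 * m)"
          using m by (simp add: norm_divide norm_mult)
        then show ?thesis using norm_csinc_power_le[of z 4] m by (simp only:) (intro divide_right_mono; simp)
      qed
      also have "\<dots> \<le> (6 ^ 4 * ?e / ?d) / (2 * m)"
        using m d by (intro divide_right_mono divide_left_mono power_increasing) (auto intro!: mult_pos_pos add_pos_nonneg)
      finally have 1: "norm (csinc z ^ 4 / of_real (2 * m)) \<le> 6 ^ 4 / (2 * m) * (?e / ?d)" by (simp add: mult_ac)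
      have "norm (deriv bump z) \<le> 1440 * exp 2 * exp (2 * \<bar>Im z\<bar>) / ?d" by (rule norm_deriv_bump_le)
      also have "\<dots> \<le> 1440 * exp 2 * ?e / ?d" using d by (intro divide_right_mono mult_left_mono) auto
      finally have "A * norm (deriv bump z) \<le> A * (1440 * exp 2 * ?e / ?d)" using A by (intro mult_left_mono) auto
      then have 2: "norm (of_real A * deriv bump z) \<le> A * (1440 * exp 2) * (?e / ?d)"
        using A by (simp add: norm_mult mult_ac)
      have "norm (k z) \<le> 6 ^ 4 / (2 * m) * (?e / ?d) + A * (1440 * exp 2) * (?e / ?d)"
        unfolding k_def by (rule order_trans[OF norm_triangle_ineq add_mono[OF 1 2]])
      also have "\<dots> = (6 ^ 4 / (2 * m) + A * (1440 * exp 2)) * (?e / ?d)" by (rule distrib_right[symmetric])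
      also have "\<dots> \<le> C * (?e / ?d)"
      proof (rule mult_right_mono)
        have "324 / m + A * 360 \<ge> 0" using m A by auto
        then show "6 ^ 4 / (2 * m) + A * (1440 * exp 2) \<le> C" unfolding C_def by linarith
      qed (use d in auto)
      finally show ?thesis by simp
    qed
    show "(G has_real_derivative Re (k (of_real x))) (at x)" for x
    proof -
      have "(E has_real_derivative Re (deriv bump (of_real x))) (at x)"
        unfolding E_def by (rule has_real_derivative_Re(1)[OF bump_der])
      then have "(G has_real_derivative s x ^ 4 / (2 * m) + A * Re (deriv bump (of_real x))) (at x)"
        unfolding G_def using m by (auto intro!: derivative_eq_intros F' simp: field_simps)
      moreover have "Re (k (of_real x)) = s x ^ 4 / (2 * m) + A * Re (deriv bump (of_real x))"
        by (simp add: k_def s flip: of_real_power of_real_divide of_real_mult)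
      ultimately show ?thesis by simp
    qed
    show G1: "G x \<ge> 1" if "x \<ge> 0" for x using AE[OF that] by (simp add: G_pos)
    show "G x \<ge> 0" for x using \<tau>(1)[of "- x"] E0[of x] A by (simp add: G_neg)
    have C_ge: "324 / m + A * 360 \<le> C"
    proof -
      have "6 ^ 4 / (2 * m) + A * (1440 * exp 2) \<ge> 0" using m A by auto
      then show ?thesis unfolding C_def by linarith
    qed
    have le: "\<tau> \<bar>x\<bar> + A * E x \<le> C / (1 + \<bar>x\<bar>)\<^sup>2" for x
    proof -
      have "\<tau> \<bar>x\<bar> + A * E x \<le> (324 / m) / (1 + \<bar>x\<bar>)\<^sup>2 + A * (360 / (1 + \<bar>x\<bar>)\<^sup>2)"
        using A by (intro add_mono \<tau>(2) mult_left_mono E_up) auto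
      also have "\<dots> = (324 / m + A * 360) / (1 + \<bar>x\<bar>)\<^sup>2" by (simp add: add_divide_distrib)
      also have "\<dots> \<le> C / (1 + \<bar>x\<bar>)\<^sup>2" by (intro divide_right_mono C_ge) auto
      finally show ?thesis .
    qed
    show "G x \<le> C / (1 + \<bar>x\<bar>)\<^sup>2" if "x \<le> 0" for x using le[of x] that by (simp add: G_neg)
    show "G x \<le> 1 + C / (1 + \<bar>x\<bar>)\<^sup>2" if "x \<ge> 0" for x
      using le[of x] that \<tau>(1)[of x] by (simp add: G_pos)
  qed
qed

section \<open>Sums over primes\<close>

lemma suminf_inverse_squares_le: "(\<Sum>n. real (Suc n) powr (- 2)) \<le> 2"
proof -
  have tel: "(\<lambda>n. 1 / real (Suc n) - 1 / real (Suc (Suc n))) sums (1 / real (Suc 0) - 0)"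
    by (rule telescope_sums') (rule LIMSEQ_Suc[OF lim_1_over_n])
  have "(\<Sum>n. real (Suc (Suc n)) powr (- 2)) \<le> 1"
  proof -
    have "real (Suc (Suc n)) powr (- 2) \<le> 1 / real (Suc n) - 1 / real (Suc (Suc n))" for n
    proof -
      have "real (Suc (Suc n)) powr (- 2) = 1 / (real (Suc (Suc n)) * real (Suc (Suc n)))"
        by (simp add: powr_minus powr_numeral power2_eq_square field_simps del: of_nat_Suc)
      also have "\<dots> \<le> 1 / (real (Suc n) * real (Suc (Suc n)))"
        by (intro divide_left_mono mult_right_mono) auto
      also have "\<dots> = 1 / real (Suc n) - 1 / real (Suc (Suc n))" by (simp add: field_simps)
      finally show ?thesis .
    qed
    moreover have "summable (\<lambda>n. real (Suc (Suc n)) powr (- 2))"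
      using summable_Suc_powr by (subst (asm) summable_Suc_iff[symmetric])
    ultimately have "(\<Sum>n. real (Suc (Suc n)) powr (- 2)) \<le> (\<Sum>n. 1 / real (Suc n) - 1 / real (Suc (Suc n)))"
      using tel by (intro suminf_le) (auto simp: sums_iff)
    also have "\<dots> = 1" using tel by (simp add: sums_iff)
    finally show ?thesis .
  qed
  then show ?thesis using suminf_split_head[OF summable_Suc_powr] by simp
qed

text \<open>Rankin's device: at \<open>s = 1 + 1 / ln x\<close> the \<open>p\<close>-th term of \<open>log \<zeta>(s)\<close> is still at least
  \<open>1 / (e p)\<close> for \<open>p < x\<close>, whereas \<open>\<zeta>(s)\<close> is at most \<open>ln x\<close> plus a constant.\<close>

lemma sum_primes_inverse_le:
  assumes x: "x \<ge> 3"
  shows "(\<Sum>p | prime p \<and> real p < x. 1 / real p) \<le> 9 * ln (3 * ln x)"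
proof -
  interpret Z: completely_multiplicative "\<lambda>_. 1 :: complex" by (rule completely_multiplicative_1)
  let ?S = "{p. prime p \<and> real p < x}"
  have fin: "finite ?S" by (rule finite_subset[of _ "{..nat \<lceil>x\<rceil>}"]) (auto simp: le_nat_iff le_ceiling_iff)
  have ln1: "ln x \<ge> 1"
  proof -
    have "exp 1 \<le> x" using exp_le x by linarith
    then show ?thesis using x by (subst ln_ge_iff) auto
  qed
  define d where "d = 1 / ln x"
  have d: "0 < d" "d \<le> 1" using ln1 by (auto simp: d_def)
  define s where "s = complex_of_real (1 + d)"
  have s1: "Re s > 1" using d by (simp add: s_def)
  define r where "r = (\<lambda>p. real p powr - (1 + d))"
  have dterm: "Z.dterm s p = of_real (r p)" for p
  proof -
    have "complex_of_nat p powr s = of_real (real p powr (1 + d))"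
      using powr_of_real[of "real p" "1 + d"] by (simp add: s_def)
    then show ?thesis
      unfolding Z.dterm_def r_def powr_minus by (simp only: of_real_inverse) (simp add: field_simps)
  qed
  have Re_factor: "Re (Z.log_factor s p) \<ge> r p" if "prime p" for p
  proof -
    have rp: "r p \<le> 3 / 4" "r p \<ge> 0"
      using Z.norm_dterm_prime_le[OF that, of s] s1 by (auto simp: dterm r_def)
    have "- r p \<ge> ln (1 + - r p)" using rp by (intro ln_add_one_self_le_self2) auto
    moreover have "ln (1 - complex_of_real (r p)) = of_real (ln (1 - r p))"
      using Ln_of_real[of "1 - r p"] rp by simp
    ultimately show ?thesis using that by (simp add: Z.log_factor_def dterm)
  qed
  have r_ge: "1 / real p \<le> 3 * r p" if "p \<in> ?S" for p
  proof -
    have p: "real p \<ge> 1" using that by (simp add: prime_gt_0_nat Suc_leI)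
    have "real p powr d \<le> x powr d" using that p d by (intro powr_mono2) auto
    also have "x powr d = exp 1" using x ln1 by (simp add: powr_def d_def)
    also have "\<dots> \<le> 3" using exp_le by simp
    finally have "1 / (3 * real p) \<le> 1 / (real p powr d * real p)"
      using p by (intro divide_left_mono mult_right_mono mult_pos_pos) auto
    also have "\<dots> = r p" using p unfolding r_def powr_minus powr_add by (simp add: field_simps)
    finally show ?thesis by simp
  qed
  have "(\<Sum>p\<in>?S. 1 / real p) \<le> (\<Sum>p\<in>?S. 3 * Re (Z.log_factor s p))"
  proof (rule sum_mono)
    fix p assume p: "p \<in> ?S"
    show "1 / real p \<le> 3 * Re (Z.log_factor s p)" using r_ge[OF p] Re_factor[of p] p by auto
  qed
  also have "\<dots> = 3 * (\<Sum>p\<in>?S. Re (Z.log_factor s p))" by (simp add: sum_distrib_left)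
  also have "(\<Sum>p\<in>?S. Re (Z.log_factor s p)) \<le> (\<Sum>n. Re (Z.log_factor s n))"
  proof (rule sum_le_suminf[OF _ fin])
    show "summable (\<lambda>n. Re (Z.log_factor s n))"
      by (intro summable_Re summable_norm_cancel[OF Z.summable_norm_log_factor[OF s1]])
    fix n show "0 \<le> Re (Z.log_factor s n)"
    proof (cases "prime n")
      case True
      have "0 \<le> r n" by (simp add: r_def)
      then show ?thesis using Re_factor[OF True] by linarith
    qed (simp add: Z.log_factor_def)
  qed
  also have "\<dots> = Re (Z.log_series s)"
    unfolding Z.log_series_def
    by (rule Re_suminf[symmetric, OF summable_norm_cancel[OF Z.summable_norm_log_factor[OF s1]]])
  also have "\<dots> = ln (norm (dirichlet_L (\<lambda>_. 1) s))"
    unfolding Z.exp_log_series[OF s1, symmetric] norm_exp_eq_Re by simp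
  also have "\<dots> \<le> ln ((3 * ln x) ^ 3)"
  proof (subst ln_le_cancel_iff)
    have "norm (dirichlet_L (\<lambda>_. 1) s) \<le> norm (1 / (s - 1)) + norm (dirichlet_L (\<lambda>_. 1) s - 1 / (s - 1))"
      by (metis add.commute diff_add_cancel norm_triangle_ineq)
    also have "norm (dirichlet_L (\<lambda>_. 1) s - 1 / (s - 1)) \<le> norm s * (\<Sum>n. real (Suc n) powr (- 2))"
      by (rule zeta_minus_pole_bound[OF s1])
    also have "\<dots> \<le> 2 * 2"
      using d by (intro mult_mono suminf_inverse_squares_le suminf_nonneg summable_Suc_powr)
        (auto simp: s_def norm_of_real simp del: of_real_add)
    also have "norm (1 / (s - 1)) = ln x" using ln1 by (simp add: s_def d_def norm_divide)
    finally have "norm (dirichlet_L (\<lambda>_. 1) s) \<le> 27 * ln x" using ln1 by simp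
    also have "\<dots> \<le> 27 * ln x ^ 3" using ln1 power_increasing[of 1 3 "ln x"] by simp
    finally show "norm (dirichlet_L (\<lambda>_. 1) s) \<le> (3 * ln x) ^ 3" by (simp add: power_mult_distrib)
  qed (use ln1 Z.dirichlet_L_nonzero[OF s1] in auto)
  also have "\<dots> = 3 * ln (3 * ln x)" using ln1 by (subst ln_realpow) auto
  finally show ?thesis by simp
qed

section \<open>Smoothing functions of bounded decrease\<close>

text \<open>The mass of a majorant of the kernel at scale \<open>h\<close>.\<close>

lemma integral_quadratic_decay_le:
  assumes h: "h > 0" and U: "U > 0" and C: "C \<ge> (0 :: real)"
  shows "(\<lambda>u. C / (1 + \<bar>u / h\<bar>)\<^sup>2) integrable_on {- U..U}"
    and "integral {- U..U} (\<lambda>u. C / (1 + \<bar>u / h\<bar>)\<^sup>2) \<le> 2 * C * h"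
proof -
  have pos: "1 + x / h > 0" if "x \<ge> 0" for x using that h by (simp add: add_pos_nonneg)
  have cont: "continuous_on A (\<lambda>u. C / (1 + \<bar>u / h\<bar>)\<^sup>2)" for A
  proof -
    have nz: "\<forall>u\<in>A. (1 + \<bar>u / h\<bar>)\<^sup>2 \<noteq> 0"
    proof
      fix u have "1 + \<bar>u / h\<bar> > 0" by (rule add_pos_nonneg) auto
      then show "(1 + \<bar>u / h\<bar>)\<^sup>2 \<noteq> 0" by (metis less_irrefl zero_less_power)
    qed
    show ?thesis by (intro continuous_intros nz) (use h in auto)
  qed
  show int: "(\<lambda>u. C / (1 + \<bar>u / h\<bar>)\<^sup>2) integrable_on {- U..U}"
    by (intro integrable_continuous_interval cont)
  have 1: "((\<lambda>u. C / (1 + \<bar>u / h\<bar>)\<^sup>2) has_integral (- (C * h) / (1 + U / h) - (- (C * h) / (1 + 0 / h)))) {0..U}"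
  proof (rule fundamental_theorem_of_calculus)
    fix x assume x: "x \<in> {0..U}"
    have "((\<lambda>x. - (C * h) / (1 + x / h)) has_real_derivative C / (1 + x / h)\<^sup>2) (at x within {0..U})"
      using pos[of x] x h by (auto intro!: derivative_eq_intros simp: power2_eq_square divide_simps)
    then show "((\<lambda>x. - (C * h) / (1 + x / h)) has_vector_derivative C / (1 + \<bar>x / h\<bar>)\<^sup>2) (at x within {0..U})"
      using x h by (simp add: has_real_derivative_iff_has_vector_derivative)
  qed (use U in auto)
  have e1: "integral {0..U} (\<lambda>u. C / (1 + \<bar>u / h\<bar>)\<^sup>2) \<le> C * h"
  proof -
    have "C * h / (1 + U / h) \<ge> 0" using C h U by (auto intro!: divide_nonneg_nonneg add_nonneg_nonneg)
    then show ?thesis using integral_unique[OF 1] by simp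
  qed
  have "integral {- U..0} (\<lambda>u. C / (1 + \<bar>u / h\<bar>)\<^sup>2) = integral {0..U} (\<lambda>u. C / (1 + \<bar>u / h\<bar>)\<^sup>2)"
    using Henstock_Kurzweil_Integration.integral_reflect_real[of U 0 "\<lambda>u. C / (1 + \<bar>u / h\<bar>)\<^sup>2"] by simp
  then show "integral {- U..U} (\<lambda>u. C / (1 + \<bar>u / h\<bar>)\<^sup>2) \<le> 2 * C * h"
    using Henstock_Kurzweil_Integration.integral_combine[OF _ _ int, of 0] e1 U by simp
qed

text \<open>If the slope of \<open>w\<close> is at least \<open>- A\<close>, comparing \<open>w t\<close> with the average of \<open>w\<close> against
  \<open>G'\<close> amounts, after integration by parts, to integrating \<open>w'\<close> against the nonnegative
  difference of \<open>G\<close> and the unit step.\<close>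

theorem smoothing_upper_bound:
  fixes w w' G \<kappa> :: "real \<Rightarrow> real"
  assumes G: "\<And>x. (G has_real_derivative \<kappa> x) (at x)" and \<kappa>: "continuous_on UNIV \<kappa>"
    and G0: "\<And>x. G x \<ge> 0" and G1: "\<And>x. x \<ge> 0 \<Longrightarrow> G x \<ge> 1"
    and Gl: "\<And>x. x \<le> 0 \<Longrightarrow> G x \<le> C / (1 + \<bar>x\<bar>)\<^sup>2"
    and Gr: "\<And>x. x \<ge> 0 \<Longrightarrow> G x \<le> 1 + C / (1 + \<bar>x\<bar>)\<^sup>2"
    and w: "\<And>y. y \<in> {t - U..t + U} \<Longrightarrow> (w has_real_derivative w' y) (at y)"
    and w': "\<And>y. y \<in> {t - U..t + U} \<Longrightarrow> w' y \<ge> - A"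
    and B: "\<And>y. y \<in> {t - U..t + U} \<Longrightarrow> \<bar>w y\<bar> \<le> B"
    and h: "h > 0" and U: "U > 0" and A: "A \<ge> 0" and C: "C \<ge> 0"
  shows "w t \<le> integral {- U..U} (\<lambda>u. \<kappa> (u / h) / h * w (t - u)) + 2 * A * C * h + 2 * B * C / (1 + U / h)\<^sup>2"
proof -
  let ?f = "\<lambda>u. \<kappa> (u / h) / h * w (t - u)"
  have w_cont: "continuous_on {t - U..t + U} w"
    using w by (intro continuous_at_imp_continuous_on) (blast intro: DERIV_isCont)
  have cont: "continuous_on {- U..U} ?f"
    using h by (intro continuous_intros continuous_on_compose2[OF \<kappa>] continuous_on_compose2[OF w_cont]) auto
  have int: "?f integrable_on {- U..U}" by (rule integrable_continuous_interval[OF cont])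
  have Gh: "((\<lambda>u. G (u / h)) has_real_derivative \<kappa> (u / h) / h) (at u within S)" for u S
  proof -
    have "((\<lambda>u. G (u / h)) has_real_derivative \<kappa> (u / h) * (1 / h)) (at u)"
      by (rule DERIV_chain2[OF G]) (use h in \<open>auto intro!: derivative_eq_intros\<close>)
    then show ?thesis by (simp add: has_field_derivative_at_within)
  qed
  have wt: "((\<lambda>u. w (t - u)) has_real_derivative - w' (t - u)) (at u within S)" if "u \<in> {- U..U}" for u S
  proof -
    have "((\<lambda>u. w (t - u)) has_real_derivative w' (t - u) * (- 1)) (at u)"
      by (rule DERIV_chain2[OF w]) (use that in \<open>auto intro!: derivative_eq_intros\<close>)
    then show ?thesis by (simp add: has_field_derivative_at_within)
  qed
  \<comment> \<open>To the left of \<open>0\<close> the step is \<open>0\<close>. Since \<open>w' \<ge> - A\<close> and \<open>0 \<le> G \<le> C / (1 + \<bar>x\<bar>)\<^sup>2\<close>, the loss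
    \<open>G w'\<close> is controlled by a function with an explicit primitive.\<close>
  have neg: "G 0 * w t - G (- U / h) * w (t + U) - A * C * h \<le> integral {- U..0} ?f"
  proof -
    let ?g = "\<lambda>u. G (u / h) * w (t - u) - A * C * h / (1 - u / h)"
    let ?g' = "\<lambda>u. \<kappa> (u / h) / h * w (t - u) - G (u / h) * w' (t - u) - A * C / (1 - u / h)\<^sup>2"
    have "(?g' has_integral (?g 0 - ?g (- U))) {- U..0}"
    proof (rule fundamental_theorem_of_calculus)
      fix u assume u: "u \<in> {- U..0}"
      have pos: "1 - u / h > 0"
      proof -
        have "u / h \<le> 0" using u h by (auto intro: divide_nonpos_pos)
        then show ?thesis by linarith
      qed
      have "((\<lambda>u. G (u / h) * w (t - u)) has_real_derivative
            \<kappa> (u / h) / h * w (t - u) + - w' (t - u) * G (u / h)) (at u within {- U..0})"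
        by (rule DERIV_mult[OF Gh wt]) (use u in auto)
      moreover have "((\<lambda>u. A * C * h / (1 - u / h)) has_real_derivative A * C / (1 - u / h)\<^sup>2) (at u within {- U..0})"
        using pos h by (auto intro!: derivative_eq_intros simp: power2_eq_square divide_simps)
      ultimately have "(?g has_real_derivative
            (\<kappa> (u / h) / h * w (t - u) + - w' (t - u) * G (u / h)) - A * C / (1 - u / h)\<^sup>2) (at u within {- U..0})"
        by (rule DERIV_diff)
      then show "(?g has_vector_derivative ?g' u) (at u within {- U..0})"
        by (simp add: has_real_derivative_iff_has_vector_derivative mult.commute)
    qed (use U in auto)
    moreover have "(?f has_integral integral {- U..0} ?f) {- U..0}"
      by (rule integrable_integral, rule integrable_subinterval_real[OF int]) (use U in auto)
    moreover have "?g' u \<le> ?f u" if u: "u \<in> {- U..0}" for u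
    proof -
      have u0: "u / h \<le> 0" using u h by (auto intro: divide_nonpos_pos)
      have "- (G (u / h) * w' (t - u)) \<le> G (u / h) * A"
        using mult_left_mono[OF w'[of "t - u"] G0[of "u / h"]] u U by simp
      also have "\<dots> \<le> C / (1 + \<bar>u / h\<bar>)\<^sup>2 * A" by (intro mult_right_mono Gl u0 A)
      also have "\<bar>u / h\<bar> = - (u / h)" by (rule abs_of_nonpos[OF u0])
      finally show ?thesis by (simp add: mult_ac)
    qed
    ultimately have "?g 0 - ?g (- U) \<le> integral {- U..0} ?f"
      by (rule has_integral_le)
    moreover have "A * C * h / (1 - (- U) / h) \<ge> 0"
      using A C h U by (auto intro!: divide_nonneg_nonneg mult_nonneg_nonneg add_nonneg_nonneg)
    ultimately show ?thesis by simp
  qed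
  \<comment> \<open>To the right of \<open>0\<close> the step is \<open>1\<close>, and \<open>G - 1\<close> takes the place of \<open>G\<close>.\<close>
  have pos: "(G (U / h) - 1) * w (t - U) - (G 0 - 1) * w t - A * C * h \<le> integral {0..U} ?f"
  proof -
    let ?g = "\<lambda>u. (G (u / h) - 1) * w (t - u) + A * C * h / (1 + u / h)"
    let ?g' = "\<lambda>u. \<kappa> (u / h) / h * w (t - u) - (G (u / h) - 1) * w' (t - u) - A * C / (1 + u / h)\<^sup>2"
    have "(?g' has_integral (?g U - ?g 0)) {0..U}"
    proof (rule fundamental_theorem_of_calculus)
      fix u assume u: "u \<in> {0..U}"
      have pos: "1 + u / h > 0" using u h by (simp add: add_pos_nonneg)
      have "((\<lambda>u. G (u / h) - 1) has_real_derivative \<kappa> (u / h) / h) (at u within {0..U})"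
        using DERIV_diff[OF Gh DERIV_const] by simp
      then have "((\<lambda>u. (G (u / h) - 1) * w (t - u)) has_real_derivative
            \<kappa> (u / h) / h * w (t - u) + - w' (t - u) * (G (u / h) - 1)) (at u within {0..U})"
        by (rule DERIV_mult[OF _ wt]) (use u in auto)
      moreover have "((\<lambda>u. A * C * h / (1 + u / h)) has_real_derivative - (A * C / (1 + u / h)\<^sup>2)) (at u within {0..U})"
        using pos h by (auto intro!: derivative_eq_intros simp: power2_eq_square divide_simps)
      ultimately have "(?g has_real_derivative
            (\<kappa> (u / h) / h * w (t - u) + - w' (t - u) * (G (u / h) - 1)) + - (A * C / (1 + u / h)\<^sup>2)) (at u within {0..U})"
        by (rule DERIV_add)
      then show "(?g has_vector_derivative ?g' u) (at u within {0..U})"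
        by (simp add: has_real_derivative_iff_has_vector_derivative mult.commute)
    qed (use U in auto)
    moreover have "(?f has_integral integral {0..U} ?f) {0..U}"
      by (rule integrable_integral, rule integrable_subinterval_real[OF int]) (use U in auto)
    moreover have "?g' u \<le> ?f u" if u: "u \<in> {0..U}" for u
    proof -
      have u0: "u / h \<ge> 0" using u h by simp
      have "- ((G (u / h) - 1) * w' (t - u)) \<le> (G (u / h) - 1) * A"
        using mult_left_mono[OF w'[of "t - u"], of "G (u / h) - 1"] G1[OF u0] u U by simp
      also have "\<dots> \<le> C / (1 + \<bar>u / h\<bar>)\<^sup>2 * A"
        using Gr[OF u0] A by (intro mult_right_mono) auto
      also have "\<bar>u / h\<bar> = u / h" by (rule abs_of_nonneg[OF u0])
      finally show ?thesis by (simp add: mult_ac)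
    qed
    ultimately have "?g U - ?g 0 \<le> integral {0..U} ?f"
      by (rule has_integral_le)
    moreover have "A * C * h / (1 + U / h) \<ge> 0"
      using A C h U by (auto intro!: divide_nonneg_nonneg mult_nonneg_nonneg add_nonneg_nonneg)
    ultimately show ?thesis by simp
  qed
  have split: "integral {- U..U} ?f = integral {- U..0} ?f + integral {0..U} ?f"
    using Henstock_Kurzweil_Integration.integral_combine[OF _ _ int, of 0] U by simp
  have UH: "U / h \<ge> 0" using U h by simp
  have B0: "B \<ge> 0" using B[of t] U by (smt (verit) atLeastAtMost_iff)
  have "G (- U / h) * w (t + U) \<le> C / (1 + U / h)\<^sup>2 * B"
  proof -
    have "G (- U / h) * w (t + U) \<le> G (- U / h) * B"
      using B[of "t + U"] U G0 by (intro mult_left_mono) auto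
    also have "\<dots> \<le> C / (1 + U / h)\<^sup>2 * B"
    proof (rule mult_right_mono[OF _ B0])
      have "G (- (U / h)) \<le> C / (1 + \<bar>- (U / h)\<bar>)\<^sup>2" by (rule Gl) (use UH in linarith)
      then show "G (- U / h) \<le> C / (1 + U / h)\<^sup>2"
        unfolding abs_minus_cancel abs_of_nonneg[OF UH] by (simp only: minus_divide_left[symmetric])
    qed
    finally show ?thesis .
  qed
  moreover have "- ((G (U / h) - 1) * w (t - U)) \<le> C / (1 + U / h)\<^sup>2 * B"
  proof -
    have "- ((G (U / h) - 1) * w (t - U)) = (G (U / h) - 1) * (- w (t - U))" by simp
    also have "\<dots> \<le> (G (U / h) - 1) * B"
      using B[of "t - U"] U G1[OF UH] by (intro mult_left_mono) auto
    also have "\<dots> \<le> C / (1 + U / h)\<^sup>2 * B"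
      using Gr[OF UH] UH B0 by (intro mult_right_mono) (auto simp: abs_if)
    finally show ?thesis .
  qed
  ultimately have "G 0 * w t - (G 0 - 1) * w t - 2 * (A * C * h) - 2 * (C / (1 + U / h)\<^sup>2 * B) \<le> integral {- U..U} ?f"
    using neg pos split by linarith
  moreover have "G 0 * w t - (G 0 - 1) * w t = w t" by (simp add: algebra_simps)
  ultimately show ?thesis by (simp add: mult_ac)
qed

section \<open>Shifting the smoothing integral into the half-plane of convergence\<close>

text \<open>Bounds an integral along a side of the rectangle by comparison with an explicit primitive.\<close>

lemma norm_diff_le_if_derivative_le:
  fixes f f' :: "real \<Rightarrow> complex" and \<phi> \<phi>' :: "real \<Rightarrow> real"
  assumes "a \<le> b"
    and f: "\<And>x. x \<in> {a..b} \<Longrightarrow> (f has_vector_derivative f' x) (at x)"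
    and \<phi>: "\<And>x. x \<in> {a..b} \<Longrightarrow> (\<phi> has_real_derivative \<phi>' x) (at x)"
    and le: "\<And>x. x \<in> {a..b} \<Longrightarrow> norm (f' x) \<le> \<phi>' x"
  shows "norm (f b - f a) \<le> \<phi> b - \<phi> a"
proof -
  have 1: "(f' has_integral (f b - f a)) {a..b}"
    by (rule fundamental_theorem_of_calculus[OF assms(1)]) (use f in \<open>blast intro: has_vector_derivative_at_within\<close>)
  have 2: "(\<phi>' has_integral (\<phi> b - \<phi> a)) {a..b}"
    by (rule fundamental_theorem_of_calculus[OF assms(1)])
       (use \<phi> in \<open>auto simp: has_real_derivative_iff_has_vector_derivative intro: has_vector_derivative_at_within\<close>)
  have "norm (integral {a..b} f') \<le> integral {a..b} \<phi>'"
    by (rule Henstock_Kurzweil_Integration.integral_norm_bound_integral) (use 1 2 le in \<open>auto intro: has_integral_integrable\<close>)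
  then show ?thesis using 1 2 by (simp add: integral_unique)
qed

lemma Complex_has_vector_derivative:
  "((\<lambda>x. Complex x y) has_vector_derivative 1) (at x)"
  "((\<lambda>u. Complex x (t - u)) has_vector_derivative - \<i>) (at u)"
  unfolding Complex_eq by (auto intro!: derivative_eq_intros)

text \<open>The right-hand side has the elementary primitive \<open>v + 4 sqrt v\<close>.\<close>

lemma one_plus_abs_ln_le:
  fixes v :: real
  assumes "0 < v" "v \<le> 2"
  shows "1 + \<bar>ln v\<bar> \<le> 1 + 2 / sqrt v"
proof -
  have s: "sqrt v > 0" using assms by simp
  have "ln (1 / sqrt v) \<le> 1 / sqrt v - 1" using s by (intro ln_le_minus_one) auto
  then have "- ln v \<le> 2 / sqrt v" using assms s by (simp add: ln_div ln_sqrt)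
  moreover have "ln v \<le> 2 / sqrt v"
  proof -
    have "ln v \<le> 1" using ln_le_minus_one[of v] assms by linarith
    also have "1 \<le> 2 / sqrt v"
    proof -
      have "sqrt v \<le> 2" by (rule real_le_lsqrt) (use assms in auto)
      then show ?thesis using s by (simp add: field_simps)
    qed
    finally show ?thesis .
  qed
  ultimately show ?thesis by linarith
qed

lemma one_plus_norm_pos: "1 + norm (z :: complex) > 0"
  by (rule add_pos_nonneg) auto

context grh_character
begin

definition log_partial :: "nat \<Rightarrow> complex \<Rightarrow> complex" where
  "log_partial N s = (\<Sum>n<N. log_factor s n)"

lemma log_partial_holomorphic: "log_partial N holomorphic_on quadrant"
  unfolding log_partial_def[abs_def]
  by (intro holomorphic_intros holomorphic_on_subset[OF log_factor_holomorphic]) (auto simp: quadrant_def)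

lemma norm_log_partial_le:
  assumes "Re s \<ge> 1 / 2"
  shows "norm (log_partial N s) \<le> 4 * real N"
proof -
  have "norm (log_factor s n) \<le> 4" for n
  proof (cases "n = 0")
    case False
    have "norm (log_factor s n) \<le> 4 * real n powr (- Re s)" by (rule norm_log_factor_le[OF assms])
    also have "\<dots> \<le> 4 * 1"
      using powr_mono[of "- Re s" 0 "real n"] assms False by (intro mult_left_mono) auto
    finally show ?thesis by simp
  qed (auto simp: log_factor_def)
  then have "norm (log_partial N s) \<le> (\<Sum>n<N. 4)"
    unfolding log_partial_def by (intro sum_norm_le) auto
  then show ?thesis by simp
qed

text \<open>Beyond the first \<open>exp (5 / h)\<close> terms the logarithm decays so fast to the right that it beats
  the exponential growth of the kernel, so moving the line of integration far to the right shows
  that the smoothing does not see these terms. The rectangle is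
  finite because it has to stay inside the quadrant, at height at least \<open>3\<close>; its horizontal sides
  contribute little because the kernel decays.\<close>

lemma contour_shift:
  fixes k :: "complex \<Rightarrow> complex"
  defines "Z \<equiv> 4 * (\<Sum>n. real n powr (- 2))"
  assumes lb: "\<And>\<sigma> y. 1 / 2 < \<sigma> \<Longrightarrow> \<sigma> \<le> 2 \<Longrightarrow> 3 \<le> y \<Longrightarrow>
                 norm (log_L (Complex \<sigma> y)) \<le> A * ln y * (1 + \<bar>ln (\<sigma> - 1 / 2)\<bar>)" and A: "A \<ge> 1"
    and k: "k holomorphic_on UNIV"
    and kb: "\<And>z. norm (k z) \<le> C * exp (4 * \<bar>Im z\<bar>) / (1 + norm z)\<^sup>2"
    and \<sigma>: "1 / 2 < \<sigma>" "\<sigma> \<le> 1" and h: "0 < h" "h \<le> 1" and U: "U > 0" "t - U \<ge> 3"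
    and N: "exp (5 / h) \<le> real N" "real N \<le> 2 * exp (5 / h)"
  shows "norm (integral {- U..U} (\<lambda>u. k (of_real (u / h)) *
            (log_L (Complex \<sigma> (t - u)) - log_partial N (Complex \<sigma> (t - u)))))
         \<le> 14 * (C * exp (6 / h) * (h / U)\<^sup>2 * (A * ln (t + U) + 8 * exp (5 / h)))
            + 2 * (6 + U) * (C * Z * exp (6 / h) * (h / U)\<^sup>2) + 2 * U * (C * Z * exp (- U))"
proof -
  define s0 where "s0 = Complex \<sigma> t"
  \<comment> \<open>In the variable \<open>zz s\<close> the kernel sits on the line \<open>Re s = \<sigma>\<close> as \<open>k (u / h)\<close>, and it grows
    like \<open>exp (4 (Re s - \<sigma>) / h)\<close> to the right of that line.\<close>
  define zz where "zz = (\<lambda>s. \<i> * (s - s0) / of_real h)"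
  define F where "F = (\<lambda>s. log_L s - log_partial N s)"
  define \<Phi> where "\<Phi> = (\<lambda>s. k (zz s) * F s)"
  have zz: "Re (zz (Complex a y)) = (t - y) / h" "Im (zz (Complex a y)) = (a - \<sigma>) / h" for a y
    by (simp_all add: zz_def s0_def Re_divide_of_real Im_divide_of_real)
  have C: "C \<ge> 0"
  proof -
    have "0 \<le> norm (k 0)" by simp
    also have "\<dots> \<le> C" using kb[of 0] by simp
    finally show ?thesis .
  qed
  have Z: "Z \<ge> 0"
    unfolding Z_def by (intro mult_nonneg_nonneg suminf_nonneg) (auto simp: summable_real_powr_iff)
  have Fhol: "F holomorphic_on quadrant"
    unfolding F_def by (intro holomorphic_intros log_L_holomorphic log_partial_holomorphic)
  have "(k \<circ> zz) holomorphic_on quadrant"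
    by (rule holomorphic_on_compose_gen[OF _ k]) (use h in \<open>auto simp: zz_def intro!: holomorphic_intros\<close>)
  then have \<Phi>hol: "\<Phi> holomorphic_on quadrant"
    unfolding \<Phi>_def o_def by (intro holomorphic_intros Fhol)
  obtain \<Psi> where "\<And>s. s \<in> quadrant \<Longrightarrow> (\<Psi> has_field_derivative \<Phi> s) (at s within quadrant)"
    using holomorphic_convex_primitive'[OF quadrant(2,1) \<Phi>hol] by blast
  then have \<Psi>: "(\<Psi> has_field_derivative \<Phi> s) (at s)" if "s \<in> quadrant" for s
    using at_within_open[OF that quadrant(1)] that by metis
  have hor: "((\<lambda>a. \<Psi> (Complex a y)) has_vector_derivative \<Phi> (Complex a y)) (at a)"
    if "a > 1 / 2" "y > 0" for a y
  proof -
    have "Complex a y \<in> quadrant" using that by (auto simp: quadrant_def)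
    from field_vector_diff_chain_at[OF Complex_has_vector_derivative(1) \<Psi>[OF this]]
    show ?thesis by (simp add: o_def)
  qed
  have ver: "((\<lambda>u. \<Psi> (Complex a (t - u))) has_vector_derivative - \<i> * \<Phi> (Complex a (t - u))) (at u)"
    if "a > 1 / 2" "t - u > 0" for a u
  proof -
    have "Complex a (t - u) \<in> quadrant" using that by (auto simp: quadrant_def)
    from field_vector_diff_chain_at[OF Complex_has_vector_derivative(2) \<Psi>[OF this]]
    show ?thesis by (simp add: o_def)
  qed
  define e where "e = C * exp (6 / h) * (h / U)\<^sup>2"
  have e: "e \<ge> 0" using C by (simp add: e_def)
  \<comment> \<open>The abscissa of the far side, where the kernel times the tail of the logarithm has size
    \<open>exp ((10 - Y - 4 \<sigma>) / h)\<close> and \<open>10 - Y - 4 \<sigma> \<le> - U\<close>.\<close>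
  define Y where "Y = 8 + U"
  have k_hor: "norm (k (zz (Complex a y))) \<le> C * exp (4 * (a - \<sigma>) / h) * (h / U)\<^sup>2"
    if "a \<ge> \<sigma>" "\<bar>t - y\<bar> = U" for a y
  proof -
    let ?z = "zz (Complex a y)"
    have "U / h = \<bar>Re ?z\<bar>" unfolding zz using that h by (simp add: abs_divide)
    also have "\<dots> \<le> norm ?z" by (rule abs_Re_le_cmod)
    also have "\<dots> \<le> 1 + norm ?z" by simp
    finally have "(U / h)\<^sup>2 \<le> (1 + norm ?z)\<^sup>2" using U h by (intro power_mono) auto
    moreover have "(U / h)\<^sup>2 > 0" "(1 + norm ?z)\<^sup>2 > 0"
      using U h one_plus_norm_pos[of ?z] by (auto intro!: zero_less_power simp del: zero_less_power2)
    ultimately have "C * exp (4 * \<bar>Im ?z\<bar>) / (1 + norm ?z)\<^sup>2 \<le> C * exp (4 * \<bar>Im ?z\<bar>) / (U / h)\<^sup>2"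
      using C by (intro divide_left_mono mult_pos_pos mult_nonneg_nonneg) auto
    with kb[of ?z] have "norm (k ?z) \<le> C * exp (4 * \<bar>Im ?z\<bar>) / (U / h)\<^sup>2" by (rule order_trans)
    moreover have "\<bar>Im ?z\<bar> = (a - \<sigma>) / h" unfolding zz using that h by simp
    ultimately show ?thesis by (simp add: power_divide)
  qed
  have F_right: "norm (F (Complex a y)) \<le> Z * exp (5 * (2 - a) / h)" if "a \<ge> 2" "y > 0" for a y
  proof -
    have N1: "N \<ge> 1" using N(1) exp_gt_zero[of "5 / h"] by (cases N) auto
    have "F (Complex a y) = log_series (Complex a y) - sum (log_factor (Complex a y)) {..<N}"
      using that by (simp add: F_def log_partial_def log_L_eq_series quadrant_def)
    then have "norm (F (Complex a y)) \<le> Z * real N powr (2 - a)"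
      using norm_log_series_tail_le[of "Complex a y" N] that N1 by (simp add: Z_def)
    also have "real N powr (2 - a) \<le> exp (5 / h) powr (2 - a)"
      using that N by (intro powr_mono2') auto
    also have "\<dots> = exp (5 * (2 - a) / h)" by (simp add: powr_def mult.commute)
    finally show ?thesis using Z by (simp add: mult_left_mono)
  qed
  have horizontal: "norm (\<Psi> (Complex Y y) - \<Psi> (Complex \<sigma> y))
      \<le> 7 * (e * (A * ln (t + U) + 8 * exp (5 / h))) + (6 + U) * (Z * e)"
    if y: "y \<ge> 3" "\<bar>t - y\<bar> = U" for y
  proof -
    define M where "M = A * ln (t + U) + 8 * exp (5 / h)"
    have "y \<le> t + U" using y by linarith
    then have lny: "A * ln y \<le> A * ln (t + U)" using y A by (intro mult_left_mono) auto
    have M0: "M \<ge> 0" unfolding M_def using A U by (intro add_nonneg_nonneg mult_nonneg_nonneg) auto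
    have left: "norm (\<Phi> (Complex a y)) \<le> e * M * (1 + 2 / sqrt (a - 1 / 2))" if a: "a \<in> {\<sigma>..2}" for a
    proof -
      \<comment> \<open>The kernel grows by at most \<open>exp (4 (2 - 1 / 2) / h)\<close> up to abscissa \<open>2\<close>.\<close>
      have "exp (4 * (a - \<sigma>) / h) \<le> exp (6 / h)" using a \<sigma> h by (simp add: divide_right_mono)
      then have "C * exp (4 * (a - \<sigma>) / h) * (h / U)\<^sup>2 \<le> e"
        unfolding e_def using C by (intro mult_right_mono mult_left_mono) auto
      then have 1: "norm (k (zz (Complex a y))) \<le> e" using k_hor[of a y] a y by simp
      have "norm (F (Complex a y)) \<le> norm (log_L (Complex a y)) + norm (log_partial N (Complex a y))"
        unfolding F_def by (rule norm_triangle_ineq4)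
      also have "\<dots> \<le> A * ln y * (1 + \<bar>ln (a - 1 / 2)\<bar>) + 8 * exp (5 / h) * 1"
        using lb[of a y] norm_log_partial_le[of "Complex a y" N] N a \<sigma> y by (intro add_mono) auto
      also have "\<dots> \<le> A * ln (t + U) * (1 + \<bar>ln (a - 1 / 2)\<bar>) + 8 * exp (5 / h) * (1 + \<bar>ln (a - 1 / 2)\<bar>)"
        by (intro add_mono mult_right_mono[OF lny] mult_left_mono) auto
      also have "\<dots> = M * (1 + \<bar>ln (a - 1 / 2)\<bar>)" unfolding M_def by (rule distrib_right[symmetric])
      also have "\<dots> \<le> M * (1 + 2 / sqrt (a - 1 / 2))"
        using a \<sigma> M0 by (intro mult_left_mono one_plus_abs_ln_le) auto
      finally have 2: "norm (F (Complex a y)) \<le> M * (1 + 2 / sqrt (a - 1 / 2))" .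
      have "norm (\<Phi> (Complex a y)) \<le> e * (M * (1 + 2 / sqrt (a - 1 / 2)))"
        unfolding \<Phi>_def norm_mult by (intro mult_mono 1 2 e) auto
      then show ?thesis by (simp only: mult.assoc)
    qed
    have "norm (\<Psi> (Complex 2 y) - \<Psi> (Complex \<sigma> y))
        \<le> e * M * (2 + 4 * sqrt (2 - 1 / 2)) - e * M * (\<sigma> + 4 * sqrt (\<sigma> - 1 / 2))"
    proof (rule norm_diff_le_if_derivative_le[where f' = "\<lambda>a. \<Phi> (Complex a y)"
          and \<phi>' = "\<lambda>a. e * M * (1 + 2 / sqrt (a - 1 / 2))"])
      fix a assume a: "a \<in> {\<sigma>..2}"
      show "((\<lambda>a. \<Psi> (Complex a y)) has_vector_derivative \<Phi> (Complex a y)) (at a)"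
        by (rule hor) (use a \<sigma> y in auto)
      have "a - 1 / 2 > 0" using a \<sigma> by simp
      then have "((\<lambda>a. a + 4 * sqrt (a - 1 / 2)) has_real_derivative (1 + 2 / sqrt (a - 1 / 2))) (at a)"
        by (auto intro!: derivative_eq_intros simp: field_simps)
      then show "((\<lambda>a. e * M * (a + 4 * sqrt (a - 1 / 2))) has_real_derivative e * M * (1 + 2 / sqrt (a - 1 / 2))) (at a)"
        by (rule DERIV_cmult)
    qed (use \<sigma> left in auto)
    also have "\<dots> \<le> e * M * 7"
    proof -
      have "sqrt (2 - 1 / 2) \<le> 5 / 4" by (rule real_le_lsqrt) (auto simp: power2_eq_square)
      then have "2 + 4 * sqrt (2 - 1 / 2) - (\<sigma> + 4 * sqrt (\<sigma> - 1 / 2)) \<le> 7"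
        using \<sigma> real_sqrt_ge_zero[of "\<sigma> - 1 / 2"] by linarith
      then have "e * M * (2 + 4 * sqrt (2 - 1 / 2) - (\<sigma> + 4 * sqrt (\<sigma> - 1 / 2))) \<le> e * M * 7"
        using e M0 by (intro mult_left_mono) auto
      then show ?thesis by (simp only: right_diff_distrib)
    qed
    finally have 1: "norm (\<Psi> (Complex 2 y) - \<Psi> (Complex \<sigma> y)) \<le> e * M * 7" .
    \<comment> \<open>From abscissa \<open>2\<close> on the decay rate \<open>5 / h\<close> of the tail beats the growth rate \<open>4 / h\<close> of the kernel.\<close>
    have right: "norm (\<Phi> (Complex a y)) \<le> Z * e" if a: "a \<in> {2..Y}" for a
    proof -
      have "norm (\<Phi> (Complex a y)) \<le> (C * exp (4 * (a - \<sigma>) / h) * (h / U)\<^sup>2) * (Z * exp (5 * (2 - a) / h))"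
        unfolding \<Phi>_def norm_mult using a \<sigma> y C by (intro mult_mono k_hor F_right) auto
      also have "\<dots> = C * Z * (h / U)\<^sup>2 * exp (4 * (a - \<sigma>) / h + 5 * (2 - a) / h)"
        by (simp add: exp_add)
      also have "4 * (a - \<sigma>) / h + 5 * (2 - a) / h = (10 - a - 4 * \<sigma>) / h"
        by (simp add: add_divide_distrib[symmetric])
      also have "C * Z * (h / U)\<^sup>2 * exp ((10 - a - 4 * \<sigma>) / h) \<le> C * Z * (h / U)\<^sup>2 * exp (6 / h)"
      proof (rule mult_left_mono)
        show "exp ((10 - a - 4 * \<sigma>) / h) \<le> exp (6 / h)"
          using a \<sigma> h by (simp add: divide_right_mono)
      qed (use C Z in auto)
      finally show ?thesis by (simp add: e_def mult_ac)
    qed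
    have "norm (\<Psi> (Complex Y y) - \<Psi> (Complex 2 y)) \<le> Z * e * Y - Z * e * 2"
    proof (rule norm_diff_le_if_derivative_le[where f' = "\<lambda>a. \<Phi> (Complex a y)" and \<phi>' = "\<lambda>_. Z * e"])
      fix a assume a: "a \<in> {2..Y}"
      show "((\<lambda>a. \<Psi> (Complex a y)) has_vector_derivative \<Phi> (Complex a y)) (at a)"
        by (rule hor) (use a y in auto)
      show "((\<lambda>a. Z * e * a) has_real_derivative Z * e) (at a)"
        by (auto intro!: derivative_eq_intros)
    qed (use U right in \<open>auto simp: Y_def\<close>)
    also have "\<dots> = (6 + U) * (Z * e)" by (simp add: Y_def algebra_simps)
    finally have 2: "norm (\<Psi> (Complex Y y) - \<Psi> (Complex 2 y)) \<le> (6 + U) * (Z * e)" .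
    have "norm (\<Psi> (Complex Y y) - \<Psi> (Complex \<sigma> y))
        \<le> norm (\<Psi> (Complex 2 y) - \<Psi> (Complex \<sigma> y)) + norm (\<Psi> (Complex Y y) - \<Psi> (Complex 2 y))"
      using norm_triangle_ineq[of "\<Psi> (Complex 2 y) - \<Psi> (Complex \<sigma> y)" "\<Psi> (Complex Y y) - \<Psi> (Complex 2 y)"] by simp
    also have "\<dots> \<le> e * M * 7 + (6 + U) * (Z * e)" by (rule add_mono[OF 1 2])
    finally show ?thesis unfolding M_def by (simp only: mult_ac)
  qed
  have vertical: "norm (\<Psi> (Complex Y (t - U)) - \<Psi> (Complex Y (t - (- U)))) \<le> 2 * U * (C * Z * exp (- U))"
  proof -
    have "norm (\<Psi> (Complex Y (t - U)) - \<Psi> (Complex Y (t - (- U))))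
        \<le> C * Z * exp (- U) * U - C * Z * exp (- U) * (- U)"
    proof (rule norm_diff_le_if_derivative_le[where f' = "\<lambda>u. - \<i> * \<Phi> (Complex Y (t - u))"
          and \<phi>' = "\<lambda>_. C * Z * exp (- U)"])
      fix u assume u: "u \<in> {- U..U}"
      show "((\<lambda>u. \<Psi> (Complex Y (t - u))) has_vector_derivative - \<i> * \<Phi> (Complex Y (t - u))) (at u)"
        by (rule ver) (use u U in \<open>auto simp: Y_def\<close>)
      show "((\<lambda>u. C * Z * exp (- U) * u) has_real_derivative C * Z * exp (- U)) (at u)"
        by (auto intro!: derivative_eq_intros)
      let ?z = "zz (Complex Y (t - u))"
      have "norm (k ?z) \<le> C * exp (4 * \<bar>Im ?z\<bar>) / (1 + norm ?z)\<^sup>2" by (rule kb)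
      also have "\<dots> \<le> C * exp (4 * \<bar>Im ?z\<bar>) / 1"
        using C one_plus_norm_pos[of ?z] by (intro divide_left_mono one_le_power) (auto intro!: zero_less_power)
      also have "\<bar>Im ?z\<bar> = (Y - \<sigma>) / h" unfolding zz using \<sigma> h U by (simp add: Y_def)
      finally have "norm (k ?z) \<le> C * exp (4 * ((Y - \<sigma>) / h))" by simp
      then have "norm (\<Phi> (Complex Y (t - u))) \<le> (C * exp (4 * ((Y - \<sigma>) / h))) * (Z * exp (5 * (2 - Y) / h))"
        unfolding \<Phi>_def norm_mult using C U u by (intro mult_mono F_right) (auto simp: Y_def)
      also have "\<dots> = C * Z * exp (4 * ((Y - \<sigma>) / h) + 5 * (2 - Y) / h)" by (simp add: exp_add)
      also have "4 * ((Y - \<sigma>) / h) + 5 * (2 - Y) / h = (10 - Y - 4 * \<sigma>) / h"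
        by (simp add: add_divide_distrib[symmetric])
      also have "(10 - Y - 4 * \<sigma>) / h \<le> - U"
      proof -
        have "10 - Y - 4 * \<sigma> \<le> - U" using \<sigma> by (simp add: Y_def)
        also have "\<dots> \<le> - U * h" using U h mult_left_mono[of h 1 U] by simp
        finally show ?thesis using h by (simp add: pos_divide_le_eq)
      qed
      finally show "norm (- \<i> * \<Phi> (Complex Y (t - u))) \<le> C * Z * exp (- U)"
        using C Z by (simp add: norm_mult mult_left_mono)
    qed (use U in auto)
    then show ?thesis by (simp add: algebra_simps)
  qed
  have zz_line: "zz (Complex \<sigma> (t - u)) = of_real (u / h)" for u
    by (simp add: complex_eq_iff zz)
  have "((\<lambda>u. - \<i> * \<Phi> (Complex \<sigma> (t - u))) has_integral
      (\<Psi> (Complex \<sigma> (t - U)) - \<Psi> (Complex \<sigma> (t - (- U))))) {- U..U}"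
  proof (rule fundamental_theorem_of_calculus)
    fix u assume u: "u \<in> {- U..U}"
    show "((\<lambda>u. \<Psi> (Complex \<sigma> (t - u))) has_vector_derivative - \<i> * \<Phi> (Complex \<sigma> (t - u))) (at u within {- U..U})"
      by (rule has_vector_derivative_at_within[OF ver]) (use u U \<sigma> in auto)
  qed (use U in auto)
  from has_integral_mult_right[OF this, of \<i>]
  have "((\<lambda>u. k (of_real (u / h)) * F (Complex \<sigma> (t - u))) has_integral
      (\<i> * (\<Psi> (Complex \<sigma> (t - U)) - \<Psi> (Complex \<sigma> (t - (- U)))))) {- U..U}"
    by (simp add: \<Phi>_def zz_line mult.assoc[symmetric])
  then have "integral {- U..U} (\<lambda>u. k (of_real (u / h)) * F (Complex \<sigma> (t - u)))
      = \<i> * (\<Psi> (Complex \<sigma> (t - U)) - \<Psi> (Complex \<sigma> (t - (- U))))"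
    by (rule integral_unique)
  also have "norm \<dots> \<le> norm (\<Psi> (Complex Y (t - U)) - \<Psi> (Complex Y (t - (- U))))
      + norm (\<Psi> (Complex Y (t - U)) - \<Psi> (Complex \<sigma> (t - U)))
      + norm (\<Psi> (Complex Y (t - (- U))) - \<Psi> (Complex \<sigma> (t - (- U))))"
  proof -
    have "norm (a - b) \<le> norm (c - d) + norm (c - a) + norm (d - b)" for a b c d :: complex
    proof -
      have "a - b = (c - d) - (c - a) + (d - b)" by simp
      then have "norm (a - b) = norm ((c - d) - (c - a) + (d - b))" by (rule arg_cong)
      also have "\<dots> \<le> norm ((c - d) - (c - a)) + norm (d - b)" by (rule norm_triangle_ineq)
      also have "norm ((c - d) - (c - a)) \<le> norm (c - d) + norm (c - a)" by (rule norm_triangle_ineq4)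
      finally show ?thesis by simp
    qed
    then show ?thesis by (simp only: norm_mult norm_ii mult_1)
  qed
  also have "\<dots> \<le> 2 * U * (C * Z * exp (- U))
      + (7 * (e * (A * ln (t + U) + 8 * exp (5 / h))) + (6 + U) * (Z * e))
      + (7 * (e * (A * ln (t + U) + 8 * exp (5 / h))) + (6 + U) * (Z * e))"
    by (intro add_mono vertical horizontal) (use U in auto)
  also have "\<dots> = 14 * (e * (A * ln (t + U) + 8 * exp (5 / h))) + 2 * (6 + U) * (Z * e) + 2 * U * (C * Z * exp (- U))"
    by (simp add: algebra_simps)
  finally show ?thesis unfolding F_def e_def by (simp only: mult_ac)
qed

end

section \<open>Pointwise approximation by Dirichlet polynomials\<close>

text \<open>The properties of a majorant's derivative that survive the reflection \<open>z \<mapsto> - z\<close>.\<close>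

locale kernel =
  fixes k :: "complex \<Rightarrow> complex" and C :: real
  assumes holomorphic: "k holomorphic_on UNIV" and Im_k: "Im (k (of_real x)) = 0"
    and norm_k_le: "norm (k z) \<le> C * exp (4 * \<bar>Im z\<bar>) / (1 + norm z)\<^sup>2"
begin

lemma C_nonneg: "C \<ge> 0"
proof -
  have "0 \<le> norm (k 0)" by simp
  also have "\<dots> \<le> C" using norm_k_le[of 0] by simp
  finally show ?thesis .
qed

lemma k_continuous_on: "continuous_on A (\<lambda>u. k (of_real (u / h)))"
proof -
  have "continuous_on UNIV k" by (rule holomorphic_on_imp_continuous_on[OF holomorphic])
  then show ?thesis
    by (rule continuous_on_compose2)
       (auto intro!: continuous_intros simp: divide_inverse)
qed

lemma Re_k_continuous_on: "continuous_on A (\<lambda>x. Re (k (of_real x)))"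
  using k_continuous_on[of A 1] by (auto intro!: continuous_intros)

lemma norm_average_le:
  assumes h: "h > 0" and U: "U > 0" and f: "continuous_on {- U..U} f"
    and B: "\<And>u. u \<in> {- U..U} \<Longrightarrow> norm (f u) \<le> B"
  shows "norm (integral {- U..U} (\<lambda>u. k (of_real (u / h)) * f u)) \<le> 2 * C * h * B"
proof -
  have B0: "B \<ge> 0" using B[of 0] U norm_ge_zero[of "f 0"] by (smt (verit) atLeastAtMost_iff)
  have CB: "C * B \<ge> 0" using C_nonneg B0 by simp
  have "norm (integral {- U..U} (\<lambda>u. k (of_real (u / h)) * f u))
      \<le> integral {- U..U} (\<lambda>u. C * B / (1 + \<bar>u / h\<bar>)\<^sup>2)"
  proof (rule Henstock_Kurzweil_Integration.integral_norm_bound_integral)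
    show "(\<lambda>u. k (of_real (u / h)) * f u) integrable_on {- U..U}"
      by (intro integrable_continuous_interval continuous_intros k_continuous_on f)
    show "(\<lambda>u. C * B / (1 + \<bar>u / h\<bar>)\<^sup>2) integrable_on {- U..U}"
      by (rule integral_quadratic_decay_le(1)[OF h U CB])
    fix u assume u: "u \<in> {- U..U}"
    have "norm (k (of_real (u / h))) \<le> C / (1 + \<bar>u / h\<bar>)\<^sup>2"
      using norm_k_le[of "of_real (u / h)"] by (simp only: Im_complex_of_real norm_of_real) simp
    then have "norm (k (of_real (u / h)) * f u) \<le> C / (1 + \<bar>u / h\<bar>)\<^sup>2 * B"
      unfolding norm_mult using C_nonneg B[OF u] by (intro mult_mono divide_nonneg_nonneg) auto
    then show "norm (k (of_real (u / h)) * f u) \<le> C * B / (1 + \<bar>u / h\<bar>)\<^sup>2" by simp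
  qed
  also have "\<dots> \<le> 2 * (C * B) * h" by (rule integral_quadratic_decay_le(2)[OF h U CB])
  finally show ?thesis by (simp only: mult_ac)
qed

text \<open>The factor that averaging puts on the frequency \<open>w\<close>.\<close>

definition mass :: "real \<Rightarrow> real \<Rightarrow> real \<Rightarrow> complex" where
  "mass h U w = integral {- U..U} (\<lambda>u. k (of_real (u / h)) * cis (w * u)) / of_real h"

lemma norm_mass_le:
  assumes h: "h > 0" and U: "U > 0"
  shows "norm (mass h U w) \<le> 2 * C"
proof -
  have "norm (integral {- U..U} (\<lambda>u. k (of_real (u / h)) * cis (w * u))) \<le> 2 * C * h * 1"
    by (intro norm_average_le h U continuous_intros) auto
  then show ?thesis using h by (simp add: mass_def norm_divide pos_divide_le_eq)
qed

end

lemma kernel_reflect: "kernel k C \<Longrightarrow> kernel (\<lambda>z. k (- z)) C"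
proof -
  assume "kernel k C"
  then interpret kernel k C .
  show ?thesis
  proof
    have "(k \<circ> uminus) holomorphic_on UNIV"
      by (rule holomorphic_on_compose_gen[OF _ holomorphic]) (auto intro!: holomorphic_intros)
    then show "(\<lambda>z. k (- z)) holomorphic_on UNIV" by (simp add: o_def)
    show "Im (k (- of_real x)) = 0" for x using Im_k[of "- x"] by simp
    show "norm (k (- z)) \<le> C * exp (4 * \<bar>Im z\<bar>) / (1 + norm z)\<^sup>2" for z
      using norm_k_le[of "- z"] by simp
  qed
qed

context grh_character
begin

definition prime_sum :: "nat \<Rightarrow> (nat \<Rightarrow> complex) \<Rightarrow> complex \<Rightarrow> complex" where
  "prime_sum N c s = (\<Sum>p | prime p \<and> p < N. c p * dterm s p)"

definition prime_square_sum :: "nat \<Rightarrow> (nat \<Rightarrow> complex) \<Rightarrow> complex \<Rightarrow> complex" where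
  "prime_square_sum N c s = (\<Sum>p | prime p \<and> p < N. c p * dterm s p ^ 2)"

text \<open>A vertical shift multiplies the term of \<open>p\<close> by a pure oscillation of frequency \<open>ln p\<close>.\<close>

lemma dterm_shift:
  assumes "p > 0"
  shows "dterm (Complex \<sigma> (t - u)) p = dterm (Complex \<sigma> t) p * cis (ln (real p) * u)"
proof -
  have p: "complex_of_nat p \<noteq> 0" using assms by simp
  have ln: "ln (complex_of_nat p) = of_real (ln (real p))"
    using assms Ln_of_real[of "real p"] by simp
  have "Complex \<sigma> t = Complex \<sigma> (t - u) + \<i> * of_real u" by (simp add: complex_eq_iff)
  then have "complex_of_nat p powr Complex \<sigma> t = of_nat p powr Complex \<sigma> (t - u) * of_nat p powr (\<i> * of_real u)"
    by (simp only: powr_add)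
  also have "complex_of_nat p powr (\<i> * of_real u) = cis (ln (real p) * u)"
    using p by (simp add: powr_def ln cis_conv_exp mult_ac)
  finally show ?thesis using p by (simp add: dterm_def)
qed

text \<open>In \<open>- ln (1 - z) = z + z\<^sup>2 / 2 + O(\<bar>z\<bar>\<^sup>3)\<close> with \<open>z\<close> the term of \<open>p\<close>, the cubes have a convergent sum
  up to the line \<open>Re s = 1 / 2\<close>, while averaging multiplies the coefficients of the first
  two parts by the bounded factors \<open>mass\<close>.\<close>

lemma norm_average_log_partial_le:
  assumes "kernel k C" and h: "h > 0" and U: "U > 0" and \<sigma>: "\<sigma> \<ge> 1 / 2"
  defines "c1 \<equiv> \<lambda>p. kernel.mass k h U (ln (real p))" and "c2 \<equiv> \<lambda>p. kernel.mass k h U (2 * ln (real p))"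
  shows "norm (integral {- U..U} (\<lambda>u. k (of_real (u / h)) * log_partial N (Complex \<sigma> (t - u))))
      \<le> h * (norm (prime_sum N c1 (Complex \<sigma> t)) + norm (prime_square_sum N c2 (Complex \<sigma> t))
             + 8 * C * (\<Sum>n. real n powr (- (3 / 2))))"
proof -
  interpret kernel k C by fact
  let ?S = "{p. prime p \<and> p < N}"
  have fin: "finite ?S" by (rule finite_subset[of _ "{..<N}"]) auto
  define d where "d = (\<lambda>p. dterm (Complex \<sigma> t) p)"
  have p0: "p > 0" if "p \<in> ?S" for p using that prime_gt_0_nat by auto
  define f1 where "f1 = (\<lambda>u. \<Sum>p\<in>?S. d p * cis (ln (real p) * u))"
  define f2 where "f2 = (\<lambda>u. \<Sum>p\<in>?S. d p ^ 2 / 2 * cis (2 * ln (real p) * u))"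
  define R where "R = (\<lambda>u. log_partial N (Complex \<sigma> (t - u)) - f1 u - f2 u)"
  have nd: "norm (d p) \<le> 3 / 4" "norm (d p) \<le> real p powr (- (1 / 2))" if "p \<in> ?S" for p
  proof -
    show "norm (d p) \<le> 3 / 4" unfolding d_def using that \<sigma> by (intro norm_dterm_prime_le) auto
    have "norm (d p) \<le> real p powr (- \<sigma>)" unfolding d_def using norm_dterm_le[of "Complex \<sigma> t" p] by simp
    also have "\<dots> \<le> real p powr (- (1 / 2))" using p0[OF that] \<sigma> by (intro powr_mono) auto
    finally show "norm (d p) \<le> real p powr (- (1 / 2))" .
  qed
  have part: "log_partial N (Complex \<sigma> (t - u)) = (\<Sum>p\<in>?S. - ln (1 - d p * cis (ln (real p) * u)))" for u
  proof -
    have "log_partial N (Complex \<sigma> (t - u)) = (\<Sum>p\<in>?S. log_factor (Complex \<sigma> (t - u)) p)"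
      unfolding log_partial_def by (rule sum.mono_neutral_right) (auto simp: log_factor_def)
    also have "\<dots> = (\<Sum>p\<in>?S. - ln (1 - d p * cis (ln (real p) * u)))"
      using p0 by (intro sum.cong) (auto simp: log_factor_def dterm_shift d_def)
    finally show ?thesis .
  qed
  have R_eq: "R u = (\<Sum>p\<in>?S. - ln (1 - d p * cis (ln (real p) * u)) - d p * cis (ln (real p) * u)
                 - (d p * cis (ln (real p) * u))\<^sup>2 / 2)" for u
  proof -
    have "(d p * cis (ln (real p) * u))\<^sup>2 / 2 = d p ^ 2 / 2 * cis (2 * ln (real p) * u)" for p
    proof -
      have "(cis (ln (real p) * u))\<^sup>2 = cis (2 * ln (real p) * u)"
        unfolding power2_eq_square cis_mult by (rule arg_cong[of _ _ cis]) simp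
      then show ?thesis by (simp only: power_mult_distrib times_divide_eq_left)
    qed
    then show ?thesis by (simp only: R_def part f1_def f2_def sum_subtractf)
  qed
  have sm: "summable (\<lambda>n. real n powr (- (3 / 2)))" by (simp add: summable_real_powr_iff)
  have R_le: "norm (R u) \<le> 4 * (\<Sum>n. real n powr (- (3 / 2)))" for u
  proof -
    have "norm (R u) \<le> (\<Sum>p\<in>?S. 4 * real p powr (- (3 / 2)))"
      unfolding R_eq
    proof (rule sum_norm_le)
      fix p assume p: "p \<in> ?S"
      let ?z = "d p * cis (ln (real p) * u)"
      have nz: "norm ?z = norm (d p)" by (simp add: norm_mult)
      have "norm (- ln (1 - ?z) - ?z - ?z\<^sup>2 / 2) \<le> 4 * norm ?z ^ 3"
        by (rule norm_ln_1_minus_remainder_le) (use nd(1)[OF p] nz in simp)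
      also have "\<dots> \<le> 4 * (real p powr (- (1 / 2))) ^ 3"
        unfolding nz using nd(2)[OF p] by (intro mult_left_mono power_mono) auto
      also have "(real p powr (- (1 / 2))) ^ 3 = real p powr (- (3 / 2))"
        using p0[OF p] by (simp add: powr_power)
      finally show "norm (- ln (1 - ?z) - ?z - ?z\<^sup>2 / 2) \<le> 4 * real p powr (- (3 / 2))" .
    qed
    also have "\<dots> = 4 * (\<Sum>p\<in>?S. real p powr (- (3 / 2)))" by (simp add: sum_distrib_left)
    also have "\<dots> \<le> 4 * (\<Sum>n. real n powr (- (3 / 2)))"
      by (intro mult_left_mono sum_le_suminf sm fin) auto
    finally show ?thesis .
  qed
  have cont1: "continuous_on A f1" "continuous_on A f2" for A
    unfolding f1_def f2_def by (intro continuous_intros)+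
  have "continuous_on {- U..U} (\<lambda>u. \<Sum>p\<in>?S. - ln (1 - d p * cis (ln (real p) * u)))"
  proof (intro continuous_intros)
    fix p u assume p: "p \<in> ?S"
    have "Re (d p * cis (ln (real p) * u)) \<le> norm (d p * cis (ln (real p) * u))" by (rule complex_Re_le_cmod)
    also have "\<dots> \<le> 3 / 4" using nd(1)[OF p] by (simp add: norm_mult)
    finally show "1 - d p * cis (ln (real p) * u) \<notin> \<real>\<^sub>\<le>\<^sub>0"
      by (simp add: complex_nonpos_Reals_iff)
  qed
  then have "continuous_on {- U..U} (\<lambda>u. log_partial N (Complex \<sigma> (t - u)))" by (simp only: part)
  then have contR: "continuous_on {- U..U} R"
    unfolding R_def by (intro continuous_on_diff cont1)
  define K where "K = (\<lambda>u. k (of_real (u / h)))"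
  define I where "I = (\<lambda>f. integral {- U..U} (\<lambda>u. K u * f u))"
  have K_cont: "continuous_on {- U..U} K" unfolding K_def by (rule k_continuous_on)
  have int: "(\<lambda>u. K u * f u) integrable_on {- U..U}" if "continuous_on {- U..U} f" for f
    by (intro integrable_continuous_interval continuous_on_mult K_cont that)
  have cis_int: "I (\<lambda>u. c * cis (w * u)) = of_real h * (c * mass h U w)" for c w
  proof -
    have "I (\<lambda>u. c * cis (w * u)) = integral {- U..U} (\<lambda>u. c * (K u * cis (w * u)))"
      unfolding I_def by (simp only: mult.left_commute)
    also have "\<dots> = c * integral {- U..U} (\<lambda>u. K u * cis (w * u))"
      by (rule Henstock_Kurzweil_Integration.integral_mult_right)
    also have "integral {- U..U} (\<lambda>u. K u * cis (w * u)) = of_real h * mass h U w"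
      unfolding mass_def K_def using h by simp
    finally show ?thesis by (simp only: mult.left_commute)
  qed
  have cis_cont: "continuous_on {- U..U} (\<lambda>u. c * cis (w * u))" for c w
    by (intro continuous_intros)
  have I_sum: "I (\<lambda>u. \<Sum>p\<in>?S. c p * cis (w p * u)) = of_real h * (\<Sum>p\<in>?S. c p * mass h U (w p))" for c w
  proof -
    have "I (\<lambda>u. \<Sum>p\<in>?S. c p * cis (w p * u)) = (\<Sum>p\<in>?S. I (\<lambda>u. c p * cis (w p * u)))"
      unfolding I_def sum_distrib_left
      by (rule Henstock_Kurzweil_Integration.integral_sum[OF fin int[OF cis_cont]])
    then show ?thesis by (simp only: cis_int sum_distrib_left)
  qed
  have I1: "I f1 = of_real h * prime_sum N c1 (Complex \<sigma> t)"
    unfolding f1_def I_sum prime_sum_def c1_def d_def by (simp only: mult.commute)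
  have I2: "I f2 = of_real h * (prime_square_sum N c2 (Complex \<sigma> t) / 2)"
    unfolding f2_def I_sum prime_square_sum_def c2_def d_def sum_divide_distrib
    by (simp only: mult.commute times_divide_eq_right)
  have "log_partial N (Complex \<sigma> (t - u)) = f1 u + f2 u + R u" for u
    by (simp add: R_def)
  then have "integral {- U..U} (\<lambda>u. k (of_real (u / h)) * log_partial N (Complex \<sigma> (t - u))) = I (\<lambda>u. f1 u + f2 u + R u)"
    by (simp only: I_def K_def)
  also have "\<dots> = I f1 + I f2 + I R"
    unfolding I_def distrib_left
    by (subst Henstock_Kurzweil_Integration.integral_add, intro Henstock_Kurzweil_Integration.integrable_add int cont1,
        rule int[OF contR], subst Henstock_Kurzweil_Integration.integral_add, (rule int[OF cont1(1)] int[OF cont1(2)] refl)+)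
  also have "norm \<dots> \<le> norm (I f1) + norm (I f2) + norm (I R)"
    by (intro order_trans[OF norm_triangle_ineq] add_right_mono norm_triangle_ineq)
  also have "\<dots> \<le> h * norm (prime_sum N c1 (Complex \<sigma> t)) + h * norm (prime_square_sum N c2 (Complex \<sigma> t))
      + 2 * C * h * (4 * (\<Sum>n. real n powr (- (3 / 2))))"
  proof (intro add_mono)
    show "norm (I f1) \<le> h * norm (prime_sum N c1 (Complex \<sigma> t))"
      unfolding I1 using h by (simp add: norm_mult)
    show "norm (I f2) \<le> h * norm (prime_square_sum N c2 (Complex \<sigma> t))"
      unfolding I2 using h by (simp add: norm_mult norm_divide)
    show "norm (I R) \<le> 2 * C * h * (4 * (\<Sum>n. real n powr (- (3 / 2))))"
      unfolding I_def K_def by (rule norm_average_le[OF h U contR R_le])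
  qed
  finally show ?thesis by (simp add: algebra_simps)
qed

text \<open>The bound of \<open>contour_shift\<close>.\<close>

definition contour_error :: "real \<Rightarrow> real \<Rightarrow> real \<Rightarrow> real \<Rightarrow> real \<Rightarrow> real" where
  "contour_error A C h U t =
     14 * (C * exp (6 / h) * (h / U)\<^sup>2 * (A * ln (t + U) + 8 * exp (5 / h)))
       + 2 * (6 + U) * (C * (4 * (\<Sum>n. real n powr (- 2))) * exp (6 / h) * (h / U)\<^sup>2)
       + 2 * U * (C * (4 * (\<Sum>n. real n powr (- 2))) * exp (- U))"

text \<open>The kernel is real on the real line, so averaging commutes with taking the argument.\<close>

lemma abs_average_Im_log_L_le:
  assumes "kernel k C"
    and lb: "\<And>\<sigma> y. 1 / 2 < \<sigma> \<Longrightarrow> \<sigma> \<le> 2 \<Longrightarrow> 3 \<le> y \<Longrightarrow>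
                 norm (log_L (Complex \<sigma> y)) \<le> A * ln y * (1 + \<bar>ln (\<sigma> - 1 / 2)\<bar>)" and A: "A \<ge> 1"
    and \<sigma>: "1 / 2 < \<sigma>" "\<sigma> \<le> 1" and h: "0 < h" "h \<le> 1" and U: "U > 0" "t - U \<ge> 3"
    and N: "exp (5 / h) \<le> real N" "real N \<le> 2 * exp (5 / h)"
  defines "c1 \<equiv> \<lambda>p. kernel.mass k h U (ln (real p))" and "c2 \<equiv> \<lambda>p. kernel.mass k h U (2 * ln (real p))"
  shows "\<bar>integral {- U..U} (\<lambda>u. Re (k (of_real (u / h))) / h * Im (log_L (Complex \<sigma> (t - u))))\<bar>
      \<le> norm (prime_sum N c1 (Complex \<sigma> t)) + norm (prime_square_sum N c2 (Complex \<sigma> t))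
        + 8 * C * (\<Sum>n. real n powr (- (3 / 2))) + contour_error A C h U t / h"
proof -
  interpret kernel k C by fact
  define l where "l = (\<lambda>u. log_L (Complex \<sigma> (t - u)))"
  define P where "P = (\<lambda>u. log_partial N (Complex \<sigma> (t - u)))"
  define K where "K = (\<lambda>u. k (of_real (u / h)))"
  have path: "continuous_on {- U..U} (\<lambda>u. Complex \<sigma> (t - u))" "(\<lambda>u. Complex \<sigma> (t - u)) ` {- U..U} \<subseteq> quadrant"
    using U \<sigma> by (auto simp: Complex_eq quadrant_def intro!: continuous_intros)
  have cl: "continuous_on {- U..U} l" unfolding l_def
    by (rule continuous_on_compose2[OF holomorphic_on_imp_continuous_on[OF log_L_holomorphic] path])
  have cP: "continuous_on {- U..U} P" unfolding P_def
    by (rule continuous_on_compose2[OF holomorphic_on_imp_continuous_on[OF log_partial_holomorphic] path])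
  have K_cont: "continuous_on {- U..U} K" unfolding K_def by (rule k_continuous_on)
  have int: "(\<lambda>u. K u * f u) integrable_on {- U..U}" if "continuous_on {- U..U} f" for f
    by (intro integrable_continuous_interval continuous_on_mult K_cont that)
  define I where "I = integral {- U..U} (\<lambda>u. K u * l u)"
  have 1: "((\<lambda>u. Im (K u * l u)) has_integral Im I) {- U..U}"
    unfolding I_def by (rule has_integral_Im[OF integrable_integral[OF int[OF cl]]])
  have 2: "Im (K u * l u) = Re (K u) * Im (l u)" for u
  proof -
    have "Im (K u) = 0" unfolding K_def by (rule Im_k)
    then show ?thesis by simp
  qed
  have eq: "integral {- U..U} (\<lambda>u. Re (k (of_real (u / h))) / h * Im (log_L (Complex \<sigma> (t - u)))) = Im I / h"
  proof -
    have "((\<lambda>u. Re (K u) * Im (l u) / h) has_integral Im I / h) {- U..U}"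
      by (rule has_integral_divide) (use 1 in \<open>simp only: 2\<close>)
    then have "((\<lambda>u. Re (K u) / h * Im (l u)) has_integral Im I / h) {- U..U}"
      by (simp only: times_divide_eq_left)
    then show ?thesis unfolding K_def l_def by (rule integral_unique)
  qed
  have "I = integral {- U..U} (\<lambda>u. K u * (l u - P u) + K u * P u)"
    unfolding I_def by (simp only: distrib_left[symmetric] diff_add_cancel)
  also have "\<dots> = integral {- U..U} (\<lambda>u. K u * (l u - P u)) + integral {- U..U} (\<lambda>u. K u * P u)"
    by (intro Henstock_Kurzweil_Integration.integral_add int continuous_on_diff cl cP)
  also have "norm \<dots> \<le> norm (integral {- U..U} (\<lambda>u. K u * (l u - P u))) + norm (integral {- U..U} (\<lambda>u. K u * P u))"
    by (rule norm_triangle_ineq)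
  also have "\<dots> \<le> contour_error A C h U t + h * (norm (prime_sum N c1 (Complex \<sigma> t)) + norm (prime_square_sum N c2 (Complex \<sigma> t))
             + 8 * C * (\<Sum>n. real n powr (- (3 / 2))))"
  proof (rule add_mono)
    show "norm (integral {- U..U} (\<lambda>u. K u * (l u - P u))) \<le> contour_error A C h U t"
      unfolding contour_error_def K_def l_def P_def by (rule contour_shift[OF lb A holomorphic norm_k_le \<sigma> h U N])
    show "norm (integral {- U..U} (\<lambda>u. K u * P u)) \<le> h * (norm (prime_sum N c1 (Complex \<sigma> t)) + norm (prime_square_sum N c2 (Complex \<sigma> t))
             + 8 * C * (\<Sum>n. real n powr (- (3 / 2))))"
      unfolding c1_def c2_def K_def P_def by (rule norm_average_log_partial_le[OF assms(1) h(1) U(1)]) (use \<sigma> in simp)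
  qed
  finally have "\<bar>Im I\<bar> \<le> contour_error A C h U t + h * (norm (prime_sum N c1 (Complex \<sigma> t)) + norm (prime_square_sum N c2 (Complex \<sigma> t))
             + 8 * C * (\<Sum>n. real n powr (- (3 / 2))))"
    by (rule order_trans[OF abs_Im_le_cmod])
  then have "\<bar>Im I\<bar> / h \<le> (contour_error A C h U t + h * (norm (prime_sum N c1 (Complex \<sigma> t)) + norm (prime_square_sum N c2 (Complex \<sigma> t))
             + 8 * C * (\<Sum>n. real n powr (- (3 / 2))))) / h"
    using h by (intro divide_right_mono) auto
  then show ?thesis unfolding eq using h by (simp add: add_divide_distrib)
qed

end

context grh_character
begin

definition approximant :: "(complex \<Rightarrow> complex) \<Rightarrow> nat \<Rightarrow> real \<Rightarrow> real \<Rightarrow> complex \<Rightarrow> real" where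
  "approximant k N h U s =
     norm (prime_sum N (\<lambda>p. kernel.mass k h U (ln (real p))) s)
       + norm (prime_square_sum N (\<lambda>p. kernel.mass k h U (2 * ln (real p))) s)"

lemma Im_log_L_has_derivative:
  assumes "\<sigma> > 1 / 2" "y > 0"
  shows "((\<lambda>y. Im (log_L (Complex \<sigma> y))) has_real_derivative Re (deriv log_L (Complex \<sigma> y))) (at y)"
proof -
  have q: "Complex \<sigma> y \<in> quadrant" using assms by (auto simp: quadrant_def)
  have "((\<lambda>y. Complex \<sigma> y) has_vector_derivative \<i>) (at y)"
    unfolding Complex_eq by (auto intro!: derivative_eq_intros)
  from field_vector_diff_chain_at[OF this holomorphic_derivI[OF log_L_holomorphic quadrant(1) q]]
  have "((\<lambda>y. log_L (Complex \<sigma> y)) has_vector_derivative \<i> * deriv log_L (Complex \<sigma> y)) (at y)"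
    by (simp add: o_def)
  from bounded_linear.has_vector_derivative[OF bounded_linear_Im this]
  show ?thesis by (simp add: has_real_derivative_iff_has_vector_derivative)
qed

text \<open>Smoothing from above applied to the argument and to its reflection in \<open>t\<close> bounds the
  argument from above and from below.\<close>

lemma abs_Im_log_L_le:
  fixes k :: "complex \<Rightarrow> complex" and G :: "real \<Rightarrow> real"
  assumes ker: "kernel k C"
    and G: "\<And>x. (G has_real_derivative Re (k (of_real x))) (at x)"
    and G0: "\<And>x. G x \<ge> 0" and G1: "\<And>x. x \<ge> 0 \<Longrightarrow> G x \<ge> 1"
    and Gl: "\<And>x. x \<le> 0 \<Longrightarrow> G x \<le> C / (1 + \<bar>x\<bar>)\<^sup>2"
    and Gr: "\<And>x. x \<ge> 0 \<Longrightarrow> G x \<le> 1 + C / (1 + \<bar>x\<bar>)\<^sup>2"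
    and A: "A \<ge> 1"
    and Im_b: "\<And>\<sigma> t. 1 / 2 < \<sigma> \<Longrightarrow> \<sigma> \<le> 2 \<Longrightarrow> 3 \<le> t \<Longrightarrow> \<bar>Im (log_L (Complex \<sigma> t))\<bar> \<le> A * ln t"
    and lb: "\<And>\<sigma> t. 1 / 2 < \<sigma> \<Longrightarrow> \<sigma> \<le> 2 \<Longrightarrow> 3 \<le> t \<Longrightarrow>
           norm (log_L (Complex \<sigma> t)) \<le> A * ln t * (1 + \<bar>ln (\<sigma> - 1 / 2)\<bar>)"
    and der: "\<And>\<sigma> t. 1 / 2 < \<sigma> \<Longrightarrow> \<sigma> \<le> 2 \<Longrightarrow> 3 \<le> t \<Longrightarrow> Re (deriv log_L (Complex \<sigma> t)) \<ge> - A * ln t"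
    and \<sigma>: "1 / 2 < \<sigma>" "\<sigma> \<le> 1" and h: "0 < h" "h \<le> 1" and U: "U > 0" "t - U \<ge> 3"
    and N: "exp (5 / h) \<le> real N" "real N \<le> 2 * exp (5 / h)"
  shows "\<bar>Im (log_L (Complex \<sigma> t))\<bar> \<le> approximant k N h U (Complex \<sigma> t) + approximant (\<lambda>z. k (- z)) N h U (Complex \<sigma> t)
      + (8 * C * (\<Sum>n. real n powr (- (3 / 2))) + contour_error A C h U t / h)
      + 2 * (A * ln (t + U)) * C * h + 2 * (A * ln (t + U)) * C / (1 + U / h)\<^sup>2"
proof -
  interpret kernel k C by fact
  define a where "a = A * ln (t + U)"
  define E where "E = 8 * C * (\<Sum>n. real n powr (- (3 / 2))) + contour_error A C h U t / h"
  define S where "S = 2 * a * C * h + 2 * a * C / (1 + U / h)\<^sup>2"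
  let ?\<kappa> = "\<lambda>x. Re (k (of_real x))"
  let ?v = "\<lambda>y. Im (log_L (Complex \<sigma> y))"
  have a0: "a \<ge> 0" using A U by (simp add: a_def)
  have lny: "A * ln y \<le> a" if "y \<in> {t - U..t + U}" for y
    unfolding a_def using that U A by (intro mult_left_mono) auto
  have v': "Re (deriv log_L (Complex \<sigma> y)) \<ge> - a" if "y \<in> {t - U..t + U}" for y
    using der[of \<sigma> y] lny[OF that] that \<sigma> U by auto
  have v: "\<bar>?v y\<bar> \<le> a" if "y \<in> {t - U..t + U}" for y
    using Im_b[of \<sigma> y] lny[OF that] that \<sigma> U by auto
  have d: "(?v has_real_derivative Re (deriv log_L (Complex \<sigma> y))) (at y)" if "y \<in> {t - U..t + U}" for y
    by (rule Im_log_L_has_derivative) (use that \<sigma> U in auto)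
  have refl: "2 * t - y \<in> {t - U..t + U}" if "y \<in> {t - U..t + U}" for y using that by auto
  have "?v t \<le> integral {- U..U} (\<lambda>u. ?\<kappa> (u / h) / h * ?v (t - u)) + 2 * a * C * h + 2 * a * C / (1 + U / h)\<^sup>2"
    by (rule smoothing_upper_bound[OF G Re_k_continuous_on G0 G1 Gl Gr d v' v h(1) U(1) a0 C_nonneg])
  moreover have "\<bar>integral {- U..U} (\<lambda>u. ?\<kappa> (u / h) / h * ?v (t - u))\<bar> \<le> approximant k N h U (Complex \<sigma> t) + E"
    unfolding approximant_def E_def
    using abs_average_Im_log_L_le[OF ker lb A \<sigma> h U N] by (simp only: add.assoc)
  ultimately have up: "?v t \<le> approximant k N h U (Complex \<sigma> t) + E + S" unfolding S_def by linarith
  have d2: "((\<lambda>y. - ?v (2 * t - y)) has_real_derivative Re (deriv log_L (Complex \<sigma> (2 * t - y)))) (at y)"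
    if "y \<in> {t - U..t + U}" for y
  proof -
    have "((\<lambda>y. ?v (2 * t - y)) has_real_derivative Re (deriv log_L (Complex \<sigma> (2 * t - y))) * (- 1)) (at y)"
      by (rule DERIV_chain2[where f = ?v and g = "\<lambda>y. 2 * t - y", OF d[OF refl[OF that]]])
         (auto intro!: derivative_eq_intros)
    from DERIV_minus[OF this] show ?thesis by simp
  qed
  have l1: "- ?v (2 * t - t) \<le> integral {- U..U} (\<lambda>u. ?\<kappa> (u / h) / h * - ?v (2 * t - (t - u))) + 2 * a * C * h + 2 * a * C / (1 + U / h)\<^sup>2"
  proof (rule smoothing_upper_bound[OF G Re_k_continuous_on G0 G1 Gl Gr d2 _ _ h(1) U(1) a0 C_nonneg])
    show "Re (deriv log_L (Complex \<sigma> (2 * t - y))) \<ge> - a" "\<bar>- ?v (2 * t - y)\<bar> \<le> a" if "y \<in> {t - U..t + U}" for y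
      using v'[OF refl[OF that]] v[OF refl[OF that]] by simp_all
  qed
  have l2: "integral {- U..U} (\<lambda>u. ?\<kappa> (u / h) / h * - ?v (2 * t - (t - u)))
      = - integral {- U..U} (\<lambda>u. Re (k (- of_real (u / h))) / h * ?v (t - u))"
  proof -
    have "integral {- U..U} (\<lambda>u. ?\<kappa> (u / h) / h * - ?v (2 * t - (t - u)))
        = integral {- U..- (- U)} (\<lambda>u. (\<lambda>u. Re (k (- of_real (u / h))) / h * - ?v (t - u)) (- u))"
      by (simp add: algebra_simps)
    also have "\<dots> = integral {- U..U} (\<lambda>u. Re (k (- of_real (u / h))) / h * - ?v (t - u))"
      by (rule Henstock_Kurzweil_Integration.integral_reflect_real)
    also have "\<dots> = - integral {- U..U} (\<lambda>u. Re (k (- of_real (u / h))) / h * ?v (t - u))"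
      by (simp only: mult_minus_right Henstock_Kurzweil_Integration.integral_neg)
    finally show ?thesis .
  qed
  have l3: "\<bar>integral {- U..U} (\<lambda>u. Re (k (- of_real (u / h))) / h * ?v (t - u))\<bar>
      \<le> approximant (\<lambda>z. k (- z)) N h U (Complex \<sigma> t) + E"
    unfolding approximant_def E_def
    using abs_average_Im_log_L_le[OF kernel_reflect[OF ker] lb A \<sigma> h U N] by (simp only: add.assoc)
  have "2 * t - t = t" by simp
  then have l4: "- ?v t \<le> - integral {- U..U} (\<lambda>u. Re (k (- of_real (u / h))) / h * ?v (t - u)) + 2 * a * C * h + 2 * a * C / (1 + U / h)\<^sup>2"
    using l1 unfolding l2 by (simp only:)
  have low: "- ?v t \<le> approximant (\<lambda>z. k (- z)) N h U (Complex \<sigma> t) + E + S"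
    using l4 abs_le_D2[OF l3] unfolding S_def by linarith
  have "approximant k N h U (Complex \<sigma> t) \<ge> 0" "approximant (\<lambda>z. k (- z)) N h U (Complex \<sigma> t) \<ge> 0"
    unfolding approximant_def by (simp_all only: add_nonneg_nonneg norm_ge_zero)
  with up low show ?thesis unfolding S_def E_def a_def by linarith
qed

text \<open>With this \<open>h\<close> every \<open>exp (c / h)\<close> that occurs is at most \<open>T\<close>, so the two of them in the contour error
  are compensated by \<open>(h / U)\<^sup>2 \<le> 4 h / T\<^sup>2\<close>. The slope of order \<open>ln T\<close> times the scale
  \<open>h\<close> of the smoothing leaves the main error of order \<open>k\<close>.\<close>

lemma error_terms_le:
  fixes T :: real and k :: nat
  assumes A: "A \<ge> 1" and C: "C \<ge> 0" and k: "k \<ge> 1" and T: "40 * real k \<le> ln T" "T > 0" and t: "t \<in> {T..2 * T}"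
  defines "h \<equiv> 40 * real k / ln T" and "U \<equiv> T / 2" and "Z \<equiv> 4 * (\<Sum>n. real n powr (- 2))"
  shows "contour_error A C h U t / h \<le> 56 * C * (2 * A + 8) + 64 * (C * Z)"
    and "2 * (A * ln (t + U)) * C * h \<le> 160 * A * C * real k"
    and "2 * (A * ln (t + U)) * C / (1 + U / h)\<^sup>2 \<le> 16 * A * C"
proof -
  have lnT: "ln T \<ge> 40" using T k by linarith
  have TlnT: "ln T \<le> T - 1" using T(2) by (rule ln_le_minus_one)
  have T41: "T \<ge> 41" using lnT TlnT by linarith
  have h: "0 < h" "h \<le> 1"
  proof -
    show "0 < h" unfolding h_def using k lnT by (intro divide_pos_pos) auto
    show "h \<le> 1" unfolding h_def using T(1) lnT by (subst divide_le_eq_1_pos) auto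
  qed
  have h_low: "1 / T \<le> h"
  proof -
    have "1 / T \<le> 40 / ln T" using lnT TlnT T41 by (intro frac_le) auto
    also have "\<dots> \<le> h" unfolding h_def using k lnT by (intro divide_right_mono) auto
    finally show ?thesis .
  qed
  have Z: "Z \<ge> 0"
    unfolding Z_def by (intro mult_nonneg_nonneg suminf_nonneg) (auto simp: summable_real_powr_iff)
  have e: "exp (c / h) \<le> T" if "0 \<le> c" "c \<le> 40" for c
  proof -
    have "c / h = (c / 40) * ln T / real k" using lnT k by (simp add: h_def)
    also have "\<dots> \<le> (c / 40) * ln T / 1" using that lnT k by (intro divide_left_mono mult_nonneg_nonneg) auto
    also have "\<dots> \<le> 1 * ln T" using that lnT by (simp add: mult_right_mono)
    finally have "exp (c / h) \<le> exp (ln T)" by simp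
    then show ?thesis using T(2) by simp
  qed
  have lnU: "0 \<le> ln (t + U)" "ln (t + U) \<le> 2 * ln T" "ln (t + U) \<le> 2 * T"
  proof -
    show "0 \<le> ln (t + U)" using t T41 by (simp add: U_def)
    have "3 * T \<le> T * T" using T41 by (intro mult_right_mono) auto
    moreover have "t + U \<le> 3 * T" using t T41 by (auto simp: U_def)
    ultimately have "t + U \<le> T * T" by (rule order_trans[rotated])
    then have "ln (t + U) \<le> ln (T * T)" using t T41 by (subst ln_le_cancel_iff) (auto simp: U_def)
    also have "\<dots> = 2 * ln T" using T(2) by (simp add: ln_mult)
    finally show "ln (t + U) \<le> 2 * ln T" .
    then show "ln (t + U) \<le> 2 * T" using TlnT by linarith
  qed
  define r where "r = h * (4 / T\<^sup>2)"
  have r: "(h / U)\<^sup>2 \<le> r" "r \<ge> 0"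
  proof -
    have "(h / U)\<^sup>2 = h * h * (4 / T\<^sup>2)" by (simp add: U_def power_divide power2_eq_square)
    also have "\<dots> \<le> h * 1 * (4 / T\<^sup>2)" using h by (intro mult_right_mono mult_left_mono) auto
    finally show "(h / U)\<^sup>2 \<le> r" by (simp add: r_def)
    show "r \<ge> 0" using h by (simp add: r_def)
  qed
  have rT: "r * T * T = 4 * h" "r * T = 4 * h / T" using T(2) by (auto simp: r_def power2_eq_square)
  have t1: "14 * (C * exp (6 / h) * (h / U)\<^sup>2 * (A * ln (t + U) + 8 * exp (5 / h))) \<le> h * (56 * C * (2 * A + 8))"
  proof -
    have a: "A * ln (t + U) + 8 * exp (5 / h) \<le> A * (2 * T) + 8 * T"
      using A lnU e[of 5] by (intro add_mono mult_left_mono) auto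
    have b: "C * exp (6 / h) * (h / U)\<^sup>2 \<le> C * T * r"
      using C e[of 6] r T(2) by (intro mult_mono) auto
    have "C * exp (6 / h) * (h / U)\<^sup>2 * (A * ln (t + U) + 8 * exp (5 / h)) \<le> C * T * r * (A * (2 * T) + 8 * T)"
      by (rule mult_mono[OF b a]) (use C T(2) r A lnU in auto)
    also have "\<dots> = C * (r * T * T) * (2 * A + 8)" by (simp add: algebra_simps)
    finally have "14 * (C * exp (6 / h) * (h / U)\<^sup>2 * (A * ln (t + U) + 8 * exp (5 / h)))
        \<le> 14 * (C * (4 * h) * (2 * A + 8))"
      unfolding rT(1) by (rule mult_left_mono) auto
    also have "\<dots> = h * (56 * C * (2 * A + 8))" by (simp add: algebra_simps)
    finally show ?thesis .
  qed
  have t2: "2 * (6 + U) * (C * Z * exp (6 / h) * (h / U)\<^sup>2) \<le> h * (56 * (C * Z))"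
  proof -
    have "C * Z * exp (6 / h) * (h / U)\<^sup>2 \<le> C * Z * T * r"
      using C Z e[of 6] r T(2) by (intro mult_mono) auto
    then have "2 * (6 + U) * (C * Z * exp (6 / h) * (h / U)\<^sup>2) \<le> 2 * (6 + U) * (C * Z * T * r)"
      using T(2) by (intro mult_left_mono) (auto simp: U_def)
    also have "\<dots> = 2 * (6 + U) * (C * Z * (r * T))" by (simp add: mult_ac)
    also have "\<dots> = (h * (8 * (C * Z))) * ((6 + U) / T)" unfolding rT by (simp add: mult_ac)
    also have "\<dots> \<le> (h * (8 * (C * Z))) * 7"
      using h C Z T41 by (intro mult_left_mono mult_nonneg_nonneg) (auto simp: U_def divide_simps)
    finally show ?thesis by simp
  qed
  have t3: "2 * U * (C * Z * exp (- U)) \<le> h * (8 * (C * Z))"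
  proof -
    have "exp U \<ge> 1 + U + U\<^sup>2 / 2" using T(2) by (intro exp_lower_Taylor_quadratic) (simp add: U_def)
    then have "exp U \<ge> T\<^sup>2 / 8" using T(2) by (simp add: U_def power_divide)
    then have "exp (- U) \<le> 1 / (T\<^sup>2 / 8)"
      unfolding exp_minus inverse_eq_divide using T(2) by (intro divide_left_mono) auto
    then have "T * exp (- U) \<le> T * (1 / (T\<^sup>2 / 8))" using T(2) by (intro mult_left_mono) auto
    also have "\<dots> = 8 * (1 / T)" using T(2) by (simp add: power2_eq_square)
    also have "\<dots> \<le> 8 * h" using h_low by simp
    finally have "C * Z * (T * exp (- U)) \<le> C * Z * (8 * h)" using C Z by (intro mult_left_mono) auto
    then show ?thesis by (simp add: U_def mult_ac)
  qed
  have "contour_error A C h U t \<le> h * (56 * C * (2 * A + 8)) + h * (56 * (C * Z)) + h * (8 * (C * Z))"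
    unfolding contour_error_def Z_def[symmetric] by (intro add_mono t1 t2 t3)
  also have "\<dots> = (56 * C * (2 * A + 8) + 64 * (C * Z)) * h" by (simp add: algebra_simps)
  finally show "contour_error A C h U t / h \<le> 56 * C * (2 * A + 8) + 64 * (C * Z)"
    using h by (simp add: pos_divide_le_eq)
  have "2 * (A * ln (t + U)) * C * h \<le> 2 * (A * (2 * ln T)) * C * h"
    using A C h lnU by (intro mult_right_mono mult_left_mono) auto
  also have "\<dots> = 4 * A * C * (h * ln T)" by simp
  also have "h * ln T = 40 * real k" using lnT by (simp add: h_def)
  finally show "2 * (A * ln (t + U)) * C * h \<le> 160 * A * C * real k" by simp
  have "T / 2 \<le> 1 + U / h"
  proof -
    have "U \<le> U / h" using h T(2) by (simp add: U_def field_simps)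
    then show ?thesis by (simp add: U_def)
  qed
  then have "(T / 2)\<^sup>2 \<le> (1 + U / h)\<^sup>2" using T(2) by (intro power_mono) auto
  then have "2 * (A * ln (t + U)) * C / (1 + U / h)\<^sup>2 \<le> 2 * (A * (2 * T)) * C / (T / 2)\<^sup>2"
    using A C lnU T(2) by (intro frac_le mult_right_mono mult_left_mono mult_nonneg_nonneg) auto
  also have "\<dots> = 16 * A * C / T" using T(2) by (simp add: power2_eq_square)
  also have "\<dots> \<le> 16 * A * C / 1" using T41 A C by (intro divide_left_mono) auto
  finally show "2 * (A * ln (t + U)) * C / (1 + U / h)\<^sup>2 \<le> 16 * A * C" by simp
qed

lemma dterm_tendsto:
  "((\<lambda>\<sigma>. dterm (Complex \<sigma> t) p) \<longlongrightarrow> dterm (Complex (1 / 2) t) p) (at_right (1 / 2))"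
proof (cases "p = 0")
  case False
  have "((\<lambda>\<sigma>. exp (Complex \<sigma> t * ln (of_nat p))) \<longlongrightarrow> exp (Complex (1 / 2) t * ln (of_nat p))) (at_right (1 / 2))"
    by (intro tendsto_intros tendsto_Complex)
  then show ?thesis
    unfolding dterm_def using False by (intro tendsto_divide tendsto_const) (auto simp: powr_def)
qed auto

text \<open>The bound on \<open>N\<close> is what the \<open>2 k\<close>-th moment over an interval of length \<open>T\<close> can afford.\<close>

definition argument_approximable :: "real \<Rightarrow> real \<Rightarrow> nat \<Rightarrow> bool" where
  "argument_approximable B T k \<longleftrightarrow> (\<exists>N c1 c2 c3 c4. real N \<le> 2 * exp (ln T / (8 * real k)) \<and>
        (\<forall>p. norm (c1 p) \<le> B \<and> norm (c2 p) \<le> B \<and> norm (c3 p) \<le> B \<and> norm (c4 p) \<le> B) \<and>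
        (\<forall>t\<in>{T..2 * T}. L (Complex (1 / 2) t) \<noteq> 0 \<longrightarrow>
          \<bar>Im (log_dirichlet_L chi (Complex (1 / 2) t))\<bar>
            \<le> norm (prime_sum N c1 (Complex (1 / 2) t)) + norm (prime_square_sum N c2 (Complex (1 / 2) t))
              + norm (prime_sum N c3 (Complex (1 / 2) t)) + norm (prime_square_sum N c4 (Complex (1 / 2) t))
              + B * real k))"

text \<open>All bounds are uniform in \<open>\<sigma> > 1 / 2\<close>, so they pass to the critical line. The constant \<open>40\<close> in
  \<open>h = 40 k / ln T\<close> makes the length \<open>exp (5 / h)\<close> of the polynomials equal to \<open>T\<close> to the power
  \<open>1 / (8 k)\<close>.\<close>

theorem argument_approximation:
  obtains B where "B \<ge> 1"
    and "\<And>T k. 1 \<le> k \<Longrightarrow> 40 * real k \<le> ln T \<Longrightarrow> T > 0 \<Longrightarrow> argument_approximable B T k"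
proof -
  obtain \<kappa> :: "complex \<Rightarrow> complex" and G C where maj: "C > 0" "\<kappa> holomorphic_on UNIV" "\<And>x. Im (\<kappa> (of_real x)) = 0"
    "\<And>z. norm (\<kappa> z) \<le> C * exp (4 * \<bar>Im z\<bar>) / (1 + norm z)\<^sup>2"
    "\<And>x. (G has_real_derivative Re (\<kappa> (of_real x))) (at x)"
    "\<And>x. G x \<ge> 0" "\<And>x. x \<ge> 0 \<Longrightarrow> G x \<ge> 1"
    "\<And>x. x \<le> 0 \<Longrightarrow> G x \<le> C / (1 + \<bar>x\<bar>)\<^sup>2"
    "\<And>x. x \<ge> 0 \<Longrightarrow> G x \<le> 1 + C / (1 + \<bar>x\<bar>)\<^sup>2"
    by (rule band_limited_majorant) (rule that, assumption+)
  have ker: "kernel \<kappa> C" by standard (rule maj)+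
  have ker': "kernel (\<lambda>z. \<kappa> (- z)) C" by (rule kernel_reflect[OF ker])
  obtain A where A: "A \<ge> 1"
    "\<And>\<sigma> t. 1 / 2 < \<sigma> \<Longrightarrow> \<sigma> \<le> 2 \<Longrightarrow> 3 \<le> t \<Longrightarrow> \<bar>Im (log_L (Complex \<sigma> t))\<bar> \<le> A * ln t"
    "\<And>\<sigma> t. 1 / 2 < \<sigma> \<Longrightarrow> \<sigma> \<le> 2 \<Longrightarrow> 3 \<le> t \<Longrightarrow>
           norm (log_L (Complex \<sigma> t)) \<le> A * ln t * (1 + \<bar>ln (\<sigma> - 1 / 2)\<bar>)"
    "\<And>\<sigma> t. 1 / 2 < \<sigma> \<Longrightarrow> \<sigma> \<le> 2 \<Longrightarrow> 3 \<le> t \<Longrightarrow> Re (deriv log_L (Complex \<sigma> t)) \<ge> - A * ln t"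
    using log_L_bounds by blast
  define Z where "Z = 4 * (\<Sum>n. real n powr (- 2))"
  define S where "S = (\<Sum>n. real n powr (- (3 / 2)))"
  have Z: "Z \<ge> 0" and S: "S \<ge> 0"
    unfolding Z_def S_def by (intro mult_nonneg_nonneg suminf_nonneg; auto simp: summable_real_powr_iff)+
  define D where "D = 8 * C * S + (56 * C * (2 * A + 8) + 64 * (C * Z)) + 16 * A * C"
  define B where "B = 1 + 2 * C + D + 160 * A * C"
  have pos: "C \<ge> 0" "D \<ge> 0" "160 * A * C \<ge> 0" "16 * A * C \<ge> 0"
    using maj(1) A Z S by (auto simp: D_def intro!: add_nonneg_nonneg mult_nonneg_nonneg)
  show ?thesis
  proof (rule that[of B])
    show "B \<ge> 1" unfolding B_def using pos by linarith
    fix T :: real and k :: nat assume k: "1 \<le> k" and T: "40 * real k \<le> ln T" "T > 0"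
    define h where "h = 40 * real k / ln T"
    define U where "U = T / 2"
    define N where "N = nat \<lceil>exp (5 / h)\<rceil>"
    have lnT: "ln T \<ge> 40" using T k by linarith
    have T41: "T \<ge> 41" using lnT ln_le_minus_one[OF T(2)] by linarith
    have h: "0 < h" "h \<le> 1"
  proof -
    show "0 < h" unfolding h_def using k lnT by (intro divide_pos_pos) auto
    show "h \<le> 1" unfolding h_def using T(1) lnT by (subst divide_le_eq_1_pos) auto
  qed
    have e1: "exp (5 / h) \<ge> 1" using h by simp
    have N: "exp (5 / h) \<le> real N" "real N \<le> 2 * exp (5 / h)"
    proof -
      show "exp (5 / h) \<le> real N" unfolding N_def by (rule real_nat_ceiling_ge)
      have "real N = of_int \<lceil>exp (5 / h)\<rceil>" unfolding N_def using e1 by (simp add: zero_le_ceiling less_le_trans[of "-1" 0])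
      also have "\<dots> \<le> exp (5 / h) + 1" by (rule of_int_ceiling_le_add_one)
      finally show "real N \<le> 2 * exp (5 / h)" using e1 by linarith
    qed
    have U: "U > 0" using T by (simp add: U_def)
    let ?c1 = "\<lambda>p. kernel.mass \<kappa> h U (ln (real p))" and ?c2 = "\<lambda>p. kernel.mass \<kappa> h U (2 * ln (real p))"
    let ?c3 = "\<lambda>p. kernel.mass (\<lambda>z. \<kappa> (- z)) h U (ln (real p))" and ?c4 = "\<lambda>p. kernel.mass (\<lambda>z. \<kappa> (- z)) h U (2 * ln (real p))"
    have "5 / h = ln T / (8 * real k)" using lnT k by (simp add: h_def field_simps)
    then have N': "real N \<le> 2 * exp (ln T / (8 * real k))" using N(2) by simp
    have CB: "2 * C \<le> B" unfolding B_def using pos by linarith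
    have c: "norm (?c1 p) \<le> B \<and> norm (?c2 p) \<le> B \<and> norm (?c3 p) \<le> B \<and> norm (?c4 p) \<le> B" for p
      using kernel.norm_mass_le[OF ker h(1) U] kernel.norm_mass_le[OF ker' h(1) U] CB order_trans by blast
    define R where "R = (\<lambda>s. norm (prime_sum N ?c1 s) + norm (prime_square_sum N ?c2 s)
              + norm (prime_sum N ?c3 s) + norm (prime_square_sum N ?c4 s) + B * real k)"
    have main: "\<bar>Im (log_dirichlet_L chi (Complex (1 / 2) t))\<bar> \<le> R (Complex (1 / 2) t)"
      if t: "t \<in> {T..2 * T}" and nz: "L (Complex (1 / 2) t) \<noteq> 0" for t
    proof -
      have t0: "t > 0" "t - U \<ge> 3" using t T41 by (auto simp: U_def)
      have ineq: "\<bar>Im (log_L (Complex \<sigma> t))\<bar> \<le> R (Complex \<sigma> t)" if \<sigma>: "1 / 2 < \<sigma>" "\<sigma> \<le> 1" for \<sigma>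
      proof -
        note err = error_terms_le[OF A(1) pos(1) k T t, folded h_def U_def Z_def]
        have "\<bar>Im (log_L (Complex \<sigma> t))\<bar> \<le> approximant \<kappa> N h U (Complex \<sigma> t) + approximant (\<lambda>z. \<kappa> (- z)) N h U (Complex \<sigma> t)
          + (8 * C * S + contour_error A C h U t / h)
          + 2 * (A * ln (t + U)) * C * h + 2 * (A * ln (t + U)) * C / (1 + U / h)\<^sup>2"
          unfolding S_def
          by (rule abs_Im_log_L_le[OF ker maj(5-9) A \<sigma> h U t0(2) N])
        also have "\<dots> \<le> approximant \<kappa> N h U (Complex \<sigma> t) + approximant (\<lambda>z. \<kappa> (- z)) N h U (Complex \<sigma> t)
          + (D + 160 * A * C * real k)"
          using err unfolding D_def by linarith
        also have "D + 160 * A * C * real k \<le> B * real k"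
        proof -
          have "D * 1 \<le> D * real k" using k pos by (intro mult_left_mono) auto
          moreover have "(1 + 2 * C) * real k \<ge> 0" using pos by simp
          ultimately show ?thesis unfolding B_def by (simp add: algebra_simps)
        qed
        finally show ?thesis unfolding approximant_def R_def by simp
      qed
      show ?thesis
      proof (rule tendsto_le)
        show "((\<lambda>\<sigma>. \<bar>Im (log_L (Complex \<sigma> t))\<bar>) \<longlongrightarrow> \<bar>Im (log_dirichlet_L chi (Complex (1 / 2) t))\<bar>) (at_right (1 / 2))"
          by (intro tendsto_rabs Im_log_L_tendsto t0 nz)
        show "((\<lambda>\<sigma>. R (Complex \<sigma> t)) \<longlongrightarrow> R (Complex (1 / 2) t)) (at_right (1 / 2))"
          unfolding R_def prime_sum_def prime_square_sum_def by (intro tendsto_intros dterm_tendsto)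
        show "\<forall>\<^sub>F \<sigma> in at_right (1 / 2). \<bar>Im (log_L (Complex \<sigma> t))\<bar> \<le> R (Complex \<sigma> t)"
          unfolding eventually_at_right_field by (rule exI[of _ 1]) (auto intro!: ineq)
      qed simp
    qed
    show "argument_approximable B T k"
      unfolding argument_approximable_def
      by (rule exI[of _ N], rule exI[of _ ?c1], rule exI[of _ ?c2], rule exI[of _ ?c3], rule exI[of _ ?c4])
         (use N' c main[unfolded R_def] in blast)
  qed
qed

end

section \<open>Moments of Dirichlet polynomials supported on primes\<close>

definition tuples :: "'a set \<Rightarrow> nat \<Rightarrow> 'a list set" where
  "tuples S k = {xs. set xs \<subseteq> S \<and> length xs = k}"

lemma finite_tuples: "finite S \<Longrightarrow> finite (tuples S k)"
  unfolding tuples_def by (rule finite_lists_length_eq)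

lemma power_sum_eq_sum_tuples:
  fixes f :: "'a \<Rightarrow> 'b :: comm_semiring_1"
  assumes "finite S"
  shows "(\<Sum>x\<in>S. f x) ^ k = (\<Sum>xs\<in>tuples S k. \<Prod>x\<leftarrow>xs. f x)"
proof (induction k)
  case 0
  have "tuples S 0 = {[]}" by (auto simp: tuples_def)
  then show ?case by simp
next
  case (Suc k)
  have eq: "tuples S (Suc k) = (\<lambda>(xs, x). x # xs) ` (tuples S k \<times> S)"
    unfolding tuples_def by (rule lists_length_Suc_eq)
  have "(\<Sum>xs\<in>tuples S (Suc k). \<Prod>x\<leftarrow>xs. f x) = (\<Sum>(xs, x)\<in>tuples S k \<times> S. f x * (\<Prod>x\<leftarrow>xs. f x))"
    unfolding eq by (subst sum.reindex) (auto simp: inj_on_def intro!: sum.cong)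
  also have "\<dots> = (\<Sum>xs\<in>tuples S k. \<Sum>x\<in>S. f x * (\<Prod>x\<leftarrow>xs. f x))"
    by (rule sum.cartesian_product[symmetric])
  also have "\<dots> = (\<Sum>x\<in>S. f x) * (\<Sum>xs\<in>tuples S k. \<Prod>x\<leftarrow>xs. f x)"
    by (subst sum.swap) (simp only: sum_product)
  finally show ?case using Suc by simp
qed

text \<open>The tuples with the multiset of \<open>xs\<close> are its permutations.\<close>

lemma card_tuples_same_mset:
  assumes "xs \<in> tuples S k"
  shows "card {ys \<in> tuples S k. mset ys = mset xs} \<le> fact k"
proof -
  have "card (permutations_of_multiset (mset xs)) * (\<Prod>x\<in>set_mset (mset xs). fact (count (mset xs) x)) = fact (size (mset xs))"
    by (rule card_permutations_of_multiset_aux)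
  moreover have "(\<Prod>x\<in>set_mset (mset xs). fact (count (mset xs) x) :: nat) \<ge> 1"
    by (simp add: Suc_leI prod_pos)
  ultimately have "card (permutations_of_multiset (mset xs)) \<le> fact (size (mset xs))"
    by (metis mult.right_neutral mult_le_mono2)
  moreover have "card {ys \<in> tuples S k. mset ys = mset xs} \<le> card (permutations_of_multiset (mset xs))"
    by (intro card_mono finite_permutations_of_multiset) (auto intro: permutations_of_multisetI)
  ultimately show ?thesis using assms by (simp add: tuples_def)
qed

lemma mset_eq_if_prod_list_primes_eq:
  fixes xs ys :: "nat list"
  assumes "\<And>x. x \<in> set xs \<Longrightarrow> prime x" "\<And>y. y \<in> set ys \<Longrightarrow> prime y" "prod_list xs = prod_list ys"
  shows "mset xs = mset ys"
proof -
  have "prime_factorization (prod_mset (mset xs)) = mset xs" "prime_factorization (prod_mset (mset ys)) = mset ys"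
    by (intro prime_factorization_prod_mset_primes; use assms in auto)+
  then show ?thesis using assms(3) by (metis prod_mset_prod_list)
qed

lemma norm_integral_cis_le:
  assumes w: "w \<noteq> 0" and "a \<le> b"
  shows "norm (integral {a..b} (\<lambda>t. cis (w * t))) \<le> 2 / \<bar>w\<bar>"
proof -
  have "((\<lambda>t. cis (w * t)) has_integral (cis (w * b) / (\<i> * w) - cis (w * a) / (\<i> * w))) {a..b}"
  proof (rule fundamental_theorem_of_calculus[OF assms(2)])
    fix t
    have "((\<lambda>t. exp (\<i> * of_real w * of_real t) / (\<i> * w)) has_vector_derivative
        (exp (\<i> * of_real w * of_real t))) (at t within {a..b})"
      using w by (auto intro!: derivative_eq_intros has_vector_derivative_real_field simp: field_simps)
    then show "((\<lambda>t. cis (w * t) / (\<i> * w)) has_vector_derivative cis (w * t)) (at t within {a..b})"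
      by (simp add: cis_conv_exp mult_ac)
  qed
  then have "integral {a..b} (\<lambda>t. cis (w * t)) = (cis (w * b) - cis (w * a)) / (\<i> * w)"
    by (simp add: integral_unique diff_divide_distrib)
  also have "norm \<dots> \<le> 2 / \<bar>w\<bar>"
    using norm_triangle_ineq4[of "cis (w * b)" "cis (w * a)"]
    by (simp add: norm_divide norm_mult divide_right_mono)
  finally show ?thesis .
qed

text \<open>The worst case is \<open>ln N - ln (N - 1)\<close>.\<close>

lemma abs_ln_diff_ge:
  fixes m n :: nat
  assumes "m \<noteq> n" "0 < m" "0 < n" "m \<le> N" "n \<le> N"
  shows "\<bar>ln (real m) - ln (real n)\<bar> \<ge> 1 / real N"
proof -
  have *: "ln (real b) - ln (real a) \<ge> 1 / real N" if "a < b" "0 < a" "b \<le> N" for a b :: nat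
  proof -
    have "ln (real a / real b) \<le> real a / real b - 1" using that by (intro ln_le_minus_one) auto
    then have "ln (real b) - ln (real a) \<ge> 1 - real a / real b" using that by (simp add: ln_div)
    also have "1 - real a / real b = (real b - real a) / real b" using that by (simp add: field_simps)
    also have "\<dots> \<ge> 1 / real b" using that by (intro divide_right_mono) auto
    also have "1 / real b \<ge> 1 / real N" using that by (intro divide_left_mono) auto
    finally show ?thesis .
  qed
  show ?thesis using *[of m n] *[of n m] assms by (cases "m < n") auto
qed

text \<open>Expanding the \<open>k\<close>-th power gives frequencies that are logarithms of products of \<open>k\<close> primes.
  Unique factorization makes two of them equal only for permutations of the same tuple, and distinct
  ones differ by at least \<open>N\<close> to the power \<open>- k\<close>.\<close>

lemma prime_polynomial_moment:
  fixes c :: "nat \<Rightarrow> complex"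
  assumes S: "S \<subseteq> {p. prime p \<and> p \<le> N}" and m: "m \<ge> (1 :: real)"
    and T: "2 * real N ^ (2 * k) \<le> T"
  shows "integral {A..A + T} (\<lambda>t. norm (\<Sum>p\<in>S. c p * cis (- (m * ln (real p)) * t)) ^ (2 * k))
           \<le> 2 * T * fact k * (\<Sum>p\<in>S. (norm (c p))\<^sup>2) ^ k"
proof -
  have fin: "finite S" by (rule finite_subset[OF S]) auto
  have T0: "T \<ge> 0" using T by (meson order_trans zero_le_mult_iff zero_le_numeral zero_le_power of_nat_0_le_iff)
  let ?L = "tuples S k"
  define a where "a = (\<lambda>l. \<Prod>p\<leftarrow>l. c p)"
  define \<Theta> where "\<Theta> = (\<lambda>l. - m * ln (real (prod_list l)))"
  let ?D = "\<lambda>t. \<Sum>p\<in>S. c p * cis (- (m * ln (real p)) * t)"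
  have finL: "finite ?L" by (rule finite_tuples[OF fin])
  have prime: "prime p" if "p \<in> set l" "l \<in> ?L" for p l
    using that S by (auto simp: tuples_def)
  have pos: "prod_list l > 0" if "l \<in> ?L" for l
    using prime[OF _ that] by (induction l) (auto simp: prime_gt_0_nat)
  have le: "prod_list l \<le> N ^ k" if "l \<in> ?L" for l
  proof -
    have "prod_list l \<le> N ^ length l" if "set l \<subseteq> S" for l
      using that S by (induction l) (auto intro!: mult_le_mono)
    then show ?thesis using that by (auto simp: tuples_def)
  qed
  have Dk: "?D t ^ k = (\<Sum>l\<in>?L. a l * cis (\<Theta> l * t))" for t
  proof -
    have "(\<Prod>p\<leftarrow>l. c p * cis (- (m * ln (real p)) * t)) = a l * cis (\<Theta> l * t)" if "l \<in> ?L" for l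
      using prime[OF _ that]
    proof (induction l)
      case (Cons p l)
      have "prod_list l > 0" using Cons.prems by (induction l) (auto simp: prime_gt_0_nat)
      then have "ln (real (prod_list (p # l))) = ln (real p) + ln (real (prod_list l))"
        using Cons.prems[of p] by (simp add: ln_mult prime_gt_0_nat)
      then have "\<Theta> (p # l) * t = - (m * ln (real p)) * t + \<Theta> l * t"
        unfolding \<Theta>_def by (simp add: algebra_simps)
      then have "cis (\<Theta> (p # l) * t) = cis (- (m * ln (real p)) * t) * cis (\<Theta> l * t)"
        by (simp add: cis_mult)
      then show ?case using Cons by (simp add: a_def)
    qed (simp add: a_def \<Theta>_def)
    then show ?thesis by (simp add: power_sum_eq_sum_tuples[OF fin])
  qed
  have sq: "norm (?D t) ^ (2 * k) = Re (\<Sum>l\<in>?L. \<Sum>l'\<in>?L. a l * cnj (a l') * cis ((\<Theta> l - \<Theta> l') * t))" for t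
  proof -
    have "complex_of_real (norm (?D t) ^ (2 * k)) = (?D t ^ k) * cnj (?D t ^ k)"
    proof -
      have "complex_of_real (norm (?D t) ^ (2 * k)) = of_real ((norm (?D t ^ k))\<^sup>2)"
        by (simp add: norm_power power_mult[symmetric] mult.commute)
      then show ?thesis unfolding complex_norm_square .
    qed
    also have "\<dots> = (\<Sum>l\<in>?L. \<Sum>l'\<in>?L. a l * cis (\<Theta> l * t) * cnj (a l' * cis (\<Theta> l' * t)))"
      unfolding Dk by (simp add: sum_product)
    also have "\<dots> = (\<Sum>l\<in>?L. \<Sum>l'\<in>?L. a l * cnj (a l') * cis ((\<Theta> l - \<Theta> l') * t))"
    proof (intro sum.cong refl)
      fix l l'
      have "cis (\<Theta> l * t) * cnj (cis (\<Theta> l' * t)) = cis ((\<Theta> l - \<Theta> l') * t)"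
        by (simp add: cis_cnj cis_mult algebra_simps)
      then show "a l * cis (\<Theta> l * t) * cnj (a l' * cis (\<Theta> l' * t)) = a l * cnj (a l') * cis ((\<Theta> l - \<Theta> l') * t)"
        by (simp add: mult_ac)
    qed
    finally show ?thesis by (metis Re_complex_of_real)
  qed
  let ?I = "\<lambda>l l'. integral {A..A + T} (\<lambda>t. cis ((\<Theta> l - \<Theta> l') * t))"
  have cint: "(\<lambda>t. cis (w * t)) integrable_on {A..A + T}" for w
    by (intro integrable_continuous_interval continuous_intros)
  have int: "integral {A..A + T} (\<lambda>t. norm (?D t) ^ (2 * k)) = Re (\<Sum>l\<in>?L. \<Sum>l'\<in>?L. a l * cnj (a l') * ?I l l')"
  proof -
    have "((\<lambda>t. \<Sum>l\<in>?L. \<Sum>l'\<in>?L. a l * cnj (a l') * cis ((\<Theta> l - \<Theta> l') * t)) has_integral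
         (\<Sum>l\<in>?L. \<Sum>l'\<in>?L. a l * cnj (a l') * ?I l l')) {A..A + T}"
      by (intro has_integral_sum has_integral_mult_right finL integrable_integral cint)
    from has_integral_Re[OF this] show ?thesis unfolding sq by (simp add: integral_unique)
  qed
  have Ile: "norm (?I l l') \<le> (if mset l = mset l' then T else 2 * real (N ^ k))"
    if l: "l \<in> ?L" "l' \<in> ?L" for l l'
  proof (cases "mset l = mset l'")
    case True
    then have "prod_list l = prod_list l'" by (metis prod_mset_prod_list)
    then show ?thesis using True T0 by (simp add: \<Theta>_def)
  next
    case False
    then have ne: "prod_list l \<noteq> prod_list l'"
      using mset_eq_if_prod_list_primes_eq prime l by blast
    have "\<bar>ln (real (prod_list l')) - ln (real (prod_list l))\<bar> \<ge> 1 / real (N ^ k)"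
      by (rule abs_ln_diff_ge) (use ne pos le l in auto)
    also have "\<bar>ln (real (prod_list l')) - ln (real (prod_list l))\<bar>
       \<le> m * \<bar>ln (real (prod_list l')) - ln (real (prod_list l))\<bar>"
      using m mult_right_mono[of 1 m "\<bar>ln (real (prod_list l')) - ln (real (prod_list l))\<bar>"] by simp
    also have "\<dots> = \<bar>\<Theta> l - \<Theta> l'\<bar>"
    proof -
      have "\<Theta> l - \<Theta> l' = m * (ln (real (prod_list l')) - ln (real (prod_list l)))"
        unfolding \<Theta>_def by (simp add: algebra_simps)
      then show ?thesis using m by (simp only: abs_mult)
    qed
    finally have ge: "1 / real (N ^ k) \<le> \<bar>\<Theta> l - \<Theta> l'\<bar>" .
    have Np: "N ^ k > 0" using pos le l by (metis not_less le_zero_eq less_nat_zero_code not_gr_zero)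
    have wpos: "\<bar>\<Theta> l - \<Theta> l'\<bar> > 0" using ge Np by (smt (verit) divide_pos_pos of_nat_0_less_iff)
    have "norm (?I l l') \<le> 2 / \<bar>\<Theta> l - \<Theta> l'\<bar>"
      using wpos T0 by (intro norm_integral_cis_le) auto
    also have "\<dots> \<le> 2 / (1 / real (N ^ k))"
      using ge wpos Np by (intro divide_left_mono mult_pos_pos) auto
    finally show ?thesis using False by simp
  qed
  have na: "norm (a l) = (\<Prod>p\<leftarrow>l. norm (c p))" for l
    unfolding a_def by (induction l) (auto simp: norm_mult)
  have na_eq: "norm (a l) = norm (a l')" if "mset l = mset l'" for l l'
    unfolding na using that by (metis mset_map prod_mset_prod_list)
  let ?Q = "\<Sum>p\<in>S. (norm (c p))\<^sup>2"
  have diag: "(\<Sum>l\<in>?L. \<Sum>l'\<in>?L. if mset l = mset l' then norm (a l) * norm (a l') else 0) \<le> fact k * ?Q ^ k"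
  proof -
    have "(\<Sum>l'\<in>?L. if mset l = mset l' then norm (a l) * norm (a l') else 0) \<le> fact k * (norm (a l))\<^sup>2"
      if l: "l \<in> ?L" for l
    proof -
      have "(\<Sum>l'\<in>?L. if mset l = mset l' then norm (a l) * norm (a l') else 0)
         = (\<Sum>l'\<in>?L. if mset l' = mset l then (norm (a l))\<^sup>2 else 0)"
      proof (intro sum.cong refl)
        fix l' show "(if mset l = mset l' then norm (a l) * norm (a l') else 0)
           = (if mset l' = mset l then (norm (a l))\<^sup>2 else 0)"
          using na_eq[of l l'] by (auto simp: power2_eq_square)
      qed
      also have "\<dots> = real (card {l'\<in>?L. mset l' = mset l}) * (norm (a l))\<^sup>2"
        by (subst sum.inter_filter[OF finL, symmetric]) simp
      also have "\<dots> \<le> fact k * (norm (a l))\<^sup>2"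
      proof (rule mult_right_mono)
        have "real (card {l'\<in>?L. mset l' = mset l}) \<le> real (fact k)"
          using card_tuples_same_mset[OF l] by (rule of_nat_mono)
        then show "real (card {l'\<in>?L. mset l' = mset l}) \<le> fact k" by simp
      qed auto
      finally show ?thesis .
    qed
    then have "(\<Sum>l\<in>?L. \<Sum>l'\<in>?L. if mset l = mset l' then norm (a l) * norm (a l') else 0)
        \<le> (\<Sum>l\<in>?L. fact k * (norm (a l))\<^sup>2)" by (rule sum_mono)
    also have "\<dots> = fact k * (\<Sum>l\<in>?L. \<Prod>p\<leftarrow>l. (norm (c p))\<^sup>2)"
    proof -
      have "(norm (a l))\<^sup>2 = (\<Prod>p\<leftarrow>l. (norm (c p))\<^sup>2)" for l
        unfolding na by (induction l) (auto simp: power_mult_distrib)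
      then show ?thesis by (simp add: sum_distrib_left)
    qed
    also have "(\<Sum>l\<in>?L. \<Prod>p\<leftarrow>l. (norm (c p))\<^sup>2) = ?Q ^ k"
      by (rule power_sum_eq_sum_tuples[OF fin, symmetric])
    finally show ?thesis .
  qed
  \<comment> \<open>Cauchy--Schwarz loses a factor \<open>N\<^sup>k\<close>, and the small differences of frequencies another one;
    \<open>T\<close> exceeds the product.\<close>
  have off: "(\<Sum>l\<in>?L. \<Sum>l'\<in>?L. norm (a l) * norm (a l')) \<le> real N ^ k * ?Q ^ k"
  proof -
    have cardS: "card S \<le> N"
      using card_mono[of "{1..N}" S] S by (force simp: prime_gt_0_nat Suc_leI)
    have "(\<Sum>l\<in>?L. \<Sum>l'\<in>?L. norm (a l) * norm (a l')) = (\<Sum>l\<in>?L. norm (a l)) ^ 2"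
      by (simp add: power2_eq_square sum_product)
    also have "(\<Sum>l\<in>?L. norm (a l)) = (\<Sum>p\<in>S. norm (c p)) ^ k"
      unfolding na by (rule power_sum_eq_sum_tuples[OF fin, symmetric])
    also have "((\<Sum>p\<in>S. norm (c p)) ^ k) ^ 2 = ((\<Sum>p\<in>S. 1 * norm (c p)) ^ 2) ^ k"
      by (simp add: power_mult[symmetric] mult.commute)
    also have "\<dots> \<le> ((\<Sum>p\<in>S. 1 ^ 2) * ?Q) ^ k"
      by (intro power_mono Cauchy_Schwarz_ineq_sum) auto
    also have "\<dots> \<le> (real N * ?Q) ^ k"
      using cardS by (intro power_mono mult_right_mono) (auto intro!: sum_nonneg mult_nonneg_nonneg)
    finally show ?thesis by (simp add: power_mult_distrib)
  qed
  have "integral {A..A + T} (\<lambda>t. norm (?D t) ^ (2 * k)) \<le> norm (\<Sum>l\<in>?L. \<Sum>l'\<in>?L. a l * cnj (a l') * ?I l l')"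
    unfolding int by (rule complex_Re_le_cmod)
  also have "\<dots> \<le> (\<Sum>l\<in>?L. \<Sum>l'\<in>?L. norm (a l) * norm (a l') * (if mset l = mset l' then T else 2 * real (N ^ k)))"
  proof (intro sum_norm_le)
    fix l l' assume l: "l \<in> ?L" "l' \<in> ?L"
    show "norm (a l * cnj (a l') * ?I l l') \<le> norm (a l) * norm (a l') * (if mset l = mset l' then T else 2 * real (N ^ k))"
      unfolding norm_mult complex_mod_cnj by (intro mult_left_mono Ile l mult_nonneg_nonneg) auto
  qed
  also have "\<dots> \<le> (\<Sum>l\<in>?L. \<Sum>l'\<in>?L. T * (if mset l = mset l' then norm (a l) * norm (a l') else 0)
        + 2 * real N ^ k * (norm (a l) * norm (a l')))"
    by (intro sum_mono) (auto simp: mult_ac)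
  also have "\<dots> = T * (\<Sum>l\<in>?L. \<Sum>l'\<in>?L. if mset l = mset l' then norm (a l) * norm (a l') else 0)
        + 2 * real N ^ k * (\<Sum>l\<in>?L. \<Sum>l'\<in>?L. norm (a l) * norm (a l'))"
    by (simp only: sum.distrib sum_distrib_left)
  also have "\<dots> \<le> T * (fact k * ?Q ^ k) + 2 * real N ^ k * (real N ^ k * ?Q ^ k)"
    using T0 by (intro add_mono mult_left_mono diag off) auto
  also have "2 * real N ^ k * (real N ^ k * ?Q ^ k) = (2 * real N ^ (2 * k)) * ?Q ^ k"
  proof -
    have "real N ^ (2 * k) = real N ^ k * real N ^ k" by (simp only: mult_2[of k] power_add)
    then show ?thesis by (simp only: mult_ac)
  qed
  also have "\<dots> \<le> T * (fact k * ?Q ^ k)"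
  proof -
    have Q0: "?Q ^ k \<ge> 0" by (intro zero_le_power sum_nonneg) auto
    have "(2 * real N ^ (2 * k)) * ?Q ^ k \<le> T * ?Q ^ k" using Q0 T by (intro mult_right_mono)
    also have "?Q ^ k \<le> fact k * ?Q ^ k" using Q0 mult_right_mono[of 1 "fact k" "?Q ^ k"] by (simp add: fact_ge_1)
    finally show ?thesis using T0 by (simp add: mult_left_mono)
  qed
  finally show ?thesis by (simp add: algebra_simps)
qed

section \<open>The moment bound\<close>

lemma power_sum5_le:
  fixes a b c d e :: real
  assumes "a \<ge> 0" "b \<ge> 0" "c \<ge> 0" "d \<ge> 0" "e \<ge> 0"
  shows "(a + b + c + d + e) ^ n \<le> 5 ^ n * (a ^ n + b ^ n + c ^ n + d ^ n + e ^ n)"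
proof -
  define m where "m = Max {a, b, c, d, e}"
  have le: "a \<le> m" "b \<le> m" "c \<le> m" "d \<le> m" "e \<le> m" by (auto simp: m_def)
  have "m \<in> {a, b, c, d, e}" unfolding m_def by (rule Max_in) auto
  then have "m ^ n \<le> a ^ n + b ^ n + c ^ n + d ^ n + e ^ n"
    using assms by (auto intro!: add_nonneg_nonneg simp: add_increasing add_increasing2)
  moreover have "(a + b + c + d + e) ^ n \<le> (5 * m) ^ n"
    using assms le by (intro power_mono) auto
  ultimately show ?thesis by (simp add: power_mult_distrib mult_left_mono order_trans)
qed

context grh_character
begin

text \<open>\<open>L\<close> is not identically zero, so its zeros are isolated.\<close>

lemma finite_zeros_on_segment: "finite {t \<in> {a..b}. L (Complex (1 / 2) t) = 0}"
proof (cases "L constant_on {s. Re s > 0}")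
  case True
  have "L (Complex 2 1) \<noteq> 0" by (rule dirichlet_L_nonzero) simp
  then have "L (Complex (1 / 2) t) \<noteq> 0" for t
    using True by (fastforce simp: constant_on_def)
  then show ?thesis by simp
next
  case False
  let ?K = "(\<lambda>t. Complex (1 / 2) t) ` {a..b}"
  have "compact ?K" by (intro compact_continuous_image) (auto simp: Complex_eq intro!: continuous_intros)
  then have "finite {z \<in> ?K. L z = 0}"
    using False L_holomorphic
    by (intro holomorphic_compact_finite_zeros[of L "{s. Re s > 0}"])
       (auto simp: open_halfspace_Re_gt intro!: convex_connected convex_halfspace_Re_gt)
  then have "finite (Im ` {z \<in> ?K. L z = 0})" by simp
  then show ?thesis by (rule finite_subset[rotated]) force
qed

text \<open>Up to finitely many points \<open>X\<close> is a limit of continuous functions, the arguments on vertical lines to the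
  right of the critical line. The arbitrary values at the remaining points do no harm.\<close>

lemma X_measurable:
  assumes X: "is_X chi X" and T: "a > 0"
  shows "(\<lambda>t. indicator {a..b} t * X t) \<in> borel_measurable lebesgue"
proof -
  define Z where "Z = {t \<in> {a..b}. L (Complex (1 / 2) t) = 0}"
  define A where "A = {a..b} - Z"
  have fin: "finite Z" unfolding Z_def by (rule finite_zeros_on_segment)
  have A_sets: "A \<in> sets borel" unfolding A_def using fin by (intro sets.Diff) (auto intro: finite_imp_closed borel_closed)
  define F where "F = (\<lambda>n t. indicator A t * Im (log_L (Complex (1 / 2 + 1 / real (Suc n)) t)))"
  have F_meas: "F n \<in> borel_measurable lebesgue" for n
  proof -
    have "continuous_on {a..b} (\<lambda>t. log_L (Complex (1 / 2 + 1 / real (Suc n)) t))"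
    proof (rule continuous_on_compose2[OF holomorphic_on_imp_continuous_on[OF log_L_holomorphic]])
      show "continuous_on {a..b} (\<lambda>t. Complex (1 / 2 + 1 / real (Suc n)) t)"
        unfolding Complex_eq by (intro continuous_intros)
      show "(\<lambda>t. Complex (1 / 2 + 1 / real (Suc n)) t) ` {a..b} \<subseteq> quadrant"
        using T by (auto simp: quadrant_def)
    qed
    then have "continuous_on {a..b} (\<lambda>t. Im (log_L (Complex (1 / 2 + 1 / real (Suc n)) t)))"
      by (intro continuous_intros)
    then have c: "(\<lambda>t. indicator {a..b} t *\<^sub>R Im (log_L (Complex (1 / 2 + 1 / real (Suc n)) t))) \<in> borel_measurable borel"
      by (intro borel_measurable_continuous_on_indicator) auto
    have "F n = (\<lambda>t. indicator A t * (indicator {a..b} t *\<^sub>R Im (log_L (Complex (1 / 2 + 1 / real (Suc n)) t))))"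
      by (auto simp: F_def A_def indicator_def fun_eq_iff)
    moreover have "\<dots> \<in> borel_measurable borel"
      using A_sets c by (intro borel_measurable_times borel_measurable_indicator) auto
    ultimately have "F n \<in> borel_measurable lborel" by simp
    then show ?thesis by (rule measurable_completion)
  qed
  have lim: "(\<lambda>n. F n t) \<longlonglongrightarrow> indicator A t * X t" for t
  proof (cases "t \<in> A")
    case True
    then have t: "t > 0" "L (Complex (1 / 2) t) \<noteq> 0" using T by (auto simp: A_def Z_def)
    have "filterlim (\<lambda>n. 1 / 2 + 1 / real (Suc n)) (at_right (1 / 2)) sequentially"
      by real_asymp
    from filterlim_compose[OF Im_log_L_tendsto[OF t] this]
    have "(\<lambda>n. Im (log_L (Complex (1 / 2 + 1 / real (Suc n)) t))) \<longlonglongrightarrow> X t"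
      using X t(2) by (simp add: is_X_def)
    then show ?thesis using True by (simp add: F_def)
  qed (simp add: F_def)
  have 1: "(\<lambda>t. indicator A t * X t) \<in> borel_measurable lebesgue"
    by (rule borel_measurable_LIMSEQ_real[OF lim F_meas])
  have 2: "(\<lambda>t. \<Sum>z\<in>Z. X z * indicator {z} t) \<in> borel_measurable lebesgue"
    by (intro borel_measurable_sum borel_measurable_times borel_measurable_indicator) auto
  have "indicator {a..b} t * X t = indicator A t * X t + (\<Sum>z\<in>Z. X z * indicator {z} t)" for t
  proof (cases "t \<in> Z")
    case True
    then have "(\<Sum>z\<in>Z. X z * indicator {z} t) = (\<Sum>z\<in>Z. if z = t then X t else 0)"
      by (intro sum.cong) (auto simp: indicator_def)
    then show ?thesis using True fin by (auto simp: A_def Z_def indicator_def)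
  next
    case False
    then have "(\<Sum>z\<in>Z. X z * indicator {z} t) = 0"
      by (intro sum.neutral) (auto simp: indicator_def)
    then show ?thesis using False by (auto simp: A_def indicator_def)
  qed
  then show ?thesis using borel_measurable_add[OF 1 2] by simp
qed

lemma dterm_half_line:
  assumes "p > 0"
  shows "dterm (Complex (1 / 2) t) p = dterm (Complex (1 / 2) 0) p * cis (- (1 * ln (real p)) * t)"
  using dterm_shift[OF assms, of "1 / 2" 0 "- t"] by simp

text \<open>The squared coefficients are at most \<open>B\<^sup>2 / p\<close>, for prime squares as well as for primes.\<close>

lemma sum_norm_square_le:
  assumes c: "\<And>p. norm (c p) \<le> B" and N: "real N \<le> T" and T: "T \<ge> 3" and m: "m \<ge> 1"
  shows "(\<Sum>p | prime p \<and> p < N. (norm (c p * dterm (Complex (1 / 2) 0) p ^ m))\<^sup>2) \<le> B\<^sup>2 * (9 * ln (3 * ln T))"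
proof -
  have fin: "finite {p. prime p \<and> real p < T}"
    by (rule finite_subset[of _ "{..nat \<lceil>T\<rceil>}"]) (auto simp: le_nat_iff le_ceiling_iff)
  have "(\<Sum>p | prime p \<and> p < N. (norm (c p * dterm (Complex (1 / 2) 0) p ^ m))\<^sup>2) \<le> (\<Sum>p | prime p \<and> p < N. B\<^sup>2 * (1 / real p))"
  proof (rule sum_mono)
    fix p assume "p \<in> {p. prime p \<and> p < N}"
    then have p: "prime p" by simp
    have nd: "norm (dterm (Complex (1 / 2) 0) p) \<le> 3 / 4" by (rule norm_dterm_prime_le[OF p]) simp
    have "norm (dterm (Complex (1 / 2) 0) p) ^ m \<le> norm (dterm (Complex (1 / 2) 0) p) ^ 1"
      using m nd by (intro power_decreasing) auto
    also have "\<dots> \<le> real p powr (- (1 / 2))" using norm_dterm_le[of "Complex (1 / 2) 0" p] by simp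
    finally have 1: "norm (dterm (Complex (1 / 2) 0) p) ^ m \<le> real p powr (- (1 / 2))" .
    have B0: "B \<ge> 0" using c[of 0] norm_ge_zero[of "c 0"] by (rule order_trans[rotated])
    have "norm (c p * dterm (Complex (1 / 2) 0) p ^ m) \<le> B * real p powr (- (1 / 2))"
      unfolding norm_mult norm_power using 1 c B0 by (intro mult_mono) auto
    then have "(norm (c p * dterm (Complex (1 / 2) 0) p ^ m))\<^sup>2 \<le> (B * real p powr (- (1 / 2)))\<^sup>2"
      by (intro power_mono) auto
    also have "\<dots> = B\<^sup>2 * (1 / real p)"
      using prime_gt_0_nat[OF p] by (simp add: power_mult_distrib powr_power powr_minus field_simps)
    finally show "(norm (c p * dterm (Complex (1 / 2) 0) p ^ m))\<^sup>2 \<le> B\<^sup>2 * (1 / real p)" .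
  qed
  also have "\<dots> \<le> (\<Sum>p | prime p \<and> real p < T. B\<^sup>2 * (1 / real p))"
    using N by (intro sum_mono2 fin) auto
  also have "\<dots> = B\<^sup>2 * (\<Sum>p | prime p \<and> real p < T. 1 / real p)" by (simp add: sum_distrib_left)
  also have "\<dots> \<le> B\<^sup>2 * (9 * ln (3 * ln T))" by (intro mult_left_mono sum_primes_inverse_le T) auto
  finally show ?thesis .
qed

lemma prime_sum_moment:
  assumes c: "\<And>p. norm (c p) \<le> B" and N: "real N \<le> T" and T: "T \<ge> 3"
    and NT: "2 * real N ^ (2 * k) \<le> T"
  shows "integral {T..2 * T} (\<lambda>t. norm (prime_sum N c (Complex (1 / 2) t)) ^ (2 * k))
           \<le> 2 * T * fact k * (B\<^sup>2 * (9 * ln (3 * ln T))) ^ k" (is ?A)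
    and "integral {T..2 * T} (\<lambda>t. norm (prime_square_sum N c (Complex (1 / 2) t)) ^ (2 * k))
           \<le> 2 * T * fact k * (B\<^sup>2 * (9 * ln (3 * ln T))) ^ k" (is ?B)
proof -
  let ?S = "{p. prime p \<and> p < N}"
  have S: "?S \<subseteq> {p. prime p \<and> p \<le> N}" by auto
  let ?d = "\<lambda>p. dterm (Complex (1 / 2) 0) p"
  have 1: "prime_sum N c (Complex (1 / 2) t) = (\<Sum>p\<in>?S. (c p * ?d p ^ 1) * cis (- (1 * ln (real p)) * t))" for t
    unfolding prime_sum_def by (rule sum.cong) (auto simp: dterm_half_line[of _ t] prime_gt_0_nat)
  have 2: "prime_square_sum N c (Complex (1 / 2) t) = (\<Sum>p\<in>?S. (c p * ?d p ^ 2) * cis (- (2 * ln (real p)) * t))" for t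
    unfolding prime_square_sum_def
  proof (rule sum.cong)
    fix p assume "p \<in> ?S"
    then have "dterm (Complex (1 / 2) t) p = ?d p * cis (- (1 * ln (real p)) * t)"
      by (intro dterm_half_line) (auto simp: prime_gt_0_nat)
    moreover have "(cis (- (1 * ln (real p)) * t))\<^sup>2 = cis (- (2 * ln (real p)) * t)"
      unfolding power2_eq_square cis_mult by (rule arg_cong[of _ _ cis]) simp
    ultimately show "c p * dterm (Complex (1 / 2) t) p ^ 2 = c p * ?d p ^ 2 * cis (- (2 * ln (real p)) * t)"
      by (simp only: power_mult_distrib mult.assoc)
  qed simp
  have T2: "{T..2 * T} = {T..T + T}" by simp
  have step: "2 * T * fact k * (\<Sum>p\<in>?S. (norm (c p * ?d p ^ m))\<^sup>2) ^ k \<le> 2 * T * fact k * (B\<^sup>2 * (9 * ln (3 * ln T))) ^ k"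
    if "m \<ge> 1" for m
    by (intro mult_left_mono power_mono sum_norm_square_le c N T that sum_nonneg) (use T in auto)
  show ?A unfolding 1 T2 by (rule order_trans[OF prime_polynomial_moment[OF S _ NT] step]) auto
  show ?B unfolding 2 T2 by (rule order_trans[OF prime_polynomial_moment[OF S _ NT] step]) auto
qed

lemma dterm_continuous: "continuous_on A (\<lambda>t. dterm (Complex (1 / 2) t) p)"
proof (cases "p = 0")
  case False
  then have "(\<lambda>t. dterm (Complex (1 / 2) t) p) = (\<lambda>t. dterm (Complex (1 / 2) 0) p * cis (- (1 * ln (real p)) * t))"
    by (intro ext dterm_half_line) simp
  then show ?thesis by (simp only:) (intro continuous_intros)
qed simp

text \<open>The zeros on the segment form a null set, and off them the \<open>2 k\<close>-th power of the five-term bound is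
  at most \<open>5\<close> to the power \<open>2 k\<close> times the sum of the powers.\<close>

lemma moment_le:
  assumes X: "is_X chi X" and B: "B \<ge> 1"
    and k: "k \<ge> 1" "40 * real k \<le> ln T" "T > 0"
    and approx: "argument_approximable B T k"
  shows "set_integrable lebesgue {T..2 * T} (\<lambda>t. \<bar>X t\<bar> ^ (2 * k))"
    and "(LINT t:{T..2 * T}|lebesgue. \<bar>X t\<bar> ^ (2 * k))
           \<le> 5 ^ (2 * k) * (8 * T * fact k * (B\<^sup>2 * (9 * ln (3 * ln T))) ^ k + T * (B * real k) ^ (2 * k))"
proof -
  obtain N c1 c2 c3 c4 where N: "real N \<le> 2 * exp (ln T / (8 * real k))"
    and c: "\<And>p. norm (c1 p) \<le> B" "\<And>p. norm (c2 p) \<le> B" "\<And>p. norm (c3 p) \<le> B" "\<And>p. norm (c4 p) \<le> B"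
    and app: "\<And>t. t \<in> {T..2 * T} \<Longrightarrow> L (Complex (1 / 2) t) \<noteq> 0 \<Longrightarrow>
          \<bar>Im (log_dirichlet_L chi (Complex (1 / 2) t))\<bar>
            \<le> norm (prime_sum N c1 (Complex (1 / 2) t)) + norm (prime_square_sum N c2 (Complex (1 / 2) t))
              + norm (prime_sum N c3 (Complex (1 / 2) t)) + norm (prime_square_sum N c4 (Complex (1 / 2) t))
              + B * real k"
    using approx unfolding argument_approximable_def by metis
  define Z where "Z = {t \<in> {T..2 * T}. L (Complex (1 / 2) t) = 0}"
  have "Z \<in> null_sets lebesgue"
    unfolding Z_def using negligible_finite[OF finite_zeros_on_segment] by (simp add: negligible_iff_null_sets)
  then have AE: "AE t in lebesgue. t \<notin> Z" by (rule AE_not_in)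
  have lnT: "ln T \<ge> 40" using k by linarith
  have T41: "T \<ge> 41" using lnT ln_le_minus_one[OF k(3)] by linarith
  have expT: "exp (ln T) = T" using k(3) by simp
  \<comment> \<open>\<open>N\<close> is at most \<open>2\<close> times \<open>T\<close> to the power \<open>1 / (8 k)\<close>, so \<open>2 N\<^sup>2\<^sup>k\<close> is at most \<open>exp (1 + 2 k)\<close> times the
    fourth root of \<open>T\<close>.\<close>
  have NT: "2 * real N ^ (2 * k) \<le> T"
  proof -
    have two: "(2::real) \<le> exp 1" using exp_ge_add_one_self[of 1] by simp
    have "real N ^ (2 * k) \<le> (exp 1 * exp (ln T / (8 * real k))) ^ (2 * k)"
      using N two by (intro power_mono order_trans[OF N] mult_right_mono) auto
    also have "\<dots> = exp (real (2 * k) * (1 + ln T / (8 * real k)))"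
      unfolding exp_add[symmetric] exp_of_nat_mult ..
    also have "real (2 * k) * (1 + ln T / (8 * real k)) = 2 * real k + ln T / 4"
      using k by (simp add: field_simps)
    finally have "2 * real N ^ (2 * k) \<le> exp 1 * exp (2 * real k + ln T / 4)"
      using two by (intro mult_mono) auto
    also have "\<dots> = exp (1 + 2 * real k + ln T / 4)" by (simp add: exp_add mult.assoc)
    also have "\<dots> \<le> exp (ln T)"
    proof (rule iffD2[OF exp_le_cancel_iff])
      show "1 + 2 * real k + ln T / 4 \<le> ln T" using k(2) lnT by linarith
    qed
    finally show ?thesis using expT by simp
  qed
  have NT1: "real N \<le> T"
  proof (cases "N = 0")
    case False
    have "real N ^ 1 \<le> real N ^ (2 * k)" using False k by (intro power_increasing) auto
    moreover have "real N ^ (2 * k) \<ge> 0" by simp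
    ultimately show ?thesis using NT unfolding power_one_right by linarith
  qed (use T41 in simp)
  let ?n = "2 * k"
  define h1 where "h1 = (\<lambda>t. norm (prime_sum N c1 (Complex (1 / 2) t)) ^ ?n)"
  define h2 where "h2 = (\<lambda>t. norm (prime_square_sum N c2 (Complex (1 / 2) t)) ^ ?n)"
  define h3 where "h3 = (\<lambda>t. norm (prime_sum N c3 (Complex (1 / 2) t)) ^ ?n)"
  define h4 where "h4 = (\<lambda>t. norm (prime_square_sum N c4 (Complex (1 / 2) t)) ^ ?n)"
  define H where "H = (\<lambda>t. 5 ^ ?n * (h1 t + h2 t + h3 t + h4 t + (B * real k) ^ ?n))"
  have cont: "continuous_on {T..2 * T} h1" "continuous_on {T..2 * T} h2"
    "continuous_on {T..2 * T} h3" "continuous_on {T..2 * T} h4"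
    unfolding h1_def h2_def h3_def h4_def prime_sum_def prime_square_sum_def
    by (intro continuous_intros dterm_continuous)+
  then have contH: "continuous_on {T..2 * T} H" unfolding H_def by (intro continuous_intros)
  then have intH: "set_integrable lebesgue {T..2 * T} H" by (rule absolutely_integrable_continuous_real)
  have le: "\<bar>X t\<bar> ^ ?n \<le> H t" if t: "t \<in> {T..2 * T}" "t \<notin> Z" for t
  proof -
    have nz: "L (Complex (1 / 2) t) \<noteq> 0" using t by (auto simp: Z_def)
    have "\<bar>X t\<bar> ^ ?n = \<bar>Im (log_dirichlet_L chi (Complex (1 / 2) t))\<bar> ^ ?n" using X nz by (simp add: is_X_def)
    also have "\<dots> \<le> (norm (prime_sum N c1 (Complex (1 / 2) t)) + norm (prime_square_sum N c2 (Complex (1 / 2) t))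
              + norm (prime_sum N c3 (Complex (1 / 2) t)) + norm (prime_square_sum N c4 (Complex (1 / 2) t))
              + B * real k) ^ ?n"
      by (intro power_mono app t nz) auto
    also have "\<dots> \<le> H t" unfolding H_def h1_def h2_def h3_def h4_def
      by (rule power_sum5_le) (use B in auto)
    finally show ?thesis .
  qed
  have H0: "H t \<ge> 0" for t unfolding H_def h1_def h2_def h3_def h4_def using B
    by (intro mult_nonneg_nonneg add_nonneg_nonneg) auto
  have meas: "(\<lambda>t. indicator {T..2 * T} t *\<^sub>R \<bar>X t\<bar> ^ ?n) \<in> borel_measurable lebesgue"
  proof -
    have "(\<lambda>t. \<bar>indicator {T..2 * T} t * X t\<bar> ^ ?n) \<in> borel_measurable lebesgue"
      by (intro borel_measurable_power borel_measurable_abs X_measurable[OF X k(3)])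
    moreover have "(\<lambda>t. \<bar>indicator {T..2 * T} t * X t\<bar> ^ ?n) = (\<lambda>t. indicator {T..2 * T} t *\<^sub>R \<bar>X t\<bar> ^ ?n)"
      using k by (auto simp: indicator_def fun_eq_iff)
    ultimately show ?thesis by simp
  qed
  show int: "set_integrable lebesgue {T..2 * T} (\<lambda>t. \<bar>X t\<bar> ^ ?n)"
    unfolding set_integrable_def
  proof (rule Bochner_Integration.integrable_bound[OF intH[unfolded set_integrable_def] meas])
    show "AE t in lebesgue. norm (indicator {T..2 * T} t *\<^sub>R \<bar>X t\<bar> ^ ?n) \<le> norm (indicator {T..2 * T} t *\<^sub>R H t)"
      using AE by eventually_elim (use le H0 in \<open>auto simp: indicator_def\<close>)
  qed
  have "(LINT t:{T..2 * T}|lebesgue. \<bar>X t\<bar> ^ ?n) \<le> (LINT t:{T..2 * T}|lebesgue. H t)"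
    unfolding set_lebesgue_integral_def
  proof (rule integral_mono_AE[OF int[unfolded set_integrable_def] intH[unfolded set_integrable_def]])
    show "AE t in lebesgue. indicator {T..2 * T} t *\<^sub>R \<bar>X t\<bar> ^ ?n \<le> indicator {T..2 * T} t *\<^sub>R H t"
      using AE by eventually_elim (use le H0 in \<open>auto simp: indicator_def\<close>)
  qed
  also have "\<dots> = integral {T..2 * T} H" by (rule set_lebesgue_integral_eq_integral(2)[OF intH])
  also have "\<dots> = 5 ^ ?n * (integral {T..2 * T} h1 + integral {T..2 * T} h2 + integral {T..2 * T} h3 + integral {T..2 * T} h4
      + T * (B * real k) ^ ?n)"
  proof -
    have i: "(h1 has_integral integral {T..2 * T} h1) {T..2 * T}" "(h2 has_integral integral {T..2 * T} h2) {T..2 * T}"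
      "(h3 has_integral integral {T..2 * T} h3) {T..2 * T}" "(h4 has_integral integral {T..2 * T} h4) {T..2 * T}"
      by (rule integrable_integral[OF integrable_continuous_interval], rule cont)+
    have "((\<lambda>t. (B * real k) ^ ?n) has_integral T * (B * real k) ^ ?n) {T..2 * T}"
      using has_integral_const_real[of "(B * real k) ^ ?n" T "2 * T"] k(3) by simp
    from has_integral_mult_right[OF has_integral_add[OF has_integral_add[OF has_integral_add[OF has_integral_add[OF i(1,2)] i(3)] i(4)] this], of "5 ^ ?n"]
    show ?thesis unfolding H_def by (rule integral_unique)
  qed
  also have "\<dots> \<le> 5 ^ ?n * (8 * T * fact k * (B\<^sup>2 * (9 * ln (3 * ln T))) ^ k + T * (B * real k) ^ ?n)"
  proof -
    let ?R = "2 * T * fact k * (B\<^sup>2 * (9 * ln (3 * ln T))) ^ k"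
    have T3: "T \<ge> 3" using T41 by simp
    have "integral {T..2 * T} h1 \<le> ?R" "integral {T..2 * T} h3 \<le> ?R"
      unfolding h1_def h3_def by (rule prime_sum_moment(1)[OF c(1) NT1 T3 NT], rule prime_sum_moment(1)[OF c(3) NT1 T3 NT])
    moreover have "integral {T..2 * T} h2 \<le> ?R" "integral {T..2 * T} h4 \<le> ?R"
      unfolding h2_def h4_def by (rule prime_sum_moment(2)[OF c(2) NT1 T3 NT], rule prime_sum_moment(2)[OF c(4) NT1 T3 NT])
    ultimately have "integral {T..2 * T} h1 + integral {T..2 * T} h2 + integral {T..2 * T} h3 + integral {T..2 * T} h4
        \<le> 8 * T * fact k * (B\<^sup>2 * (9 * ln (3 * ln T))) ^ k" by linarith
    then show ?thesis by (intro mult_left_mono add_right_mono) auto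
  qed
  finally show "(LINT t:{T..2 * T}|lebesgue. \<bar>X t\<bar> ^ ?n)
           \<le> 5 ^ ?n * (8 * T * fact k * (B\<^sup>2 * (9 * ln (3 * ln T))) ^ k + T * (B * real k) ^ ?n)" .
qed

text \<open>This is where \<open>k \<le> K l\<close> enters: the error \<open>(B k)\<^sup>2\<close> is at most \<open>B\<^sup>2 K k l\<close>, of the same
  shape as the contribution of the primes. The factor \<open>9\<close> from the four polynomials and the error is
  absorbed into the \<open>k\<close>-th power, as is \<open>5\<close> to the power \<open>2 k\<close>.\<close>

lemma combine_constants:
  fixes k :: nat
  assumes k: "k \<ge> 1" "real k \<le> K * l" and K: "K > 0" and l: "l \<ge> 1" and u: "0 \<le> u" "u \<le> 3 * l" and B: "B \<ge> 1"
  shows "5 ^ (2 * k) * (8 * fact k * (B\<^sup>2 * (9 * u)) ^ k + (B * real k) ^ (2 * k)) \<le> (225 * (27 + K) * B\<^sup>2 * real k * l) ^ k"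
proof -
  let ?M = "(27 + K) * B\<^sup>2 * real k * l"
  have "fact k \<le> real (k ^ k)" by (rule fact_le_power)
  then have "fact k \<le> real k ^ k" by simp
  then have "fact k * (B\<^sup>2 * (9 * u)) ^ k \<le> real k ^ k * (B\<^sup>2 * (9 * (3 * l))) ^ k"
    using u by (intro mult_mono power_mono mult_left_mono) auto
  also have "\<dots> = (27 * B\<^sup>2 * real k * l) ^ k" by (simp add: power_mult_distrib mult_ac)
  also have "\<dots> \<le> ?M ^ k"
    using K l by (intro power_mono mult_right_mono) auto
  finally have 1: "8 * fact k * (B\<^sup>2 * (9 * u)) ^ k \<le> 8 * ?M ^ k" by simp
  have "(B * real k) ^ (2 * k) = (B\<^sup>2 * real k * real k) ^ k"
    by (simp add: power_mult power_mult_distrib power2_eq_square mult_ac)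
  also have "\<dots> \<le> (B\<^sup>2 * real k * (K * l)) ^ k"
    using k by (intro power_mono mult_left_mono) auto
  also have "B\<^sup>2 * real k * (K * l) = K * B\<^sup>2 * real k * l" by simp
  also have "\<dots> ^ k \<le> ?M ^ k"
    using K l by (intro power_mono mult_right_mono) auto
  finally have 2: "(B * real k) ^ (2 * k) \<le> ?M ^ k" .
  have M0: "?M ^ k \<ge> 0"
  proof -
    have "?M \<ge> 0" using K l by (intro mult_nonneg_nonneg) auto
    then show ?thesis by (rule zero_le_power)
  qed
  have five: "(5 :: real) ^ (2 * k) = 25 ^ k" by (simp add: power_mult)
  have "5 ^ (2 * k) * (8 * fact k * (B\<^sup>2 * (9 * u)) ^ k + (B * real k) ^ (2 * k)) \<le> 25 ^ k * (8 * ?M ^ k + ?M ^ k)"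
    unfolding five by (rule mult_left_mono[OF add_mono[OF 1 2]]) simp
  also have "8 * ?M ^ k + ?M ^ k = 9 * ?M ^ k" by simp
  also have "9 * ?M ^ k \<le> 9 ^ k * ?M ^ k"
    using M0 power_increasing[of 1 k "9::real"] k by (intro mult_right_mono) auto
  also have "25 ^ k * (9 ^ k * ?M ^ k) = (25 * 9 * ?M) ^ k" by (simp only: power_mult_distrib mult.assoc)
  also have "25 * 9 * ?M = 225 * (27 + K) * B\<^sup>2 * real k * l" by simp
  finally show ?thesis by (simp add: mult_left_mono)
qed

theorem moment_bound_exists:
  assumes X: "is_X chi X" and K: "K > 0"
  shows "\<exists>C>0. \<exists>T0\<ge>3. moment_bound q X K C T0"
proof -
  obtain B where B: "B \<ge> 1"
    "\<And>T k. 1 \<le> k \<Longrightarrow> 40 * real k \<le> ln T \<Longrightarrow> T > 0 \<Longrightarrow> argument_approximable B T k"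
    using argument_approximation by blast
  define Q where "Q = real q"
  have Q: "Q \<ge> 1" using q_gt_1 by (simp add: Q_def)
  have "\<forall>\<^sub>F T in at_top. 40 * K * ln (ln (Q * T)) \<le> ln T"
    using Q K by real_asymp
  moreover have "\<forall>\<^sub>F T in at_top. ln (ln (Q * T)) \<ge> 1" using Q by real_asymp
  moreover have "\<forall>\<^sub>F T :: real in at_top. ln (ln T) \<ge> 1" by real_asymp
  ultimately have "\<forall>\<^sub>F T in at_top. 40 * K * ln (ln (Q * T)) \<le> ln T \<and> ln (ln (Q * T)) \<ge> 1 \<and> ln (ln T) \<ge> 1"
    by eventually_elim blast
  then obtain T1 where T1: "\<And>T. T \<ge> T1 \<Longrightarrow> 40 * K * ln (ln (Q * T)) \<le> ln T \<and> ln (ln (Q * T)) \<ge> 1 \<and> ln (ln T) \<ge> 1"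
    by (auto simp: eventually_at_top_linorder)
  define C where "C = 225 * (27 + K) * B\<^sup>2"
  have C: "C > 0" unfolding C_def using K B(1) by (intro mult_pos_pos) auto
  have "moment_bound q X K C (max 3 T1)"
    unfolding moment_bound_def
  proof (intro allI impI)
    fix T :: real and k :: nat
    assume T: "T \<ge> max 3 T1" and k: "1 \<le> k \<and> real k \<le> K * LT q T"
    define l where "l = LT q T"
    have l_eq: "l = ln (ln (Q * T))" by (simp add: l_def LT_def Q_def)
    have T3: "T \<ge> 3" "T > 0" using T by auto
    have big: "40 * K * l \<le> ln T" "l \<ge> 1" "ln (ln T) \<ge> 1" using T1[of T] T unfolding l_eq by auto
    have k40: "40 * real k \<le> ln T" using k big(1) by (simp add: l_def)
    have lnT: "ln T \<ge> 40" using k40 k by linarith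
    have u: "0 \<le> ln (3 * ln T)" "ln (3 * ln T) \<le> 3 * l"
    proof -
      show "0 \<le> ln (3 * ln T)" using lnT by simp
      have "ln (3 * ln T) = ln 3 + ln (ln T)" using lnT by (simp add: ln_mult)
      also have "ln (3 :: real) \<le> 2" using ln_le_minus_one[of 3] by simp
      also have "ln (ln T) \<le> l"
      proof -
        have "T \<le> Q * T" using Q T3 mult_right_mono[of 1 Q T] by simp
        then have "ln T \<le> ln (Q * T)" using T3 Q by (subst ln_le_cancel_iff) auto
        then show ?thesis unfolding l_eq using lnT by (subst ln_le_cancel_iff) auto
      qed
      finally show "ln (3 * ln T) \<le> 3 * l" using big(2) by simp
    qed
    have k1: "k \<ge> 1" using k by simp
    note mom = moment_le[OF X B(1) k1 k40 T3(2) B(2)[OF k1 k40 T3(2)]]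
    show "set_integrable lebesgue {T..2 * T} (\<lambda>t. \<bar>X t\<bar> ^ (2 * k)) \<and>
        1 / T * (LINT t:{T..2 * T}|lebesgue. \<bar>X t\<bar> ^ (2 * k)) \<le> (C * real k * LT q T) ^ k"
    proof
      show "set_integrable lebesgue {T..2 * T} (\<lambda>t. \<bar>X t\<bar> ^ (2 * k))"
        by (rule mom(1))
      have "(LINT t:{T..2 * T}|lebesgue. \<bar>X t\<bar> ^ (2 * k))
           \<le> 5 ^ (2 * k) * (8 * T * fact k * (B\<^sup>2 * (9 * ln (3 * ln T))) ^ k + T * (B * real k) ^ (2 * k))"
        by (rule mom(2))
      then have "1 / T * (LINT t:{T..2 * T}|lebesgue. \<bar>X t\<bar> ^ (2 * k))
           \<le> 1 / T * (5 ^ (2 * k) * (8 * T * fact k * (B\<^sup>2 * (9 * ln (3 * ln T))) ^ k + T * (B * real k) ^ (2 * k)))"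
        using T3 by (intro mult_left_mono) auto
      also have "\<dots> = 5 ^ (2 * k) * (8 * fact k * (B\<^sup>2 * (9 * ln (3 * ln T))) ^ k + (B * real k) ^ (2 * k))"
        using T3 by (simp add: field_simps)
      also have "\<dots> \<le> (225 * (27 + K) * B\<^sup>2 * real k * l) ^ k"
        using k by (intro combine_constants k1 K big u B(1)) (simp add: l_def)
      finally show "1 / T * (LINT t:{T..2 * T}|lebesgue. \<bar>X t\<bar> ^ (2 * k)) \<le> (C * real k * LT q T) ^ k"
        by (simp add: C_def l_def)
    qed
  qed
  then show ?thesis using C by (intro exI[of _ C] conjI exI[of _ "max 3 T1"]) auto
qed

end

section \<open>From moments to large values\<close>

text \<open>Markov's inequality for the \<open>2 k\<close>-th power gives \<open>(C k L / V\<^sup>2)\<^sup>k\<close> with \<open>L = LT q T\<close>, which is least near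
  \<open>k = V\<^sup>2 / (e C L)\<close>. The range of \<open>V\<close> is what makes the integer part of this number an admissible \<open>k\<close>.\<close>

theorem tail_bound_from_moment_bound:
  assumes q: "q \<ge> 3" and C: "C > 0" and T0: "T0 \<ge> 3" and K: "K > 0" and mb: "moment_bound q X K C T0"
  shows "tail_bound q X K C T0"
  unfolding tail_bound_def
proof (intro allI impI)
  fix T V :: real
  assume T: "T \<ge> T0" and V: "sqrt (exp 1 * C * LT q T) \<le> V \<and> V \<le> sqrt (exp 1 * C * K) * LT q T"
  define l where "l = LT q T"
  define y where "y = V\<^sup>2 / (exp 1 * C * l)"
  define k where "k = nat \<lfloor>y\<rfloor>"
  have l: "l > 0"
  proof -
    have "exp 1 < real q * T"
    proof -
      have "3 * 3 \<le> real q * T" using q T T0 by (intro mult_mono) auto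
      then show ?thesis using exp_le by simp
    qed
    then have "ln (real q * T) > 1" by (metis exp_gt_zero ln_exp ln_less_cancel_iff order.strict_trans)
    then show ?thesis by (simp add: l_def LT_def)
  qed
  have ecl: "exp 1 * C * l > 0" using C l by simp
  have V0: "V > 0" using V ecl unfolding l_def[symmetric] by (smt (verit) real_sqrt_gt_zero)
  have "exp 1 * C * l \<le> V\<^sup>2"
    using V V0 unfolding l_def[symmetric] by (metis real_sqrt_le_iff real_sqrt_unique less_imp_le)
  then have y1: "y \<ge> 1" using ecl by (simp add: y_def)
  have "V\<^sup>2 \<le> (sqrt (exp 1 * C * K) * l)\<^sup>2" using V V0 by (intro power_mono) (auto simp: l_def)
  also have "\<dots> = exp 1 * C * K * l\<^sup>2" using C K by (simp add: power_mult_distrib)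
  finally have "y \<le> exp 1 * C * K * l\<^sup>2 / (exp 1 * C * l)"
    unfolding y_def using ecl by (intro divide_right_mono) auto
  also have "\<dots> = K * l" using C l by (simp add: power2_eq_square)
  finally have yK: "y \<le> K * l" .
  have k1: "k \<ge> 1" using y1 by (simp add: k_def le_nat_iff le_floor_iff)
  have k_floor: "real k = of_int \<lfloor>y\<rfloor>" using y1 by (simp add: k_def)
  have ky: "real k \<le> y" "y < real k + 1"
    unfolding k_floor using floor_correct[of y] by simp_all
  have mom: "set_integrable lebesgue {T..2 * T} (\<lambda>t. \<bar>X t\<bar> ^ (2 * k))"
    "1 / T * (LINT t:{T..2 * T}|lebesgue. \<bar>X t\<bar> ^ (2 * k)) \<le> (C * real k * l) ^ k"
    using mb T k1 ky(1) yK unfolding moment_bound_def l_def by (auto intro: order_trans)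
  let ?A = "{t \<in> {T..2 * T}. \<bar>X t\<bar> > V}"
  let ?f = "\<lambda>t. indicator {T..2 * T} t *\<^sub>R \<bar>X t\<bar> ^ (2 * k)"
  have int: "integrable lebesgue ?f" using mom(1) by (simp add: set_integrable_def)
  have gt: "\<bar>x\<bar> > V \<longleftrightarrow> \<bar>x\<bar> ^ (2 * k) > V ^ (2 * k)" for x
    using V0 k1 power_strict_mono[of V "\<bar>x\<bar>" "2 * k"] power_mono[of "\<bar>x\<bar>" V "2 * k"] by (auto simp: not_less[symmetric])
  have A_eq: "?A = {t \<in> space lebesgue. V ^ (2 * k) < ?f t}"
    using V0 gt by (auto simp: indicator_def not_less zero_le_power split: if_splits)
  have A: "?A \<in> sets lebesgue" unfolding A_eq
    using borel_measurable_integrable[OF int] by measurable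
  have Vp: "V ^ (2 * k) > 0" using V0 by simp
  have fm: "{t \<in> space lebesgue. V ^ (2 * k) \<le> ?f t} \<in> fmeasurable lebesgue"
  proof (rule fmeasurableI)
    show "{t \<in> space lebesgue. V ^ (2 * k) \<le> ?f t} \<in> sets lebesgue"
      using borel_measurable_integrable[OF int] by measurable
    have "emeasure lebesgue {t \<in> space lebesgue. V ^ (2 * k) \<le> ?f t} \<le> ennreal (1 / V ^ (2 * k) * (LINT t|lebesgue. ?f t))"
      by (rule integral_Markov_inequality[OF int _ Vp]) auto
    also have "\<dots> < \<infinity>" by simp
    finally show "emeasure lebesgue {t \<in> space lebesgue. V ^ (2 * k) \<le> ?f t} < \<infinity>" .
  qed
  have "measure lebesgue ?A \<le> measure lebesgue {t \<in> space lebesgue. V ^ (2 * k) \<le> ?f t}"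
  proof (rule measure_mono_fmeasurable[OF _ A fm])
    show "?A \<subseteq> {t \<in> space lebesgue. V ^ (2 * k) \<le> ?f t}" unfolding A_eq by auto
  qed
  also have "\<dots> \<le> (LINT t|lebesgue. ?f t) / V ^ (2 * k)"
    by (rule integral_Markov_inequality_measure[OF int, of "{}"]) (use Vp in auto)
  finally have "1 / T * measure lebesgue ?A \<le> 1 / T * ((LINT t|lebesgue. ?f t) / V ^ (2 * k))"
    by (rule mult_left_mono) (use T T0 in simp)
  also have "\<dots> = (1 / T * (LINT t:{T..2 * T}|lebesgue. \<bar>X t\<bar> ^ (2 * k))) / V ^ (2 * k)"
    by (simp add: set_lebesgue_integral_def)
  also have "\<dots> \<le> (C * real k * l) ^ k / V ^ (2 * k)"
    using mom(2) Vp by (intro divide_right_mono) auto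
  also have "\<dots> = (C * real k * l / V\<^sup>2) ^ k" by (simp add: power_mult power_divide)
  \<comment> \<open>The quotient \<open>k / y\<close> is at most \<open>1\<close>, so each of the \<open>k\<close> factors is at most \<open>1 / e\<close>.\<close>
  also have "C * real k * l / V\<^sup>2 = real k / y * exp (- 1)"
    using C l V0 by (simp add: y_def exp_minus field_simps)
  also have "(real k / y * exp (- 1)) ^ k \<le> exp (- 1) ^ k"
    using ky(1) y1 by (intro power_mono) (auto simp: divide_le_eq)
  also have "exp (- 1 :: real) ^ k = exp (- real k)" by (simp add: exp_of_nat_mult[symmetric])
  also have "\<dots> \<le> exp (- (V\<^sup>2 / (2 * exp 1 * C * l)))"
  proof -
    \<comment> \<open>The integer part of a number \<open>y \<ge> 1\<close> is at least \<open>y / 2\<close>; this is the loss of \<open>2\<close> in the exponent.\<close>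
    have "y / 2 \<le> real k" using ky(2) k1 by linarith
    moreover have e: "V\<^sup>2 / (2 * exp 1 * C * l) = y / 2" by (simp add: y_def)
    ultimately show ?thesis unfolding e by simp
  qed
  finally show "?A \<in> sets lebesgue \<and> 1 / T * measure lebesgue ?A \<le> exp (- (V\<^sup>2 / (2 * exp 1 * C * LT q T)))"
    unfolding l_def by (rule conjI[OF A])
qed

theorem corollary5p1:
  fixes q :: nat and chi :: "nat \<Rightarrow> complex" and K :: real and X :: "real \<Rightarrow> real"
  assumes "q \<ge> 3" and "squarefree q" and "odd q"
    and "primitive_character q chi" and "chi \<noteq> principal_character q"
    and "GRH chi"
    and "is_X chi X"
    and "K > 0"
  shows "(\<exists>C>0. \<exists>T0\<ge>3. moment_bound q X K C T0) \<and>
         (\<forall>C>0. \<forall>T0\<ge>3. moment_bound q X K C T0 \<longrightarrow> tail_bound q X K C T0)"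
proof -
  interpret grh_character q chi
    using assms by unfold_locales (auto simp: primitive_character_def)
  show ?thesis
    using moment_bound_exists[OF assms(7,8)] tail_bound_from_moment_bound[OF assms(1) _ _ assms(8)] by blast
qed

end
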